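(* For every $n\ge 3$, the $3$-uniform hypergraphs $X^n$ and $Y^n$ on the vertex set $\{0,1,\dots,2^n\}$ defined in the context are hypomorphic, but their characteristic polynomials are different.
   Context: **Hypergraphs and Lagrangians.** A hypergraph is a pair $(V,E)$ with $E\subseteq 2^V$; it is uniform of rank $m$ if all edges have size $m$. A uniform hypergraph $\mathcal H$ is identified with its Lagrangian polynomial $\mathcal H(\mathbf x)=\sum_{e\in E(\mathcal H)}\prod_{i\in e}x_i$. **Hypomorphic.** Two uniform hypergraphs $\mathcal H,\mathcal G$ of the same rank on the same vertex set $V$ are hypomorphic if there is a permutation $\eta$ of $V$ such that the vertex-deleted induced subhypergraphs $\mathcal H-i$ and $\mathcal G-\eta(i)$ are isomorphic for every $i\in V$. **Characteristic polynomial.** For $\mathcal H$ uniform of rank $m$ on a finite vertex set $V$, the (normalized) adjacency hypermatrix has entries $a_{i_1\dots i_m}=\frac1{(m-1)!}$ if $\{i_1,\dots,i_m\}\in E(\mathcal H)$ and $0$ otherwise. The characteristic polynomial of $\mathcal H$ is the characteristic polynomial of this hypermatrix in the usual sense, i.e. the polynomial in $t$ given by the multivariate (Macaulay) resultant of the $|V|$ homogeneous polynomials $t\,x_j^{m-1}-\sum_{i_2,\dots,i_m}a_{ji_2\dots i_m}x_{i_2}\cdots x_{i_m}$ $(j\in V)$ of degree $m-1$ in the variables $(x_i)_{i\in V}$. (Its roots are exactly the eigenvalues: those $\lambda\in\mathbb C$ for which there is a nonzero $\mathbf x\in\mathbb C^V$ with $\sum a_{ji_2\dots i_m}x_{i_2}\cdots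 x_{i_m}=\lambda x_j^{m-1}$ for all $j$.) **Construction.** Let $V_n=\{1,\dots,2^n\}$. In polynomials of level $n$ (superscript $n$), indices of variables are reduced modulo $2^n$ to the representative in $V_n$; $x_0$ is an additional separate variable (never obtained by such a reduction). For $2\le r\le n$ let $\mathrm E^n_r$ be the $\mathbb C$-algebra homomorphism with $\mathrm E^n_r(x_i)=\sum_{j\in V_n,\ j\equiv i\ (\mathrm{mod}\ 2^r)}x_j$ (so $\mathrm E_n^n$ is the identity). For $n\ge 4$ let $p^n_0,p^n_1:\mathbb C[x_1,\dots,x_{2^{n-1}}]\to\mathbb C[x_1,\dots,x_{2^n}]$ be the $\mathbb C$-algebra homomorphisms with $p^n_0(x_i)=x_{2i}$, $p^n_1(x_i)=x_{2i-1}$. Define - $G_3^3=\sum_{i=1}^8 x_{i-1}x_ix_{i+1}+\sum_{i=1}^8x_{i-3}x_ix_{i+3}$ (indices modulo $8$ in $V_3$), and $G_n^n=\mathrm E_3^n(G_3^3)$ for $n\ge4$; - $G_2^3=\sum_{i=1}^4x_ix_{i+2}x_{i+4}$, and $G_k^n=p_0^n(G_k^{n-1})+p_1^n(G_k^{n-1})$ for $n\ge 4$, $2\le k<n$; - $\Gamma_n=\sum_{k=2}^nG_k^n$; - $M_0^n=x_0\,\mathrm E_2^n(x_1x_2+x_3x_4)$, $M_1^n=x_0\,\mathrm E_2^n(x_1x_4+x_2x_3)$; - $X^n=\Gamma_n+M_0^n$, $Y^n=\Gamma_n+M_1^n$. Each of these polynomials is the Lagrangian of a $3$-uniform hypergraph;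 $X^n,Y^n$ have vertex set $\{0,1,\dots,2^n\}$. *)

theory Defs
  imports
    "HOL-Library.Poly_Mapping"
    "HOL-Combinatorics.Permutations"
    "HOL-Computational_Algebra.Computational_Algebra"
    "HOL-Computational_Algebra.Field_as_Ring"
begin

section \<open>Multivariate polynomials\<close>

text \<open>An exponent vector is a finitely supported map from variables to \<^typ>\<open>nat\<close>; the
  product of \<^type>\<open>poly_mapping\<close> is convolution, hence polynomial multiplication.\<close>

type_synonym 'v monom = "'v \<Rightarrow>\<^sub>0 nat"
type_synonym ('v, 'a) mpoly = "('v \<Rightarrow>\<^sub>0 nat) \<Rightarrow>\<^sub>0 'a"

definition var :: "'v \<Rightarrow> ('v, 'a::comm_ring_1) mpoly" where
  "var i = Poly_Mapping.single (Poly_Mapping.single i 1) 1"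

definition const :: "'a \<Rightarrow> ('v, 'a::comm_ring_1) mpoly" where
  "const c = Poly_Mapping.single 0 c"

text \<open>The algebra homomorphism that sends the variable \<open>i\<close> to \<open>s i\<close>.\<close>

definition poly_subst ::
    "('v \<Rightarrow> ('w, 'a::comm_ring_1) mpoly) \<Rightarrow> ('v, 'a) mpoly \<Rightarrow> ('w, 'a) mpoly" where
  "poly_subst s p =
     (\<Sum>\<alpha>\<in>Poly_Mapping.keys p. const (Poly_Mapping.lookup p \<alpha>) *
        (\<Prod>i\<in>Poly_Mapping.keys \<alpha>. s i ^ Poly_Mapping.lookup \<alpha> i))"

section \<open>Hypergraphs\<close>

type_synonym 'v hypergraph = "'v set \<times> 'v set set"

abbreviation vertices :: "'v hypergraph \<Rightarrow> 'v set" where "vertices H \<equiv> fst H"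
abbreviation edges :: "'v hypergraph \<Rightarrow> 'v set set" where "edges H \<equiv> snd H"

definition uniform_hypergraph :: "nat \<Rightarrow> 'v hypergraph \<Rightarrow> bool" where
  "uniform_hypergraph m H \<longleftrightarrow>
     finite (vertices H) \<and> edges H \<subseteq> Pow (vertices H) \<and> (\<forall>e\<in>edges H. card e = m)"

definition lagrangian :: "'v hypergraph \<Rightarrow> ('v, complex) mpoly" where
  "lagrangian H = (\<Sum>e\<in>edges H. \<Prod>i\<in>e. var i)"

definition delete_vertex :: "'v hypergraph \<Rightarrow> 'v \<Rightarrow> 'v hypergraph" where
  "delete_vertex H i = (vertices H - {i}, {e \<in> edges H. i \<notin> e})"

definition hypergraph_iso :: "'v hypergraph \<Rightarrow> 'w hypergraph \<Rightarrow> bool" where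
  "hypergraph_iso H G \<longleftrightarrow>
     (\<exists>f. bij_betw f (vertices H) (vertices G) \<and> (\<lambda>e. f ` e) ` edges H = edges G)"

definition hypomorphic :: "'v hypergraph \<Rightarrow> 'v hypergraph \<Rightarrow> bool" where
  "hypomorphic H G \<longleftrightarrow>
     vertices H = vertices G \<and> (\<exists>m. uniform_hypergraph m H \<and> uniform_hypergraph m G) \<and>
     (\<exists>\<eta>. bij_betw \<eta> (vertices H) (vertices H) \<and>
        (\<forall>i\<in>vertices H. hypergraph_iso (delete_vertex H i) (delete_vertex G (\<eta> i))))"

section \<open>The Macaulay resultant\<close>

text \<open>Let \<open>F j\<close>, for \<open>j\<close> in the finite set \<open>V\<close>, be homogeneous of degree \<open>d j \<ge> 1\<close> in the
  variables \<open>V\<close>. Macaulay's resultant is the quotient \<open>D / D'\<close> of two determinants. The rows and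
  columns of \<open>D\<close> are indexed by the monomials of degree \<open>1 + (\<Sum>j\<in>V. d j - 1)\<close>. Each such monomial
  \<open>x^\<alpha>\<close> is divisible by some \<open>x_i^(d i)\<close>, and for the least such \<open>i\<close> the row of \<open>\<alpha>\<close> contains the
  coefficients of \<open>(x^\<alpha> / x_i^(d i)) F i\<close>. In \<open>D'\<close> only those monomials are kept that are not
  reduced, a monomial being reduced if it is divisible by \<open>x_i^(d i)\<close> for exactly one \<open>i\<close>.
  The value is normalised to 1 at the system \<open>F j = x_j^(d j)\<close>. The formula
  determines the resultant whenever \<open>D' \<noteq> 0\<close>, and then does not depend on the order on \<open>V\<close>; it is
  used here only for systems for which \<open>D' \<noteq> 0\<close>.\<close>

definition det_on :: "'i set \<Rightarrow> ('i \<Rightarrow> 'i \<Rightarrow> 'a::comm_ring_1) \<Rightarrow> 'a" where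
  "det_on S A = (\<Sum>p | p permutes S. of_int (sign p) * (\<Prod>i\<in>S. A i (p i)))"

definition macaulay_monoms :: "'v set \<Rightarrow> ('v \<Rightarrow> nat) \<Rightarrow> 'v monom set" where
  "macaulay_monoms V d =
     {\<alpha>. Poly_Mapping.keys \<alpha> \<subseteq> V \<and>
         (\<Sum>i\<in>V. Poly_Mapping.lookup \<alpha> i) = 1 + (\<Sum>i\<in>V. d i - 1)}"

definition nonreduced_monoms :: "'v set \<Rightarrow> ('v \<Rightarrow> nat) \<Rightarrow> 'v monom set" where
  "nonreduced_monoms V d =
     {\<alpha> \<in> macaulay_monoms V d. card {i\<in>V. d i \<le> Poly_Mapping.lookup \<alpha> i} \<noteq> 1}"

definition macaulay_matrix ::
    "'v::linorder set \<Rightarrow> ('v \<Rightarrow> nat) \<Rightarrow> ('v \<Rightarrow> ('v, 'a::comm_ring_1) mpoly) \<Rightarrow>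
     'v monom \<Rightarrow> 'v monom \<Rightarrow> 'a" where
  "macaulay_matrix V d F \<alpha> \<beta> =
     (let i = Min {i\<in>V. d i \<le> Poly_Mapping.lookup \<alpha> i}
      in Poly_Mapping.lookup
           (Poly_Mapping.single (\<alpha> - Poly_Mapping.single i (d i)) 1 * F i) \<beta>)"

definition macaulay_resultant ::
    "'v::linorder set \<Rightarrow> ('v \<Rightarrow> nat) \<Rightarrow> ('v \<Rightarrow> ('v, 'a::idom) mpoly) \<Rightarrow> 'a fract" where
  "macaulay_resultant V d F =
     Fract (det_on (macaulay_monoms V d) (macaulay_matrix V d F))
           (det_on (nonreduced_monoms V d) (macaulay_matrix V d F))"

section \<open>The characteristic polynomial of a uniform hypergraph\<close>

definition adjacency_entry :: "nat \<Rightarrow> 'v hypergraph \<Rightarrow> 'v list \<Rightarrow> complex" where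
  "adjacency_entry m H is = (if set is \<in> edges H then 1 / fact (m - 1) else 0)"

definition char_system :: "nat \<Rightarrow> 'v hypergraph \<Rightarrow> 'v \<Rightarrow> ('v, complex poly) mpoly" where
  "char_system m H j =
     const [:0, 1:] * var j ^ (m - 1) -
     (\<Sum>is | set is \<subseteq> vertices H \<and> length is = m - 1.
        const [:adjacency_entry m H (j # is):] * prod_list (map var is))"

text \<open>For this system both Macaulay matrices are of the form \<open>t I - A\<close> with \<open>A\<close> constant, so their
  determinants are monic in \<open>t\<close> and the quotient is defined. The resultant is a polynomial in the
  coefficients of the system, so the quotient lies in \<open>\<complex>[t]\<close>. In lowest terms with monic
  denominator its denominator is therefore 1, and its numerator is the resultant itself.\<close>

definition characteristic_polynomial :: "nat \<Rightarrow> 'v::linorder hypergraph \<Rightarrow> complex poly" where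
  "characteristic_polynomial m H =
     fst (quot_of_fract (macaulay_resultant (vertices H) (\<lambda>_. m - 1) (char_system m H)))"

section \<open>The construction\<close>

text \<open>Reduction of an index modulo \<open>2^n\<close> to its representative in \<open>{1..2^n}\<close>.\<close>

definition red :: "nat \<Rightarrow> int \<Rightarrow> nat" where
  "red n i = nat ((i - 1) mod 2 ^ n + 1)"

definition E_hom :: "nat \<Rightarrow> nat \<Rightarrow> (nat, complex) mpoly \<Rightarrow> (nat, complex) mpoly" where
  "E_hom r n = poly_subst (\<lambda>i. \<Sum>j | j \<in> {1..2 ^ n} \<and> j mod 2 ^ r = i mod 2 ^ r. var j)"

definition p0_hom :: "(nat, complex) mpoly \<Rightarrow> (nat, complex) mpoly" where
  "p0_hom = poly_subst (\<lambda>i. var (2 * i))"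

definition p1_hom :: "(nat, complex) mpoly \<Rightarrow> (nat, complex) mpoly" where
  "p1_hom = poly_subst (\<lambda>i. var (2 * i - 1))"

definition G33 :: "(nat, complex) mpoly" where
  "G33 = (\<Sum>i=1..8. var (red 3 (i - 1)) * var (red 3 i) * var (red 3 (i + 1))) +
         (\<Sum>i=1..8. var (red 3 (i - 3)) * var (red 3 i) * var (red 3 (i + 3)))"

definition G23 :: "(nat, complex) mpoly" where
  "G23 = (\<Sum>i=1..4. var i * var (i + 2) * var (i + 4))"

text \<open>\<open>Gpoly k n\<close> is the polynomial with lower index \<open>k\<close> and level \<open>n\<close>, meaningful for
  \<open>n \<ge> 3\<close> and \<open>2 \<le> k \<le> n\<close>.\<close>

fun Gpoly :: "nat \<Rightarrow> nat \<Rightarrow> (nat, complex) mpoly" where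
  "Gpoly k n =
     (if n < 3 \<or> k < 2 \<or> n < k then 0
      else if n = 3 then (if k = 3 then G33 else G23)
      else if k = n then E_hom 3 n G33
      else p0_hom (Gpoly k (n - 1)) + p1_hom (Gpoly k (n - 1)))"

declare Gpoly.simps [simp del]

definition Gamma_poly :: "nat \<Rightarrow> (nat, complex) mpoly" where
  "Gamma_poly n = (\<Sum>k=2..n. Gpoly k n)"

definition M0_poly :: "nat \<Rightarrow> (nat, complex) mpoly" where
  "M0_poly n = var 0 * E_hom 2 n (var 1 * var 2 + var 3 * var 4)"

definition M1_poly :: "nat \<Rightarrow> (nat, complex) mpoly" where
  "M1_poly n = var 0 * E_hom 2 n (var 1 * var 4 + var 2 * var 3)"

definition X_poly :: "nat \<Rightarrow> (nat, complex) mpoly" where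
  "X_poly n = Gamma_poly n + M0_poly n"

definition Y_poly :: "nat \<Rightarrow> (nat, complex) mpoly" where
  "Y_poly n = Gamma_poly n + M1_poly n"

end

theory Submission
  imports Defs "Jordan_Normal_Form.Determinant" "HOL-Analysis.Function_Topology" "HOL-Library.Nat_Bijection"
begin

text \<open>Both Macaulay matrices are \<open>t I - A\<close> with \<open>A \<ge> 0\<close>. If \<open>x > 0\<close> is an eigenvector of the hypergraph
  with eigenvalue \<open>\<lambda>\<close>, then the monomial values \<open>x^\<alpha>\<close> form a positive eigenvector of \<open>A\<close> for \<open>\<lambda>\<close>, so
  neither determinant vanishes beyond \<open>\<lambda>\<close>; at \<open>\<lambda>\<close> the larger one vanishes and the smaller one does not,
  because every nonreduced monomial leads to a reduced one. So \<open>\<lambda>\<close> is the largest real root of the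
  characteristic polynomial, and no property of resultants is needed.

  Let \<open>x\<close> be the Perron vector of \<open>X\<close>, with class sums \<open>S\<^sub>1, \<dots>, S\<^sub>4\<close> modulo 4. The reversal gives
  \<open>S\<^sub>1 = S\<^sub>4\<close> and \<open>S\<^sub>2 = S\<^sub>3\<close>, hence \<open>Y(x) - X(x) = x\<^sub>0 (S\<^sub>1 - S\<^sub>2)\<^sup>2\<close> and the Perron root of \<open>Y\<close> is at least
  that of \<open>X\<close>. Equality would force all class sums to agree, which is impossible by descent on \<open>n\<close>.\<close>

section \<open>Determinants over finite index sets\<close>

text \<open>The characteristic polynomial is the reduced numerator of a quotient of two
  determinants, so a zero of the larger one could be lost by cancellation; this is why the smaller
  one has to be controlled at \<lambda>. A positive eigenvector exists because the Lagrangian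
  attains a maximum on nonnegative vectors with sum of cubes 1, and the hub 0, which shares an edge
  with every other vertex, makes the maximizer positive. AM-GM on each edge, applied to the ratios
  y_i / x_i, gives 3 H(y) <= \<lambda> * (sum of y_i^3) for all y >= 0, with equality only if the
  ratios are constant on each edge. This inequality compares the two roots, and its equality case
  shows that x is invariant under the reversal, an automorphism fixing the hub. If all class sums
  equal S, the hub contributes the same constant x_0 S to every equation, so x on 1..2^n is critical
  for the Gamma part alone plus a linear term. The descent keeps this form: each level adds six
  times a square to the constant, 6 being the number of edges of \<open>T33\<close> through a
  vertex. It ends at level 2, where vertices 1 and 2 lie on one and on two edges.\<close>

lemma det_on_eq_det:
  assumes f: "bij_betw f {0..<n} S"
  shows "det_on S A = Determinant.det (mat n n (\<lambda>(i, j). A (f i) (f j)))"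
proof -
  have S: "f ` {0..<n} = S" and inj: "inj_on f {0..<n}" using f by (auto simp: bij_betw_def)
  have bb: "bij_betw (map_permutation {0..<n} f) {p. p permutes {0..<n}} {p. p permutes S}"
  proof (rule bij_betw_byWitness[where f' = "map_permutation S (inv_into {0..<n} f)"])
    show "\<forall>p\<in>{p. p permutes {0..<n}}.
        map_permutation S (inv_into {0..<n} f) (map_permutation {0..<n} f p) = p"
      by (auto intro!: map_permutation_compose_inv[OF f] simp: inv_into_f_f[OF inj])
    show "\<forall>p\<in>{p. p permutes S}.
        map_permutation {0..<n} f (map_permutation S (inv_into {0..<n} f) p) = p"
      using map_permutation_compose_inv[OF bij_betw_inv_into[OF f]]
        bij_betw_inv_into_right[OF f] by blast
    show "map_permutation {0..<n} f ` {p. p permutes {0..<n}} \<subseteq> {p. p permutes S}"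
      using map_permutation_permutes[OF f] by auto
    show "map_permutation S (inv_into {0..<n} f) ` {p. p permutes S} \<subseteq> {p. p permutes {0..<n}}"
      using map_permutation_permutes[OF bij_betw_inv_into[OF f]] by auto
  qed
  have "det_on S A = (\<Sum>p | p permutes {0..<n}. of_int (sign (map_permutation {0..<n} f p)) *
      (\<Prod>i\<in>S. A i (map_permutation {0..<n} f p i)))"
    unfolding det_on_def
    using sum.reindex_bij_betw[OF bb, of "\<lambda>p. of_int (sign p) * (\<Prod>i\<in>S. A i (p i))"] by simp
  also have "\<dots> = (\<Sum>p | p permutes {0..<n}. of_int (sign p) * (\<Prod>i\<in>{0..<n}. A (f i) (f (p i))))"
  proof (rule sum.cong[OF refl], clarify)
    fix p assume p: "p permutes {0..<n}"
    have "(\<Prod>i\<in>S. A i (map_permutation {0..<n} f p i)) =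
        (\<Prod>i\<in>{0..<n}. A (f i) (map_permutation {0..<n} f p (f i)))"
      using prod.reindex_bij_betw[OF f, of "\<lambda>i. A i (map_permutation {0..<n} f p i)"] by simp
    also have "\<dots> = (\<Prod>i\<in>{0..<n}. A (f i) (f (p i)))"
      by (intro prod.cong refl) (simp add: map_permutation_apply[OF inj])
    finally show "of_int (sign (map_permutation {0..<n} f p)) *
        (\<Prod>i\<in>S. A i (map_permutation {0..<n} f p i)) =
        of_int (sign p) * (\<Prod>i\<in>{0..<n}. A (f i) (f (p i)))"
      using sign_map_permutation[OF inj p] by simp
  qed
  also have "\<dots> = Determinant.det (mat n n (\<lambda>(i, j). A (f i) (f j)))"
  proof (subst det_def'[of _ n])
    show "(\<Sum>p | p permutes {0..<n}. of_int (sign p) * (\<Prod>i\<in>{0..<n}. A (f i) (f (p i)))) =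
        (\<Sum>p | p permutes {0..<n}. of_int (sign p) *
          (\<Prod>i = 0..<n. mat n n (\<lambda>(i, j). A (f i) (f j)) $$ (i, p i)))"
    proof (intro sum.cong prod.cong arg_cong2[where f = "(*)"] refl)
      fix p i assume "p \<in> {p. p permutes {0..<n}}" "i \<in> {0..<n}"
      then show "A (f i) (f (p i)) = mat n n (\<lambda>(i, j). A (f i) (f j)) $$ (i, p i)"
        using permutes_in_image[of p "{0..<n}" i] by simp
    qed
  qed simp
  finally show ?thesis .
qed

text \<open>Kernel vectors are functions on the index set itself, so that no enumeration of the
  monomials enters later.\<close>

lemma det_on_eq_0_iff:
  fixes A :: "'i \<Rightarrow> 'i \<Rightarrow> 'a::field"
  assumes "finite S"
  shows "det_on S A = 0 \<longleftrightarrow>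
    (\<exists>w. (\<exists>\<alpha>\<in>S. w \<alpha> \<noteq> 0) \<and> (\<forall>\<alpha>\<in>S. (\<Sum>\<beta>\<in>S. A \<alpha> \<beta> * w \<beta>) = 0))"
proof -
  define n where "n = card S"
  obtain f where f: "bij_betw f {0..<n} S"
    using ex_bij_betw_nat_finite[OF assms] n_def by blast
  have S: "S = f ` {0..<n}" and inj: "inj_on f {0..<n}" using f by (auto simp: bij_betw_def)
  let ?B = "mat n n (\<lambda>(i, j). A (f i) (f j))"
  have B: "?B \<in> carrier_mat n n" by simp
  have row: "(?B *\<^sub>v v) $ i = (\<Sum>j\<in>{0..<n}. A (f i) (f j) * v $ j)"
    if "v \<in> carrier_vec n" "i < n" for v i
    using that by (auto simp: scalar_prod_def intro!: sum.cong)
  have "det_on S A = 0 \<longleftrightarrow> (\<exists>v. v \<in> carrier_vec n \<and> v \<noteq> 0\<^sub>v n \<and> ?B *\<^sub>v v = 0\<^sub>v n)"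
    using det_on_eq_det[OF f, of A] det_0_iff_vec_prod_zero_field[OF B] by simp
  also have "\<dots> \<longleftrightarrow> (\<exists>w. (\<exists>\<alpha>\<in>S. w \<alpha> \<noteq> 0) \<and> (\<forall>\<alpha>\<in>S. (\<Sum>\<beta>\<in>S. A \<alpha> \<beta> * w \<beta>) = 0))"
  proof
    assume "\<exists>v. v \<in> carrier_vec n \<and> v \<noteq> 0\<^sub>v n \<and> ?B *\<^sub>v v = 0\<^sub>v n"
    then obtain v where v: "v \<in> carrier_vec n" "v \<noteq> 0\<^sub>v n" "?B *\<^sub>v v = 0\<^sub>v n" by blast
    define w where "w \<alpha> = v $ inv_into {0..<n} f \<alpha>" for \<alpha>
    have w: "w (f i) = v $ i" if "i < n" for i
      using that by (simp add: w_def inv_into_f_f[OF inj])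
    from v(1,2) obtain i where "i < n" "v $ i \<noteq> 0" by (metis carrier_vecD eq_vecI index_zero_vec)
    then have "\<exists>\<alpha>\<in>S. w \<alpha> \<noteq> 0" using w S by force
    moreover have "(\<Sum>\<beta>\<in>S. A \<alpha> \<beta> * w \<beta>) = 0" if "\<alpha> \<in> S" for \<alpha>
    proof -
      from that obtain i where i: "i < n" "\<alpha> = f i" using S by auto
      have "(\<Sum>\<beta>\<in>S. A \<alpha> \<beta> * w \<beta>) = (\<Sum>j\<in>{0..<n}. A (f i) (f j) * w (f j))"
        using sum.reindex_bij_betw[OF f, of "\<lambda>\<beta>. A \<alpha> \<beta> * w \<beta>"] i by simp
      also have "\<dots> = (?B *\<^sub>v v) $ i" by (simp only: row[OF v(1) i(1)]) (simp add: w)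
      finally show ?thesis using v(3) i by simp
    qed
    ultimately show "\<exists>w. (\<exists>\<alpha>\<in>S. w \<alpha> \<noteq> 0) \<and> (\<forall>\<alpha>\<in>S. (\<Sum>\<beta>\<in>S. A \<alpha> \<beta> * w \<beta>) = 0)" by blast
  next
    assume "\<exists>w. (\<exists>\<alpha>\<in>S. w \<alpha> \<noteq> 0) \<and> (\<forall>\<alpha>\<in>S. (\<Sum>\<beta>\<in>S. A \<alpha> \<beta> * w \<beta>) = 0)"
    then obtain w where w: "\<exists>\<alpha>\<in>S. w \<alpha> \<noteq> 0" "\<And>\<alpha>. \<alpha> \<in> S \<Longrightarrow> (\<Sum>\<beta>\<in>S. A \<alpha> \<beta> * w \<beta>) = 0" by blast
    define v where "v = vec n (\<lambda>i. w (f i))"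
    have v: "v \<in> carrier_vec n" by (simp add: v_def)
    from w(1) obtain i where "i < n" "w (f i) \<noteq> 0" using S by auto
    then have "v \<noteq> 0\<^sub>v n" unfolding v_def by (metis index_vec index_zero_vec(1))
    moreover have "?B *\<^sub>v v = 0\<^sub>v n"
    proof (rule eq_vecI)
      fix i assume "i < dim_vec (0\<^sub>v n :: 'a vec)"
      then have i: "i < n" by simp
      have "(?B *\<^sub>v v) $ i = (\<Sum>j\<in>{0..<n}. A (f i) (f j) * w (f j))"
        by (simp only: row[OF v i]) (simp add: v_def)
      also have "\<dots> = (\<Sum>\<beta>\<in>S. A (f i) \<beta> * w \<beta>)"
        using sum.reindex_bij_betw[OF f, of "\<lambda>\<beta>. A (f i) \<beta> * w \<beta>"] by simp
      also have "\<dots> = 0" using w(2)[of "f i"] i S by auto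
      finally show "(?B *\<^sub>v v) $ i = 0\<^sub>v n $ i" using i by simp
    qed simp
    ultimately show "\<exists>v. v \<in> carrier_vec n \<and> v \<noteq> 0\<^sub>v n \<and> ?B *\<^sub>v v = 0\<^sub>v n" using v by blast
  qed
  finally show ?thesis .
qed

lemma poly_det_on: "poly (det_on S A) t = det_on S (\<lambda>\<alpha> \<beta>. poly (A \<alpha> \<beta>) t)"
  by (simp add: det_on_def poly_sum poly_prod)

lemma quot_of_fract_Fract:
  fixes a b :: "'a::field_gcd poly"
  assumes "b \<noteq> 0"
  shows "quot_of_fract (Fract a b) = normalize_quot (a, b)"
  using assms by transfer simp

text \<open>The factor \<open>d\<close> cancelled from both entries divides \<open>b\<close>, so it
  does not vanish at \<open>t\<close> and the zero of \<open>a\<close> stays in the reduced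
  numerator.\<close>

lemma poly_numerator_eq_0:
  fixes a b :: "complex poly"
  assumes "poly a t = 0" and "poly b t \<noteq> 0"
  shows "poly (fst (quot_of_fract (Fract a b))) t = 0"
proof -
  from assms have b: "b \<noteq> 0" by auto
  obtain d where d: "a = fst (normalize_quot (a, b)) * d" "b = snd (normalize_quot (a, b)) * d"
    using normalize_quotE[OF b] by metis
  have "poly d t \<noteq> 0" using assms(2) d(2) by (metis mult_zero_right poly_mult)
  moreover have "poly (fst (normalize_quot (a, b))) t * poly d t = 0"
    using assms(1) d(1) by (metis poly_mult)
  ultimately show ?thesis by (simp add: quot_of_fract_Fract[OF b])
qed

text \<open>The reduced numerator divides \<open>a\<close>, so it has no zero that \<open>a\<close>
  lacks.\<close>

lemma poly_numerator_neq_0: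
  fixes a b :: "complex poly"
  assumes "poly a t \<noteq> 0" and "b \<noteq> 0"
  shows "poly (fst (quot_of_fract (Fract a b))) t \<noteq> 0"
proof -
  obtain d where "a = fst (normalize_quot (a, b)) * d"
    using normalize_quotE[OF assms(2)] by metis
  then show ?thesis using assms by (metis mult_zero_left poly_mult quot_of_fract_Fract)
qed

section \<open>The Macaulay matrix of a 3-uniform hypergraph\<close>

text \<open>Ordered pairs, as in the sum over index tuples of the adjacency hypermatrix: an edge of
  size 3 through \<open>i\<close> is met twice, which the entry 1/2! compensates.\<close>

definition links :: "'v set set \<Rightarrow> 'v \<Rightarrow> 'v list set" where
  "links E i = {is. length is = 2 \<and> set (i # is) \<in> E}"

definition pivot :: "'v::linorder set \<Rightarrow> 'v monom \<Rightarrow> 'v" where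
  "pivot V \<alpha> = Min {i \<in> V. 2 \<le> Poly_Mapping.lookup \<alpha> i}"

text \<open>The monomial of x^\<alpha> / x_i^2 times x_a x_b, that is, a column met by row
  \<open>\<alpha>\<close> outside the t-term. The subtraction of exponents is exact only if
  \<open>\<alpha>\<close> has exponent at least 2 at \<open>i\<close>, as at a pivot.\<close>

definition move :: "'v \<Rightarrow> 'v monom \<Rightarrow> 'v list \<Rightarrow> 'v monom" where
  "move i \<alpha> is = \<alpha> - Poly_Mapping.single i 2 +
     (Poly_Mapping.single (is ! 0) 1 + Poly_Mapping.single (is ! 1) 1)"

lemma finite_links:
  assumes "finite V" "E \<subseteq> Pow V"
  shows "finite (links E i)"
  by (rule finite_subset[OF _ finite_lists_length_eq[OF assms(1), of 2]])
    (use assms(2) in \<open>auto simp: links_def\<close>)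

lemma links_nth_in:
  assumes "E \<subseteq> Pow V" "is \<in> links E i"
  shows "is ! 0 \<in> V" "is ! 1 \<in> V"
  using assms by (auto simp: links_def numeral_2_eq_2 length_Suc_conv)

lemma var_power2: "var i ^ 2 = Poly_Mapping.single (Poly_Mapping.single i 2) 1"
  by (simp add: var_def power2_eq_square mult_single single_add[symmetric] numeral_2_eq_2)

text \<open>For arbitrary \<open>\<alpha>\<close> truncated subtraction may prevent the monomial of
  the t-term from being \<open>\<alpha>\<close>; it becomes the diagonal once the pivot exponent is
  known to be at least 2.\<close>

lemma poly_macaulay_matrix:
  assumes H: "finite (vertices H)" "edges H \<subseteq> Pow (vertices H)"
  shows "poly (macaulay_matrix (vertices H) (\<lambda>_. 2) (char_system 3 H) \<alpha> \<beta>) t =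
    (if \<beta> = \<alpha> - Poly_Mapping.single (pivot (vertices H) \<alpha>) 2 + Poly_Mapping.single (pivot (vertices H) \<alpha>) 2
     then t else 0) -
    (\<Sum>is\<in>links (edges H) (pivot (vertices H) \<alpha>). if \<beta> = move (pivot (vertices H) \<alpha>) \<alpha> is then 1 / 2 else 0)"
proof -
  define i where "i = pivot (vertices H) \<alpha>"
  define \<mu> where "\<mu> = \<alpha> - Poly_Mapping.single i 2"
  let ?A = "{is. set is \<subseteq> vertices H \<and> length is = 2}"
  have finA: "finite ?A" using finite_lists_length_eq[OF H(1), of 2] by simp
  have pl: "prod_list (map var is) =
      (Poly_Mapping.single (Poly_Mapping.single (is ! 0) 1 + Poly_Mapping.single (is ! 1) 1) 1 :: ('a, complex poly) mpoly)"
    if "length is = 2" for "is" :: "'a list"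
    using that by (auto simp: numeral_2_eq_2 length_Suc_conv var_def mult_single)
  have "macaulay_matrix (vertices H) (\<lambda>_. 2) (char_system 3 H) \<alpha> \<beta> =
      Poly_Mapping.lookup (Poly_Mapping.single \<mu> 1 * char_system 3 H i) \<beta>"
    by (simp add: macaulay_matrix_def Let_def i_def pivot_def \<mu>_def)
  also have "Poly_Mapping.single \<mu> 1 * char_system 3 H i =
      Poly_Mapping.single (\<mu> + Poly_Mapping.single i 2) [:0, 1:] -
      (\<Sum>is\<in>?A. Poly_Mapping.single (move i \<alpha> is) [:adjacency_entry 3 H (i # is):])"
    unfolding char_system_def
    by (auto simp: right_diff_distrib var_power2 const_def mult_single sum_distrib_left
        pl move_def \<mu>_def add.assoc intro!: sum.cong arg_cong2[where f = "(-)"])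
  finally have "poly (macaulay_matrix (vertices H) (\<lambda>_. 2) (char_system 3 H) \<alpha> \<beta>) t =
     (if \<beta> = \<mu> + Poly_Mapping.single i 2 then t else 0) -
     (\<Sum>is\<in>?A. if \<beta> = move i \<alpha> is then adjacency_entry 3 H (i # is) else 0)"
    by (auto simp: lookup_minus lookup_sum lookup_single poly_sum when_def intro!: sum.cong)
  also have "(\<Sum>is\<in>?A. if \<beta> = move i \<alpha> is then adjacency_entry 3 H (i # is) else 0) =
     (\<Sum>is\<in>links (edges H) i. if \<beta> = move i \<alpha> is then 1 / 2 else 0)"
    by (rule sum.mono_neutral_cong_right[OF finA])
      (use H(2) in \<open>auto simp: links_def adjacency_entry_def\<close>)
  finally show ?thesis by (simp add: i_def \<mu>_def)
qed

section \<open>Monomials of degree card V + 1 and their moves\<close>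

abbreviation "quad_monoms V \<equiv> macaulay_monoms V (\<lambda>_. 2)"

lemma quad_monoms_iff:
  "\<alpha> \<in> quad_monoms V \<longleftrightarrow> Poly_Mapping.keys \<alpha> \<subseteq> V \<and>
     (\<Sum>i\<in>V. Poly_Mapping.lookup \<alpha> i) = Suc (card V)"
  by (simp add: macaulay_monoms_def)

lemma finite_quad_monoms:
  assumes V: "finite V"
  shows "finite (quad_monoms V)"
proof (rule finite_imageD)
  have "Poly_Mapping.lookup \<alpha> i \<le> Suc (card V)" if "\<alpha> \<in> quad_monoms V" "i \<in> V" for \<alpha> i
    using member_le_sum[OF that(2), of "Poly_Mapping.lookup \<alpha>"] that V by (simp add: quad_monoms_iff)
  then show "finite ((\<lambda>\<alpha>. restrict (Poly_Mapping.lookup \<alpha>) V) ` quad_monoms V)"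
    by (intro finite_subset[OF _ finite_PiE[OF V, of "\<lambda>_. {..Suc (card V)}"]]) auto
  show "inj_on (\<lambda>\<alpha>. restrict (Poly_Mapping.lookup \<alpha>) V) (quad_monoms V)"
  proof (rule inj_onI, rule poly_mapping_eqI)
    fix \<alpha> \<beta> k
    assume "\<alpha> \<in> quad_monoms V" "\<beta> \<in> quad_monoms V"
      and eq: "restrict (Poly_Mapping.lookup \<alpha>) V = restrict (Poly_Mapping.lookup \<beta>) V"
    then have "k \<notin> V \<Longrightarrow> Poly_Mapping.lookup \<alpha> k = 0 \<and> Poly_Mapping.lookup \<beta> k = 0"
      by (auto simp: quad_monoms_iff in_keys_iff)
    then show "Poly_Mapping.lookup \<alpha> k = Poly_Mapping.lookup \<beta> k"
      using fun_cong[OF eq, of k] by (cases "k \<in> V") auto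
  qed
qed

text \<open>Pigeonhole: degree card V + 1 in card V variables forces an exponent of at least
  2.\<close>

lemma pivot:
  assumes V: "finite V" and \<alpha>: "\<alpha> \<in> quad_monoms V"
  shows "pivot V \<alpha> \<in> V" "2 \<le> Poly_Mapping.lookup \<alpha> (pivot V \<alpha>)"
    and "\<And>j. j \<in> V \<Longrightarrow> j < pivot V \<alpha> \<Longrightarrow> Poly_Mapping.lookup \<alpha> j < 2"
proof -
  let ?P = "{i \<in> V. 2 \<le> Poly_Mapping.lookup \<alpha> i}"
  have "?P \<noteq> {}"
  proof
    assume "?P = {}"
    then have "Poly_Mapping.lookup \<alpha> i \<le> 1" if "i \<in> V" for i using that by force
    then have "(\<Sum>i\<in>V. Poly_Mapping.lookup \<alpha> i) \<le> (\<Sum>i\<in>V. 1)" by (intro sum_mono)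
    with \<alpha> show False by (simp add: quad_monoms_iff)
  qed
  then have "pivot V \<alpha> \<in> ?P" unfolding pivot_def using V by (intro Min_in) auto
  then show "pivot V \<alpha> \<in> V" "2 \<le> Poly_Mapping.lookup \<alpha> (pivot V \<alpha>)" by auto
  show "\<And>j. j \<in> V \<Longrightarrow> j < pivot V \<alpha> \<Longrightarrow> Poly_Mapping.lookup \<alpha> j < 2"
  proof -
    fix j assume j: "j \<in> V" "j < pivot V \<alpha>"
    show "Poly_Mapping.lookup \<alpha> j < 2"
    proof (rule ccontr)
      assume "\<not> ?thesis"
      then have "pivot V \<alpha> \<le> j" unfolding pivot_def using V j(1) by (intro Min_le) auto
      with j(2) show False by simp
    qed
  qed
qed

lemma lookup_move:
  "Poly_Mapping.lookup (move i \<alpha> is) j = Poly_Mapping.lookup \<alpha> j - (if j = i then 2 else 0) +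
    ((if j = is ! 0 then 1 else 0) + (if j = is ! 1 then 1 else 0))"
  by (auto simp: move_def lookup_add lookup_minus lookup_single when_def)

lemma move_in_quad_monoms:
  assumes V: "finite V" and E: "E \<subseteq> Pow V" and \<alpha>: "\<alpha> \<in> quad_monoms V"
    and "is": "is \<in> links E (pivot V \<alpha>)"
  shows "move (pivot V \<alpha>) \<alpha> is \<in> quad_monoms V"
proof -
  let ?i = "pivot V \<alpha>"
  note piv = pivot[OF V \<alpha>]
  note isV = links_nth_in[OF E "is"]
  have "k \<in> V" if "Poly_Mapping.lookup \<alpha> k \<noteq> 0" for k
    using \<alpha> that by (auto simp: quad_monoms_iff in_keys_iff)
  then have "Poly_Mapping.keys (move ?i \<alpha> is) \<subseteq> V"
    using piv(1) isV by (auto simp: in_keys_iff lookup_move split: if_splits)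
  \<comment> \<open>Adding 2 on both sides keeps the truncated subtraction of \<open>move\<close>
    out of the sum.\<close>
  moreover have "(\<Sum>j\<in>V. Poly_Mapping.lookup (move ?i \<alpha> is) j) + 2 =
      (\<Sum>j\<in>V. Poly_Mapping.lookup \<alpha> j) + 2"
  proof -
    have "(\<Sum>j\<in>V. Poly_Mapping.lookup (move ?i \<alpha> is) j) + 2 =
        (\<Sum>j\<in>V. Poly_Mapping.lookup (move ?i \<alpha> is) j) + (\<Sum>j\<in>V. if j = ?i then 2 else 0)"
      using V piv by simp
    also have "\<dots> = (\<Sum>j\<in>V. Poly_Mapping.lookup \<alpha> j +
        ((if j = is ! 0 then 1 else 0) + (if j = is ! 1 then 1 else 0)))"
      unfolding sum.distrib[symmetric]
      by (rule sum.cong) (use piv in \<open>auto simp: lookup_move\<close>)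
    also have "\<dots> = (\<Sum>j\<in>V. Poly_Mapping.lookup \<alpha> j) + 2"
      using V isV by (simp add: sum.distrib)
    finally show ?thesis .
  qed
  ultimately show ?thesis using \<alpha> by (simp add: quad_monoms_iff)
qed

definition monom_val :: "'v set \<Rightarrow> ('v \<Rightarrow> real) \<Rightarrow> 'v monom \<Rightarrow> real" where
  "monom_val V x \<alpha> = (\<Prod>i\<in>V. x i ^ Poly_Mapping.lookup \<alpha> i)"

lemma monom_val_pos: "(\<And>i. i \<in> V \<Longrightarrow> 0 < x i) \<Longrightarrow> 0 < monom_val V x \<alpha>"
  by (simp add: monom_val_def prod_pos)

text \<open>Multiplying the eigenvalue equation at the pivot i by x^\<alpha> / x_i^2 gives row
  \<open>\<alpha>\<close> of the Macaulay matrix; this identity is the passage from x^\<alpha> to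
  its moves, stated without division.\<close>

lemma monom_val_move:
  assumes V: "finite V" and E: "E \<subseteq> Pow V" and \<alpha>: "\<alpha> \<in> quad_monoms V"
    and "is": "is \<in> links E (pivot V \<alpha>)"
  shows "monom_val V x (move (pivot V \<alpha>) \<alpha> is) * x (pivot V \<alpha>) ^ 2 =
    monom_val V x \<alpha> * (x (is ! 0) * x (is ! 1))"
proof -
  let ?i = "pivot V \<alpha>"
  note piv = pivot[OF V \<alpha>]
  note isV = links_nth_in[OF E "is"]
  have delta: "(\<Prod>j\<in>V. x j ^ (if j = k then c else 0)) = x k ^ c" if "k \<in> V" for k and c :: nat
    using V that by (subst prod.remove[of _ k]) auto
  have "monom_val V x (move ?i \<alpha> is) * x ?i ^ 2 =
      (\<Prod>j\<in>V. x j ^ Poly_Mapping.lookup (move ?i \<alpha> is) j * x j ^ (if j = ?i then 2 else 0))"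
    by (simp only: monom_val_def prod.distrib delta[OF piv(1)])
  also have "\<dots> = (\<Prod>j\<in>V. x j ^ Poly_Mapping.lookup \<alpha> j *
      (x j ^ (if j = is ! 0 then 1 else 0) * x j ^ (if j = is ! 1 then 1 else 0)))"
    unfolding power_add[symmetric]
    by (rule prod.cong) (use piv in \<open>auto simp: lookup_move\<close>)
  also have "\<dots> = monom_val V x \<alpha> * (x (is ! 0) * x (is ! 1))"
    by (simp only: monom_val_def prod.distrib delta[OF isV(1)] delta[OF isV(2)] power_one_right)
  finally show ?thesis .
qed

text \<open>\<open>S\<close> is left open because the same formula serves all monomials and the
  nonreduced ones; a move that leaves \<open>S\<close> falls outside the principal
  submatrix.\<close>

lemma macaulay_matrix_mult:
  assumes H: "finite (vertices H)" "edges H \<subseteq> Pow (vertices H)"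
    and S: "S \<subseteq> quad_monoms (vertices H)" and \<alpha>: "\<alpha> \<in> S"
  shows "(\<Sum>\<beta>\<in>S. poly (macaulay_matrix (vertices H) (\<lambda>_. 2) (char_system 3 H) \<alpha> \<beta>) t * w \<beta>) =
    t * w \<alpha> - (\<Sum>is\<in>links (edges H) (pivot (vertices H) \<alpha>).
      if move (pivot (vertices H) \<alpha>) \<alpha> is \<in> S
      then w (move (pivot (vertices H) \<alpha>) \<alpha> is) / 2 else 0)"
proof -
  let ?i = "pivot (vertices H) \<alpha>" and ?L = "links (edges H) (pivot (vertices H) \<alpha>)"
  have finS: "finite S" using S finite_quad_monoms[OF H(1)] finite_subset by blast
  have "2 \<le> Poly_Mapping.lookup \<alpha> ?i" using pivot(2)[OF H(1)] S \<alpha> by blast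
  then have split: "\<alpha> - Poly_Mapping.single ?i 2 + Poly_Mapping.single ?i 2 = \<alpha>"
    by (intro poly_mapping_eqI) (auto simp: lookup_add lookup_minus lookup_single when_def)
  have "(\<Sum>\<beta>\<in>S. poly (macaulay_matrix (vertices H) (\<lambda>_. 2) (char_system 3 H) \<alpha> \<beta>) t * w \<beta>) =
     (\<Sum>\<beta>\<in>S. if \<beta> = \<alpha> then t * w \<beta> else 0) -
     (\<Sum>\<beta>\<in>S. \<Sum>is\<in>?L. if \<beta> = move ?i \<alpha> is then w \<beta> / 2 else 0)"
    unfolding poly_macaulay_matrix[OF H] split left_diff_distrib sum_distrib_right sum_subtractf
    by (intro arg_cong2[where f = "(-)"] sum.cong) auto
  also have "(\<Sum>\<beta>\<in>S. \<Sum>is\<in>?L. if \<beta> = move ?i \<alpha> is then w \<beta> / 2 else 0) =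
     (\<Sum>is\<in>?L. \<Sum>\<beta>\<in>S. if \<beta> = move ?i \<alpha> is then w \<beta> / 2 else 0)"
    by (rule sum.swap)
  finally show ?thesis using finS \<alpha> by simp
qed

text \<open>The vector of monomial values of a positive vector with \<open>\<partial>\<^sub>iH(x) \<le> \<lambda>x\<^sub>i\<^sup>2\<close> dominates the kernel
  vectors of the principal submatrices; the extremal monomials form the closed set.\<close>

lemma kernel_closed_set:
  fixes w :: "'v::linorder monom \<Rightarrow> complex"
  assumes V: "finite V" and E: "E \<subseteq> Pow V" and S: "S \<subseteq> quad_monoms V"
    and x: "\<And>i. i \<in> V \<Longrightarrow> 0 < x i"
    and sub: "\<And>i. i \<in> V \<Longrightarrow> (\<Sum>is\<in>links E i. x (is ! 0) * x (is ! 1) / 2) \<le> l * x i ^ 2"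
    and "l \<le> t"
    and w: "\<exists>\<alpha>\<in>S. w \<alpha> \<noteq> 0"
    and ker: "\<And>\<alpha>. \<alpha> \<in> S \<Longrightarrow> of_real t * w \<alpha> = (\<Sum>is\<in>links E (pivot V \<alpha>).
      if move (pivot V \<alpha>) \<alpha> is \<in> S then w (move (pivot V \<alpha>) \<alpha> is) / 2 else 0)"
  shows "l = t"
    and "\<exists>M. M \<noteq> {} \<and> M \<subseteq> S \<and> (\<forall>\<alpha>\<in>M. \<forall>is\<in>links E (pivot V \<alpha>). move (pivot V \<alpha>) \<alpha> is \<in> M)"
proof -
  let ?v = "monom_val V x"
  \<comment> \<open>The kernel vector is measured against the positive vector \<open>?v\<close>, and
    the argument takes place where this ratio is maximal.\<close>
  define r where "r \<alpha> = cmod (w \<alpha>) / ?v \<alpha>" for \<alpha>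
  define \<theta> where "\<theta> = Max (r ` S)"
  have finS: "finite S" using S finite_quad_monoms[OF V] finite_subset by blast
  have vpos: "0 < ?v \<alpha>" for \<alpha> using monom_val_pos[of V x] x by blast
  have "S \<noteq> {}" using w by blast
  have r_le: "r \<alpha> \<le> \<theta>" if "\<alpha> \<in> S" for \<alpha> using that finS by (simp add: \<theta>_def)
  then have w_le: "cmod (w \<alpha>) \<le> \<theta> * ?v \<alpha>" if "\<alpha> \<in> S" for \<alpha>
    using that vpos[of \<alpha>] by (simp add: r_def divide_le_eq)
  have \<theta>: "0 < \<theta>"
  proof -
    obtain \<alpha> where "\<alpha> \<in> S" "w \<alpha> \<noteq> 0" using w by blast
    then have "0 < r \<alpha>" using vpos[of \<alpha>] by (simp add: r_def)
    then show ?thesis using r_le[OF \<open>\<alpha> \<in> S\<close>] by linarith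
  qed
  define M where "M = {\<alpha> \<in> S. cmod (w \<alpha>) = \<theta> * ?v \<alpha>}"
  have "\<theta> \<in> r ` S" unfolding \<theta>_def using finS \<open>S \<noteq> {}\<close> by (intro Max_in) auto
  then obtain \<alpha>0 where "\<alpha>0 \<in> S" "\<theta> = r \<alpha>0" by blast
  then have \<alpha>0: "\<alpha>0 \<in> M" using vpos[of \<alpha>0] by (simp add: M_def r_def)
  \<comment> \<open>Slack of the bound for one move. A move that leaves \<open>S\<close> counts in
    full, so zero slack forces the moved monomial into \<open>S\<close> and makes it
    extremal.\<close>
  define d where "d \<alpha> is = \<theta> * ?v (move (pivot V \<alpha>) \<alpha> is) / 2 -
    (if move (pivot V \<alpha>) \<alpha> is \<in> S then cmod (w (move (pivot V \<alpha>) \<alpha> is)) / 2 else 0)" for \<alpha> "is"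
  have d_nonneg: "0 \<le> d \<alpha> is" for \<alpha> "is"
    using w_le[of "move (pivot V \<alpha>) \<alpha> is"] \<theta> vpos[of "move (pivot V \<alpha>) \<alpha> is"] by (simp add: d_def)
  have key: "t * \<theta> * ?v \<alpha> + (\<Sum>is\<in>links E (pivot V \<alpha>). d \<alpha> is) \<le> l * \<theta> * ?v \<alpha>"
    if "\<alpha> \<in> M" for \<alpha>
  proof -
    let ?i = "pivot V \<alpha>"
    from that have \<alpha>: "\<alpha> \<in> S" "\<alpha> \<in> quad_monoms V" "cmod (w \<alpha>) = \<theta> * ?v \<alpha>" using S by (auto simp: M_def)
    have xi: "0 < x ?i" using x pivot(1)[OF V \<alpha>(2)] by blast
    have "t * \<theta> * ?v \<alpha> \<le> cmod (of_real t * w \<alpha>)"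
      using \<alpha>(3) mult_right_mono[OF abs_ge_self norm_ge_zero, of t "w \<alpha>"] by (simp add: norm_mult mult.assoc)
    also have "\<dots> \<le> (\<Sum>is\<in>links E ?i. if move ?i \<alpha> is \<in> S then cmod (w (move ?i \<alpha> is)) / 2 else 0)"
      unfolding ker[OF \<alpha>(1)] by (rule order.trans[OF norm_sum], rule sum_mono) (auto simp: norm_divide)
    finally have "t * \<theta> * ?v \<alpha> + (\<Sum>is\<in>links E ?i. d \<alpha> is) \<le>
        (\<Sum>is\<in>links E ?i. \<theta> * ?v (move ?i \<alpha> is) / 2)"
      by (simp add: d_def sum_subtractf)
    also have "\<dots> = (\<Sum>is\<in>links E ?i. \<theta> * ?v \<alpha> / x ?i ^ 2 * (x (is ! 0) * x (is ! 1) / 2))"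
    proof (rule sum.cong[OF refl])
      fix "is" assume "is \<in> links E ?i"
      then have "?v (move ?i \<alpha> is) * x ?i ^ 2 = ?v \<alpha> * (x (is ! 0) * x (is ! 1))"
        by (rule monom_val_move[OF V E \<alpha>(2)])
      then have "?v (move ?i \<alpha> is) = ?v \<alpha> * (x (is ! 0) * x (is ! 1)) / x ?i ^ 2"
        using xi by (simp add: eq_divide_eq)
      then show "\<theta> * ?v (move ?i \<alpha> is) / 2 = \<theta> * ?v \<alpha> / x ?i ^ 2 * (x (is ! 0) * x (is ! 1) / 2)" by simp
    qed
    also have "\<dots> = \<theta> * ?v \<alpha> / x ?i ^ 2 * (\<Sum>is\<in>links E ?i. x (is ! 0) * x (is ! 1) / 2)"
      by (simp only: sum_distrib_left)
    also have "\<dots> \<le> \<theta> * ?v \<alpha> / x ?i ^ 2 * (l * x ?i ^ 2)"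
      by (rule mult_left_mono[OF sub[OF pivot(1)[OF V \<alpha>(2)]]]) (use \<theta> vpos[of \<alpha>] in simp)
    also have "\<dots> = l * \<theta> * ?v \<alpha>" using xi by simp
    finally show ?thesis .
  qed
  have fin: "finite (links E i)" for i by (rule finite_links[OF V E])
  have "t * \<theta> * ?v \<alpha>0 \<le> l * \<theta> * ?v \<alpha>0"
    using key[OF \<alpha>0] sum_nonneg[of "links E (pivot V \<alpha>0)" "d \<alpha>0"] d_nonneg by smt
  then have "t * (\<theta> * ?v \<alpha>0) \<le> l * (\<theta> * ?v \<alpha>0)" by (simp add: mult.assoc)
  moreover have "0 < \<theta> * ?v \<alpha>0" using \<theta> vpos[of \<alpha>0] by simp
  ultimately have "t \<le> l" by (simp only: mult_le_cancel_right_pos)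
  with \<open>l \<le> t\<close> show lt: "l = t" by simp
  have "move (pivot V \<alpha>) \<alpha> is \<in> M" if "\<alpha> \<in> M" "is \<in> links E (pivot V \<alpha>)" for \<alpha> "is"
  proof -
    let ?m = "move (pivot V \<alpha>) \<alpha> is"
    have "(\<Sum>is\<in>links E (pivot V \<alpha>). d \<alpha> is) \<le> 0" using key[OF that(1)] lt by simp
    then have "d \<alpha> is = 0"
      using sum_nonneg_eq_0_iff[OF fin, of _ "d \<alpha>"] d_nonneg sum_nonneg[of "links E (pivot V \<alpha>)" "d \<alpha>"]
        that(2) by (metis order_antisym)
    then show ?thesis using \<theta> vpos[of ?m] by (auto simp: d_def M_def split: if_splits)
  qed
  with \<alpha>0 show "\<exists>M. M \<noteq> {} \<and> M \<subseteq> S \<and> (\<forall>\<alpha>\<in>M. \<forall>is\<in>links E (pivot V \<alpha>). move (pivot V \<alpha>) \<alpha> is \<in> M)"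
    by (intro exI[of _ M]) (auto simp: M_def)
qed

lemma characteristic_polynomial_3:
  "characteristic_polynomial 3 H = fst (quot_of_fract (Fract
     (det_on (quad_monoms (vertices H)) (macaulay_matrix (vertices H) (\<lambda>_. 2) (char_system 3 H)))
     (det_on (nonreduced_monoms (vertices H) (\<lambda>_. 2))
        (macaulay_matrix (vertices H) (\<lambda>_. 2) (char_system 3 H)))))"
  by (simp add: characteristic_polynomial_def macaulay_resultant_def)

lemma nonreduced_subset: "nonreduced_monoms V d \<subseteq> macaulay_monoms V d"
  by (auto simp: nonreduced_monoms_def)

text \<open>\<open>h\<close> is the least vertex, so it is the pivot whenever it carries two chips; \<open>v\<close> is the
  greatest, so it is never the pivot of a nonreduced monomial. Reading exponents as chips, every
  move can be chosen to push chips towards \<open>v\<close>, if necessary through \<open>h\<close>.\<close>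

lemma no_closed_nonreduced:
  fixes V :: "'v::linorder set"
  assumes V: "finite V" and E: "\<And>e. e \<in> E \<Longrightarrow> card e = 3"
    and h: "h \<in> V" "\<And>i. i \<in> V \<Longrightarrow> h \<le> i" and v: "v \<in> V" "\<And>i. i \<in> V \<Longrightarrow> i \<le> v"
    and hv: "{h, v, k0} \<in> E"
    and hub: "\<And>i. i \<in> V \<Longrightarrow> i \<noteq> h \<Longrightarrow> \<exists>k. {i, h, k} \<in> E"
    and M: "M \<subseteq> nonreduced_monoms V (\<lambda>_. 2)" "M \<noteq> {}"
    and closed: "\<And>\<alpha> is. \<alpha> \<in> M \<Longrightarrow> is \<in> links E (pivot V \<alpha>) \<Longrightarrow> move (pivot V \<alpha>) \<alpha> is \<in> M"
  shows False
proof -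
  let ?l = "Poly_Mapping.lookup :: 'v monom \<Rightarrow> 'v \<Rightarrow> nat"
  \<comment> \<open>With weight 3 a move from \<open>h\<close> still pays: it costs two chips at
    \<open>h\<close> and brings one to \<open>v\<close>.\<close>
  define \<phi> where "\<phi> \<alpha> = 3 * ?l \<alpha> v + ?l \<alpha> h" for \<alpha> :: "'v monom"
  have finM: "finite M"
    using M(1) nonreduced_subset finite_quad_monoms[OF V] by (meson finite_subset)
  then have "Max (\<phi> ` M) \<in> \<phi> ` M" using M(2) by (intro Max_in) auto
  then obtain \<alpha> where \<alpha>: "\<alpha> \<in> M" "\<phi> \<alpha> = Max (\<phi> ` M)" by auto
  have max: "\<phi> \<beta> \<le> \<phi> \<alpha>" if "\<beta> \<in> M" for \<beta> using that finM \<alpha>(2) by simp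
  have \<alpha>V: "\<alpha> \<in> quad_monoms V" and nonred: "card {i \<in> V. 2 \<le> ?l \<alpha> i} \<noteq> 1"
    using \<alpha>(1) M(1) by (auto simp: nonreduced_monoms_def)
  note piv = pivot[OF V \<alpha>V]
  have dist: "a \<noteq> b \<and> a \<noteq> c \<and> b \<noteq> c" if "{a, b, c} \<in> E" for a b c
    using E[OF that] by (auto simp: card_insert_if split: if_splits)
  let ?i = "pivot V \<alpha>"
  show False
  proof (cases "?i = h")
    case True
    have "[v, k0] \<in> links E h" using hv by (simp add: links_def)
    then have "\<phi> (move ?i \<alpha> [v, k0]) \<le> \<phi> \<alpha>" using closed[OF \<alpha>(1)] True max by simp
    with dist[OF hv] piv(2) True show False by (auto simp: \<phi>_def lookup_move)
  next
    case False
    have "?i \<noteq> v"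
    proof
      assume iv: "?i = v"
      have "{i \<in> V. 2 \<le> ?l \<alpha> i} = {v}"
        using piv iv v by (auto intro: order_antisym) (metis leD not_le_imp_less order_antisym)
      then show False using nonred by simp
    qed
    obtain k where k: "{?i, h, k} \<in> E" using hub[OF piv(1) False] by blast
    then have "[h, k] \<in> links E ?i" by (simp add: links_def)
    then have "\<phi> (move ?i \<alpha> [h, k]) \<le> \<phi> \<alpha>" using closed[OF \<alpha>(1)] max by simp
    with dist[OF k] \<open>?i \<noteq> v\<close> show False by (auto simp: \<phi>_def lookup_move split: if_splits)
  qed
qed

lemma det_macaulay_eq_0_iff:
  assumes H: "finite (vertices H)" "edges H \<subseteq> Pow (vertices H)"
    and S: "S \<subseteq> quad_monoms (vertices H)"
  shows "poly (det_on S (macaulay_matrix (vertices H) (\<lambda>_. 2) (char_system 3 H))) t = 0 \<longleftrightarrow>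
    (\<exists>w. (\<exists>\<alpha>\<in>S. w \<alpha> \<noteq> 0) \<and> (\<forall>\<alpha>\<in>S. t * w \<alpha> = (\<Sum>is\<in>links (edges H) (pivot (vertices H) \<alpha>).
      if move (pivot (vertices H) \<alpha>) \<alpha> is \<in> S
      then w (move (pivot (vertices H) \<alpha>) \<alpha> is) / 2 else 0)))"
proof -
  have "finite S" using S finite_quad_monoms[OF H(1)] finite_subset by blast
  then show ?thesis
    by (simp add: poly_det_on det_on_eq_0_iff macaulay_matrix_mult[OF H S])
qed

text \<open>\<open>kernel_closed_set\<close> is applied to two sets: all monomials give a nonzero
  value of the larger determinant at \<open>t\<close>, the nonreduced ones show that the denominator
  is not the zero polynomial.\<close>

lemma characteristic_polynomial_neq_0:
  fixes H :: "'v::linorder hypergraph"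
  assumes H: "finite (vertices H)" "edges H \<subseteq> Pow (vertices H)"
    and x: "\<And>i. i \<in> vertices H \<Longrightarrow> 0 < x i"
    and sub: "\<And>i. i \<in> vertices H \<Longrightarrow>
      (\<Sum>is\<in>links (edges H) i. x (is ! 0) * x (is ! 1) / 2) \<le> l * x i ^ 2"
    and "l < t"
  shows "poly (characteristic_polynomial 3 H) (of_real t) \<noteq> 0"
proof -
  have nz: "poly (det_on S (macaulay_matrix (vertices H) (\<lambda>_. 2) (char_system 3 H))) (of_real t) \<noteq> 0"
    if S: "S \<subseteq> quad_monoms (vertices H)" for S
  proof
    assume "poly (det_on S (macaulay_matrix (vertices H) (\<lambda>_. 2) (char_system 3 H))) (of_real t) = 0"
    then obtain w :: "'v monom \<Rightarrow> complex" where w: "\<exists>\<alpha>\<in>S. w \<alpha> \<noteq> 0"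
      "\<And>\<alpha>. \<alpha> \<in> S \<Longrightarrow> of_real t * w \<alpha> = (\<Sum>is\<in>links (edges H) (pivot (vertices H) \<alpha>).
        if move (pivot (vertices H) \<alpha>) \<alpha> is \<in> S
        then w (move (pivot (vertices H) \<alpha>) \<alpha> is) / 2 else 0)"
      unfolding det_macaulay_eq_0_iff[OF H S] by - (elim exE conjE, erule that, erule (1) bspec)
    have "l = t"
      by (rule kernel_closed_set(1)[OF H S x sub _ w]) (use \<open>l < t\<close> in auto)
    with \<open>l < t\<close> show False by simp
  qed
  from nz[OF nonreduced_subset] show ?thesis
    unfolding characteristic_polynomial_3 by (intro poly_numerator_neq_0 nz) auto
qed

lemma characteristic_polynomial_eq_0:
  fixes H :: "'v::linorder hypergraph"
  assumes H: "finite (vertices H)" "edges H \<subseteq> Pow (vertices H)"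
    and E: "\<And>e. e \<in> edges H \<Longrightarrow> card e = 3"
    and h: "h \<in> vertices H" "\<And>i. i \<in> vertices H \<Longrightarrow> h \<le> i"
    and v: "v \<in> vertices H" "\<And>i. i \<in> vertices H \<Longrightarrow> i \<le> v"
    and hv: "{h, v, k0} \<in> edges H"
    and hub: "\<And>i. i \<in> vertices H \<Longrightarrow> i \<noteq> h \<Longrightarrow> \<exists>k. {i, h, k} \<in> edges H"
    and x: "\<And>i. i \<in> vertices H \<Longrightarrow> 0 < x i"
    and eig: "\<And>i. i \<in> vertices H \<Longrightarrow>
      (\<Sum>is\<in>links (edges H) i. x (is ! 0) * x (is ! 1) / 2) = l * x i ^ 2"
  shows "poly (characteristic_polynomial 3 H) (of_real l) = 0"
proof -
  let ?V = "vertices H" and ?E = "edges H"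
  let ?v = "monom_val ?V x"
  let ?Q = "quad_monoms ?V" and ?N = "nonreduced_monoms ?V (\<lambda>_. 2)"
  have "poly (det_on ?Q (macaulay_matrix ?V (\<lambda>_. 2) (char_system 3 H))) (of_real l) = 0"
    unfolding det_macaulay_eq_0_iff[OF H order_refl]
  proof (intro exI[of _ "\<lambda>\<alpha>. of_real (?v \<alpha>)"] conjI ballI)
    have "Poly_Mapping.single h (Suc (card ?V)) \<in> ?Q"
      using h(1) H(1) by (auto simp: quad_monoms_iff lookup_single when_def)
    then show "\<exists>\<alpha>\<in>?Q. complex_of_real (?v \<alpha>) \<noteq> 0"
      using monom_val_pos[of ?V x] x by (metis less_irrefl of_real_eq_0_iff)
  next
    fix \<alpha> assume \<alpha>: "\<alpha> \<in> ?Q"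
    let ?i = "pivot ?V \<alpha>"
    have iV: "?i \<in> ?V" by (rule pivot(1)[OF H(1) \<alpha>])
    then have xi: "0 < x ?i" by (rule x)
    have "l * ?v \<alpha> = ?v \<alpha> / x ?i ^ 2 * (\<Sum>is\<in>links ?E ?i. x (is ! 0) * x (is ! 1) / 2)"
      unfolding eig[OF iV] using xi by simp
    also have "\<dots> = (\<Sum>is\<in>links ?E ?i. ?v (move ?i \<alpha> is) / 2)"
      unfolding sum_distrib_left
    proof (rule sum.cong[OF refl])
      fix "is" assume "is \<in> links ?E ?i"
      from monom_val_move[OF H \<alpha> this, of x] xi
      show "?v \<alpha> / x ?i ^ 2 * (x (is ! 0) * x (is ! 1) / 2) = ?v (move ?i \<alpha> is) / 2"
        by (simp add: field_simps)
    qed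
    finally have "of_real l * complex_of_real (?v \<alpha>) =
        (\<Sum>is\<in>links ?E ?i. of_real (?v (move ?i \<alpha> is)) / 2)"
      by (metis (no_types, lifting) of_real_mult of_real_sum of_real_divide of_real_numeral sum.cong)
    then show "of_real l * complex_of_real (?v \<alpha>) =
        (\<Sum>is\<in>links ?E ?i. if move ?i \<alpha> is \<in> ?Q then of_real (?v (move ?i \<alpha> is)) / 2 else 0)"
      using move_in_quad_monoms[OF H \<alpha>] by (simp cong: sum.cong)
  qed
  moreover have "poly (det_on ?N (macaulay_matrix ?V (\<lambda>_. 2) (char_system 3 H))) (of_real l) \<noteq> 0"
  proof
    assume "poly (det_on ?N (macaulay_matrix ?V (\<lambda>_. 2) (char_system 3 H))) (of_real l) = 0"
    then obtain w :: "'v monom \<Rightarrow> complex" where w: "\<exists>\<alpha>\<in>?N. w \<alpha> \<noteq> 0"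
      "\<And>\<alpha>. \<alpha> \<in> ?N \<Longrightarrow> of_real l * w \<alpha> = (\<Sum>is\<in>links ?E (pivot ?V \<alpha>).
        if move (pivot ?V \<alpha>) \<alpha> is \<in> ?N then w (move (pivot ?V \<alpha>) \<alpha> is) / 2 else 0)"
      unfolding det_macaulay_eq_0_iff[OF H nonreduced_subset]
      by - (elim exE conjE, erule that, erule (1) bspec)
    obtain M where "M \<noteq> {}" "M \<subseteq> ?N"
      "\<forall>\<alpha>\<in>M. \<forall>is\<in>links ?E (pivot ?V \<alpha>). move (pivot ?V \<alpha>) \<alpha> is \<in> M"
      using kernel_closed_set(2)[OF H nonreduced_subset x eq_refl[OF eig] order_refl w] by blast
    then show False using no_closed_nonreduced[OF H(1) E h v hv hub] by blast
  qed
  ultimately show ?thesis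
    unfolding characteristic_polynomial_3 by (rule poly_numerator_eq_0)
qed

section \<open>Lagrangians and positive eigenvectors\<close>

definition Lag :: "'v set set \<Rightarrow> ('v \<Rightarrow> 'a::comm_semiring_1) \<Rightarrow> 'a" where
  "Lag E w = (\<Sum>e\<in>E. \<Prod>i\<in>e. w i)"

text \<open>The partial derivative of \<open>Lag E\<close> with respect to variable
  \<open>j\<close>, written without differentiation so that it makes sense over any commutative
  semiring.\<close>

definition pd :: "'v set set \<Rightarrow> 'v \<Rightarrow> ('v \<Rightarrow> 'a::comm_semiring_1) \<Rightarrow> 'a" where
  "pd E j w = (\<Sum>e | e \<in> E \<and> j \<in> e. \<Prod>i\<in>e - {j}. w i)"

lemma Lag_cong:
  assumes "\<And>e i. e \<in> E \<Longrightarrow> i \<in> e \<Longrightarrow> w i = w' i"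
  shows "Lag E w = Lag E w'"
  unfolding Lag_def by (intro sum.cong prod.cong refl) (use assms in blast)

lemma finite_edges:
  assumes "finite V" "E \<subseteq> Pow V"
  shows "finite E" "e \<in> E \<Longrightarrow> finite e"
  using assms by (auto intro: finite_subset)

lemma Lag_upd:
  fixes w :: "'v \<Rightarrow> 'a::comm_semiring_1"
  assumes E: "finite E" "\<And>e. e \<in> E \<Longrightarrow> finite e"
  shows "Lag E (w(j := w j + s)) = Lag E w + s * pd E j w"
proof -
  have "(\<Prod>i\<in>e. (w(j := w j + s)) i) =
      (\<Prod>i\<in>e. w i) + (if j \<in> e then s * (\<Prod>i\<in>e - {j}. w i) else 0)" if "e \<in> E" for e
  proof (cases "j \<in> e")
    case True
    have "(\<Prod>i\<in>e. (w(j := w j + s)) i) = (w j + s) * (\<Prod>i\<in>e - {j}. (w(j := w j + s)) i)"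
      by (simp add: prod.remove[OF E(2)[OF that] True])
    also have "(\<Prod>i\<in>e - {j}. (w(j := w j + s)) i) = (\<Prod>i\<in>e - {j}. w i)"
      by (rule prod.cong) auto
    finally show ?thesis
      using True by (simp add: prod.remove[OF E(2)[OF that] True] algebra_simps)
  next
    case False
    then show ?thesis by (auto intro!: prod.cong)
  qed
  then have "Lag E (w(j := w j + s)) =
      Lag E w + (\<Sum>e\<in>E. if j \<in> e then s * (\<Prod>i\<in>e - {j}. w i) else 0)"
    by (simp add: Lag_def sum.distrib)
  also have "(\<Sum>e\<in>E. if j \<in> e then s * (\<Prod>i\<in>e - {j}. w i) else 0) = s * pd E j w"
    by (auto simp: pd_def sum_distrib_left sum.inter_filter[OF E(1)] intro!: sum.cong)
  finally show ?thesis .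
qed

text \<open>Double counting of incident pairs. Constant weight 1 gives Euler's identity; the cubes
  of y_j / x_j give the sum over edges to which AM-GM applies.\<close>

lemma euler_Lag:
  fixes w :: "'v \<Rightarrow> 'a::comm_semiring_1"
  assumes V: "finite V" "E \<subseteq> Pow V"
  shows "(\<Sum>j\<in>V. c j * (w j * pd E j w)) = (\<Sum>e\<in>E. (\<Prod>i\<in>e. w i) * (\<Sum>i\<in>e. c i))"
proof -
  note fin = finite_edges[OF V]
  have "c j * (w j * pd E j w) = (\<Sum>e\<in>E. if j \<in> e then c j * (\<Prod>i\<in>e. w i) else 0)" for j
  proof -
    have "c j * (w j * pd E j w) = (\<Sum>e | e \<in> E \<and> j \<in> e. c j * (w j * (\<Prod>i\<in>e - {j}. w i)))"
      by (simp add: pd_def sum_distrib_left)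
    also have "\<dots> = (\<Sum>e | e \<in> E \<and> j \<in> e. c j * (\<Prod>i\<in>e. w i))"
      by (rule sum.cong[OF refl]) (use fin(2) in \<open>auto simp: prod.remove\<close>)
    finally show ?thesis by (simp add: sum.inter_filter[OF fin(1)])
  qed
  then have "(\<Sum>j\<in>V. c j * (w j * pd E j w)) =
      (\<Sum>e\<in>E. \<Sum>j\<in>V. if j \<in> e then c j * (\<Prod>i\<in>e. w i) else 0)"
    by (simp only:) (rule sum.swap)
  also have "\<dots> = (\<Sum>e\<in>E. (\<Prod>i\<in>e. w i) * (\<Sum>i\<in>e. c i))"
  proof (rule sum.cong[OF refl])
    fix e assume "e \<in> E"
    then have "{j \<in> V. j \<in> e} = e" using V(2) by auto
    then show "(\<Sum>j\<in>V. if j \<in> e then c j * (\<Prod>i\<in>e. w i) else 0) = (\<Prod>i\<in>e. w i) * (\<Sum>i\<in>e. c i)"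
      by (simp add: sum.inter_filter[OF V(1), symmetric] sum_distrib_right[symmetric] mult.commute)
  qed
  finally show ?thesis .
qed

text \<open>An edge {i, a, b} contributes the two lists [a, b] and [b, a], which absorbs the factor
  1/2.\<close>

lemma links_sum_eq_pd:
  fixes x :: "'v \<Rightarrow> real"
  assumes V: "finite V" "E \<subseteq> Pow V" and E: "\<And>e. e \<in> E \<Longrightarrow> card e = 3"
  shows "(\<Sum>is\<in>links E i. x (is ! 0) * x (is ! 1) / 2) = pd E i x"
proof -
  let ?F = "{e. e \<in> E \<and> i \<in> e}" and ?A = "\<lambda>e. {is. length is = 2 \<and> set (i # is) = e}"
  have A: "(\<Sum>is\<in>?A e. x (is ! 0) * x (is ! 1) / 2) = (\<Prod>k\<in>e - {i}. x k) \<and> finite (?A e)"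
    if "e \<in> ?F" for e
  proof -
    have "card (e - {i}) = 2" using E[of e] that by (auto simp: card_Diff_singleton)
    then obtain a b where ab: "e - {i} = {a, b}" "a \<noteq> b" by (auto simp: card_2_iff)
    then have e: "e = {i, a, b}" "a \<noteq> i" "b \<noteq> i" using that by auto
    have "?A e = {[a, b], [b, a]}"
      using e ab(2) by (auto simp: numeral_2_eq_2 length_Suc_conv) (metis empty_iff insert_iff)+
    then show ?thesis using ab e by simp
  qed
  have "links E i = (\<Union>e\<in>?F. ?A e)" by (auto simp: links_def)
  then have "(\<Sum>is\<in>links E i. x (is ! 0) * x (is ! 1) / 2) =
      (\<Sum>e\<in>?F. \<Sum>is\<in>?A e. x (is ! 0) * x (is ! 1) / 2)"
    using finite_edges[OF V] A by (simp only:) (rule sum.UNION_disjoint; auto)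
  also have "\<dots> = pd E i x" unfolding pd_def by (rule sum.cong) (use A in auto)
  finally show ?thesis .
qed

section \<open>The AM-GM bound for Lagrangians\<close>

lemma am_gm_3:
  fixes p q r :: real
  assumes "0 \<le> p" "0 \<le> q" "0 \<le> r"
  shows "3 * (p * q * r) \<le> p ^ 3 + q ^ 3 + r ^ 3"
    and "3 * (p * q * r) = p ^ 3 + q ^ 3 + r ^ 3 \<Longrightarrow> p = q \<and> q = r"
proof -
  have id: "2 * (p ^ 3 + q ^ 3 + r ^ 3 - 3 * (p * q * r)) =
      (p + q + r) * ((p - q)\<^sup>2 + (q - r)\<^sup>2 + (p - r)\<^sup>2)"
    by (simp add: power2_eq_square power3_eq_cube algebra_simps)
  have "0 \<le> (p + q + r) * ((p - q)\<^sup>2 + (q - r)\<^sup>2 + (p - r)\<^sup>2)"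
    using assms by (intro mult_nonneg_nonneg add_nonneg_nonneg) auto
  then show "3 * (p * q * r) \<le> p ^ 3 + q ^ 3 + r ^ 3" unfolding id[symmetric] by simp
  assume "3 * (p * q * r) = p ^ 3 + q ^ 3 + r ^ 3"
  with id have "p + q + r = 0 \<or> (p - q)\<^sup>2 + (q - r)\<^sup>2 + (p - r)\<^sup>2 = 0" by auto
  then show "p = q \<and> q = r"
  proof
    assume "p + q + r = 0"
    with assms show ?thesis by linarith
  next
    assume "(p - q)\<^sup>2 + (q - r)\<^sup>2 + (p - r)\<^sup>2 = 0"
    then have "(p - q)\<^sup>2 = 0" "(q - r)\<^sup>2 = 0"
      using zero_le_power2[of "p - q"] zero_le_power2[of "q - r"] zero_le_power2[of "p - r"] by linarith+
    then show ?thesis by simp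
  qed
qed

lemma am_gm_set:
  fixes p :: "'v \<Rightarrow> real"
  assumes "card e = 3" and p: "\<And>i. i \<in> e \<Longrightarrow> 0 \<le> p i"
  shows "3 * (\<Prod>i\<in>e. p i) \<le> (\<Sum>i\<in>e. p i ^ 3)"
    and "3 * (\<Prod>i\<in>e. p i) = (\<Sum>i\<in>e. p i ^ 3) \<Longrightarrow> i \<in> e \<Longrightarrow> k \<in> e \<Longrightarrow> p i = p k"
proof -
  obtain a b c where e: "e = {a, b, c}" "a \<noteq> b" "a \<noteq> c" "b \<noteq> c"
    using assms(1) unfolding card_3_iff by metis
  then have nn: "0 \<le> p a" "0 \<le> p b" "0 \<le> p c" using p by auto
  show "3 * (\<Prod>i\<in>e. p i) \<le> (\<Sum>i\<in>e. p i ^ 3)"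
    using am_gm_3(1)[OF nn] e by (simp add: ac_simps)
  assume "3 * (\<Prod>i\<in>e. p i) = (\<Sum>i\<in>e. p i ^ 3)" "i \<in> e" "k \<in> e"
  with am_gm_3(2)[OF nn] e show "p i = p k" by (auto simp: ac_simps)
qed

text \<open>On each edge AM-GM is applied to the ratios y_i / x_i and multiplied by the product of
  the x_i; \<open>euler_Lag\<close> with the cubed ratios as weights then sums over edges.
  \<open>d e\<close> is the deficit of one edge, so equality in total forces equality on every
  edge.\<close>

lemma Lag_am_gm:
  fixes x y :: "'v \<Rightarrow> real"
  assumes V: "finite V" "E \<subseteq> Pow V" and E: "\<And>e. e \<in> E \<Longrightarrow> card e = 3"
    and x: "\<And>i. i \<in> V \<Longrightarrow> 0 < x i" and y: "\<And>i. i \<in> V \<Longrightarrow> 0 \<le> y i"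
  shows "3 * Lag E y \<le> (\<Sum>j\<in>V. (y j / x j) ^ 3 * (x j * pd E j x))"
    and "3 * Lag E y = (\<Sum>j\<in>V. (y j / x j) ^ 3 * (x j * pd E j x)) \<Longrightarrow>
      e \<in> E \<Longrightarrow> i \<in> e \<Longrightarrow> k \<in> e \<Longrightarrow> y i / x i = y k / x k"
proof -
  note fin = finite_edges[OF V]
  let ?p = "\<lambda>i. y i / x i"
  have p: "0 \<le> ?p i" if "e \<in> E" "i \<in> e" for e i
    using that V(2) x[of i] y[of i] by (auto intro!: divide_nonneg_pos)
  have prod_pos: "0 < (\<Prod>i\<in>e. x i)" if "e \<in> E" for e
    using that V(2) by (intro prod_pos) (auto intro: x)
  have y_eq: "3 * (\<Prod>i\<in>e. y i) = (\<Prod>i\<in>e. x i) * (3 * (\<Prod>i\<in>e. ?p i))" if "e \<in> E" for e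
  proof -
    have "(\<Prod>i\<in>e. y i) = (\<Prod>i\<in>e. x i * ?p i)"
    proof (rule prod.cong[OF refl])
      fix i assume "i \<in> e"
      with that V(2) have "0 < x i" by (intro x) auto
      then show "y i = x i * ?p i" by simp
    qed
    also have "\<dots> = (\<Prod>i\<in>e. x i) * (\<Prod>i\<in>e. ?p i)" by (rule prod.distrib)
    finally show ?thesis by (metis mult.left_commute)
  qed
  define d where "d e = (\<Prod>i\<in>e. x i) * (\<Sum>i\<in>e. ?p i ^ 3) - 3 * (\<Prod>i\<in>e. y i)" for e
  have d: "0 \<le> d e" if "e \<in> E" for e
    using mult_left_mono[OF am_gm_set(1)[OF E[OF that], of ?p] less_imp_le[OF prod_pos[OF that]]] p[OF that]
    by (simp add: d_def y_eq[OF that])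
  have sum_d: "(\<Sum>j\<in>V. ?p j ^ 3 * (x j * pd E j x)) - 3 * Lag E y = sum d E"
    by (simp add: euler_Lag[OF V] Lag_def d_def sum_subtractf sum_distrib_left)
  then show "3 * Lag E y \<le> (\<Sum>j\<in>V. ?p j ^ 3 * (x j * pd E j x))"
    using sum_nonneg[where f = d and A = E, OF d] by simp
  assume "3 * Lag E y = (\<Sum>j\<in>V. ?p j ^ 3 * (x j * pd E j x))" and e: "e \<in> E" "i \<in> e" "k \<in> e"
  then have "d e = 0" using sum_d sum_nonneg_eq_0_iff[OF fin(1), of d] d by auto
  then have "3 * (\<Prod>i\<in>e. ?p i) = (\<Sum>i\<in>e. ?p i ^ 3)"
    using prod_pos[OF e(1)] y_eq[OF e(1)] by (simp add: d_def)
  then show "?p i = ?p k" using am_gm_set(2)[OF E[OF e(1)], of ?p] p[OF e(1)] e by blast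
qed

text \<open>A Rayleigh-type bound: the eigenvalue equation collapses the right side of
  \<open>Lag_am_gm\<close> to \<open>l\<close> times the sum of cubes.\<close>

lemma eigenvector_bound:
  fixes x y :: "'v \<Rightarrow> real"
  assumes V: "finite V" "E \<subseteq> Pow V" and E: "\<And>e. e \<in> E \<Longrightarrow> card e = 3"
    and x: "\<And>i. i \<in> V \<Longrightarrow> 0 < x i" and y: "\<And>i. i \<in> V \<Longrightarrow> 0 \<le> y i"
    and eig: "\<And>i. i \<in> V \<Longrightarrow> pd E i x = l * x i ^ 2"
  shows "3 * Lag E y \<le> l * (\<Sum>j\<in>V. y j ^ 3)"
    and "3 * Lag E y = l * (\<Sum>j\<in>V. y j ^ 3) \<Longrightarrow>
      e \<in> E \<Longrightarrow> i \<in> e \<Longrightarrow> k \<in> e \<Longrightarrow> y i / x i = y k / x k"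
proof -
  have "(y j / x j) ^ 3 * (x j * pd E j x) = l * y j ^ 3" if "j \<in> V" for j
    using x[OF that] eig[OF that] by (simp add: power_divide power2_eq_square power3_eq_cube)
  then have sum: "(\<Sum>j\<in>V. (y j / x j) ^ 3 * (x j * pd E j x)) = l * (\<Sum>j\<in>V. y j ^ 3)"
    by (simp add: sum_distrib_left)
  show "3 * Lag E y \<le> l * (\<Sum>j\<in>V. y j ^ 3)"
    using Lag_am_gm(1)[where x = x and y = y, OF V E x y] sum by simp
  assume "3 * Lag E y = l * (\<Sum>j\<in>V. y j ^ 3)" "e \<in> E" "i \<in> e" "k \<in> e"
  then show "y i / x i = y k / x k"
    using Lag_am_gm(2)[where x = x and y = y, OF V E x y, of e i k] unfolding sum by blast
qed

lemma eigenvector_value: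
  fixes x :: "'v \<Rightarrow> real"
  assumes V: "finite V" "E \<subseteq> Pow V" and E: "\<And>e. e \<in> E \<Longrightarrow> card e = 3"
  shows "3 * Lag E x = (\<Sum>j\<in>V. x j * pd E j x)"
  using euler_Lag[OF V, of "\<lambda>_. 1" x] E by (simp add: Lag_def sum_distrib_left mult.commute cong: sum.cong)

text \<open>The hypothesis is the critical point equation of \<open>Lag E x + \<kappa> \<Sum>x\<^sub>i\<close> for fixed \<open>\<Sum>x\<^sub>i\<^sup>3\<close>. The
  linear term makes the maximum strict, by \<open>y\<^sup>3 / x\<^sup>2 \<ge> 3y - 2x\<close>.\<close>

lemma affine_eigenvector_rigid:
  fixes x y :: "'v \<Rightarrow> real"
  assumes V: "finite V" "E \<subseteq> Pow V" and E: "\<And>e. e \<in> E \<Longrightarrow> card e = 3"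
    and x: "\<And>i. i \<in> V \<Longrightarrow> 0 < x i" and y: "\<And>i. i \<in> V \<Longrightarrow> 0 \<le> y i"
    and eig: "\<And>i. i \<in> V \<Longrightarrow> pd E i x + \<kappa> = l * x i ^ 2" and "0 < \<kappa>"
    and same: "Lag E y = Lag E x" "(\<Sum>j\<in>V. y j) = (\<Sum>j\<in>V. x j)" "(\<Sum>j\<in>V. y j ^ 3) = (\<Sum>j\<in>V. x j ^ 3)"
    and "j \<in> V"
  shows "y j = x j"
proof -
  have pdx: "pd E i x = l * x i ^ 2 - \<kappa>" if "i \<in> V" for i using eig[OF that] by simp
  let ?q = "\<lambda>i. y i ^ 3 / x i ^ 2"
  have "(y i / x i) ^ 3 * (x i * pd E i x) = l * y i ^ 3 - \<kappa> * ?q i" if "i \<in> V" for i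
    using x[OF that] by (simp add: pdx[OF that] power_divide power2_eq_square power3_eq_cube field_simps)
  then have "(\<Sum>i\<in>V. (y i / x i) ^ 3 * (x i * pd E i x)) =
      l * (\<Sum>i\<in>V. y i ^ 3) - \<kappa> * (\<Sum>i\<in>V. ?q i)"
    by (simp only: sum_distrib_left sum_subtractf cong: sum.cong)
  then have "3 * Lag E y \<le> l * (\<Sum>i\<in>V. y i ^ 3) - \<kappa> * (\<Sum>i\<in>V. ?q i)"
    using Lag_am_gm(1)[where x = x and y = y, OF V E x y] by simp
  moreover have "3 * Lag E x = l * (\<Sum>i\<in>V. x i ^ 3) - \<kappa> * (\<Sum>i\<in>V. x i)"
  proof -
    have "x i * pd E i x = l * x i ^ 3 - \<kappa> * x i" if "i \<in> V" for i
      by (simp add: pdx[OF that] power2_eq_square power3_eq_cube algebra_simps)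
    then have "(\<Sum>i\<in>V. x i * pd E i x) = l * (\<Sum>i\<in>V. x i ^ 3) - \<kappa> * (\<Sum>i\<in>V. x i)"
      by (simp only: sum_distrib_left sum_subtractf cong: sum.cong)
    with eigenvector_value[where x = x, OF V E] show ?thesis by simp
  qed
  ultimately have "\<kappa> * (\<Sum>i\<in>V. ?q i) \<le> \<kappa> * (\<Sum>i\<in>V. x i)" using same by simp
  then have q_le: "(\<Sum>i\<in>V. ?q i) \<le> (\<Sum>i\<in>V. x i)" using \<open>0 < \<kappa>\<close> by simp
  \<comment> \<open>Since (y - x)^2 (y + 2x) = y^3 - 3 y x^2 + 2 x^3, this is the gap in y^3 / x^2
    >= 3y - 2x, and it vanishes only at y = x.\<close>
  define d where "d i = (y i - x i) ^ 2 * (y i + 2 * x i) / x i ^ 2" for i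
  have d: "0 \<le> d i" if "i \<in> V" for i using x[OF that] y[OF that] by (simp add: d_def)
  have "d i = ?q i - 3 * y i + 2 * x i" if "i \<in> V" for i
    using x[OF that] by (simp add: d_def field_simps power2_eq_square power3_eq_cube)
  then have "sum d V = (\<Sum>i\<in>V. ?q i) - 3 * (\<Sum>i\<in>V. y i) + 2 * (\<Sum>i\<in>V. x i)"
    by (simp add: sum.distrib sum_subtractf sum_distrib_left)
  then have "sum d V \<le> 0" using q_le same by simp
  then have "sum d V = 0" using sum_nonneg[of V d] d by force
  then have "d j = 0" using sum_nonneg_eq_0_iff[OF V(1), of d] d \<open>j \<in> V\<close> by auto
  then show ?thesis using x[OF \<open>j \<in> V\<close>] y[OF \<open>j \<in> V\<close>] by (auto simp: d_def)
qed

section \<open>Existence of a positive eigenvector\<close>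

lemma Lag_scale:
  fixes w :: "'v \<Rightarrow> 'a::comm_semiring_1"
  assumes "\<And>e. e \<in> E \<Longrightarrow> card e = 3"
  shows "Lag E (\<lambda>i. c * w i) = c ^ 3 * Lag E w"
  using assms by (simp add: Lag_def prod.distrib sum_distrib_left)

lemma continuous_on_Lag: "continuous_on A (\<lambda>x::'v \<Rightarrow> real. Lag E x)"
  unfolding Lag_def
  by (intro continuous_on_sum continuous_on_prod continuous_on_subset[OF continuous_on_product_coordinates]) simp

text \<open>Vectors are functions on the whole type; pinning the coordinates outside
  \<open>V\<close> to 0 makes the set a full product of compact sets, so Tychonoff applies.\<close>

lemma compact_unit_box:
  "compact {x :: 'v \<Rightarrow> real. (\<forall>i\<in>V. 0 \<le> x i \<and> x i \<le> 1) \<and> (\<forall>i. i \<notin> V \<longrightarrow> x i = 0)}"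
proof -
  have "compactin (product_topology (\<lambda>_. euclidean) UNIV)
      (PiE UNIV (\<lambda>i. if i \<in> V then {0..1::real} else {0}))"
    by (auto simp: compactin_PiE)
  then have "compact (PiE UNIV (\<lambda>i. if i \<in> V then {0..1::real} else {0}))"
    by (simp add: euclidean_product_topology)
  also have "PiE UNIV (\<lambda>i. if i \<in> V then {0..1::real} else {0}) =
      {x. (\<forall>i\<in>V. 0 \<le> x i \<and> x i \<le> 1) \<and> (\<forall>i. i \<notin> V \<longrightarrow> x i = 0)}"
    by (auto simp: PiE_iff split: if_splits)
  finally show ?thesis .
qed

text \<open>Compactness gives a maximum under the constraint. Both sides are homogeneous of degree
  3, so rescaling turns it into an inequality for all nonnegative vectors.\<close>

lemma Lag_maximizer:
  assumes V: "finite V" "V \<noteq> {}" "E \<subseteq> Pow V" and E: "\<And>e. e \<in> E \<Longrightarrow> card e = 3"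
  obtains x :: "'v \<Rightarrow> real" where "\<And>i. 0 \<le> x i" "(\<Sum>i\<in>V. x i ^ 3) = 1"
    "\<And>y. (\<And>i. i \<in> V \<Longrightarrow> 0 \<le> y i) \<Longrightarrow> Lag E y \<le> Lag E x * (\<Sum>i\<in>V. y i ^ 3)"
proof -
  define B where "B = {x :: 'v \<Rightarrow> real. (\<forall>i\<in>V. 0 \<le> x i \<and> x i \<le> 1) \<and> (\<forall>i. i \<notin> V \<longrightarrow> x i = 0)}"
  define K where "K = B \<inter> {x. (\<Sum>i\<in>V. x i ^ 3) = 1}"
  have "closed {x :: 'v \<Rightarrow> real. (\<Sum>i\<in>V. x i ^ 3) = 1}"
    by (intro closed_Collect_eq) (auto intro!: continuous_intros)
  then have "compact K" unfolding K_def B_def by (rule compact_Int_closed[OF compact_unit_box])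
  moreover have "K \<noteq> {}"
  proof -
    obtain v where v: "v \<in> V" using V(2) by blast
    have "(\<lambda>i. if i = v then 1 else 0) \<in> K"
      using v V(1) by (auto simp: K_def B_def if_distrib[of "\<lambda>z. z ^ 3"] cong: if_cong)
    then show ?thesis by blast
  qed
  ultimately obtain x where x: "x \<in> K" "\<And>y. y \<in> K \<Longrightarrow> Lag E y \<le> Lag E x"
    using continuous_attains_sup[OF _ _ continuous_on_Lag, of K E] by blast
  have "Lag E y \<le> Lag E x * (\<Sum>i\<in>V. y i ^ 3)" if y: "\<And>i. i \<in> V \<Longrightarrow> 0 \<le> y i" for y
  proof -
    define S where "S = (\<Sum>i\<in>V. y i ^ 3)"
    have S: "0 \<le> S" unfolding S_def using y by (intro sum_nonneg) auto
    show ?thesis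
    proof (cases "S = 0")
      case True
      then have y0: "y i = 0" if "i \<in> V" for i
        using sum_nonneg_eq_0_iff[OF V(1), of "\<lambda>i. y i ^ 3"] y that by (auto simp: S_def)
      have "Lag E y = 0"
        unfolding Lag_def
      proof (rule sum.neutral, rule ballI)
        fix e assume e: "e \<in> E"
        then have "finite e" "e \<noteq> {}" using E[OF e] by (auto intro: card_ge_0_finite)
        then show "(\<Prod>i\<in>e. y i) = 0" using e V(3) y0 by (auto simp: prod_zero_iff)
      qed
      then show ?thesis using True by (simp add: S_def)
    next
      case False
      define c where "c = root 3 S"
      have c: "0 < c" "c ^ 3 = S" using S False by (auto simp: c_def)
      define z where "z i = (if i \<in> V then inverse c * y i else 0)" for i
      have z3: "(\<Sum>i\<in>V. z i ^ 3) = 1"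
        using c False by (simp add: z_def power_mult_distrib sum_distrib_left[symmetric] S_def[symmetric]
            power_inverse)
      have "z i ^ 3 \<le> 1 ^ 3" if "i \<in> V" for i
        using member_le_sum[OF that, of "\<lambda>i. z i ^ 3"] V(1) y c z3 by (auto simp: z_def)
      then have "z i \<le> 1" if "i \<in> V" for i using that by (auto intro: power_le_imp_le_base[of _ 2] simp: eval_nat_numeral)
      then have "z \<in> K" using z3 y c by (auto simp: K_def B_def z_def)
      then have "Lag E z \<le> Lag E x" by (rule x(2))
      moreover have "Lag E y = c ^ 3 * Lag E z"
      proof -
        have "Lag E y = Lag E (\<lambda>i. c * z i)"
          using V(3) c by (intro Lag_cong) (auto simp: z_def)
        also have "\<dots> = c ^ 3 * Lag E z" by (rule Lag_scale[OF E])
        finally show ?thesis .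
      qed
      ultimately show ?thesis using S c(2) by (simp add: S_def[symmetric] mult.commute mult_left_mono)
    qed
  qed
  moreover have "0 \<le> x i" for i using x(1) by (cases "i \<in> V") (auto simp: K_def B_def)
  moreover have "(\<Sum>i\<in>V. x i ^ 3) = 1" using x(1) by (simp add: K_def)
  ultimately show ?thesis using that by blast
qed

text \<open>Raise all zero coordinates to s. An edge meeting both the zero set and its complement
  has at most two zero vertices and gains at least a multiple of s^2, while the sum of cubes grows
  only by a multiple of s^3; small s contradicts maximality.\<close>

lemma maximizer_pos:
  fixes x :: "'v \<Rightarrow> real"
  assumes V: "finite V" "E \<subseteq> Pow V" and E: "\<And>e. e \<in> E \<Longrightarrow> card e = 3"
    and h: "h \<in> V" and hub: "\<And>i. i \<in> V \<Longrightarrow> i \<noteq> h \<Longrightarrow> \<exists>k. {i, h, k} \<in> E"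
    and x: "\<And>i. 0 \<le> x i" "(\<Sum>i\<in>V. x i ^ 3) = 1"
    and max: "\<And>y. (\<And>i. i \<in> V \<Longrightarrow> 0 \<le> y i) \<Longrightarrow> Lag E y \<le> Lag E x * (\<Sum>i\<in>V. y i ^ 3)"
    and "j \<in> V"
  shows "0 < x j"
proof (rule ccontr)
  assume "\<not> ?thesis"
  define Z where "Z = {i \<in> V. x i = 0}"
  have jZ: "j \<in> Z" using \<open>\<not> 0 < x j\<close> x(1)[of j] \<open>j \<in> V\<close> by (simp add: Z_def)
  note fin = finite_edges[OF V]
  \<comment> \<open>The edge passes through the hub: if x_h = 0 it is taken through a nonzero
    vertex, otherwise through \<open>j\<close>.\<close>
  have "\<exists>e\<in>E. e \<inter> Z \<noteq> {} \<and> e - Z \<noteq> {}"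
  proof (cases "x h = 0")
    case True
    have "\<exists>i\<in>V. x i \<noteq> 0"
    proof (rule ccontr)
      assume "\<not> ?thesis"
      then have "(\<Sum>i\<in>V. x i ^ 3) = 0" by simp
      with x(2) show False by simp
    qed
    then obtain i where i: "i \<in> V" "x i \<noteq> 0" by blast
    then obtain k where "{i, h, k} \<in> E" using hub True by blast
    then show ?thesis using i True h by (intro bexI[of _ "{i, h, k}"]) (auto simp: Z_def)
  next
    case False
    then have "j \<noteq> h" using jZ by (auto simp: Z_def)
    then obtain k where "{j, h, k} \<in> E" using hub \<open>j \<in> V\<close> by blast
    then show ?thesis using jZ False by (intro bexI[of _ "{j, h, k}"]) (auto simp: Z_def)
  qed
  then obtain e where e: "e \<in> E" "e \<inter> Z \<noteq> {}" "e - Z \<noteq> {}" by blast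
  have fe: "finite e" using fin(2)[OF e(1)] .
  have cz: "card (e \<inter> Z) \<le> 2"
  proof -
    have "card (e \<inter> Z) < card e" using fe e(3) by (intro psubset_card_mono) auto
    then show ?thesis using E[OF e(1)] by simp
  qed
  define m where "m = (\<Prod>i\<in>e - Z. x i)"
  have m: "0 < m"
    unfolding m_def
  proof (rule prod_pos)
    fix i assume "i \<in> e - Z"
    then have "i \<in> V" "x i \<noteq> 0" using e(1) V(2) by (auto simp: Z_def)
    then show "0 < x i" using x(1)[of i] by simp
  qed
  let ?L = "Lag E x"
  have L: "0 \<le> ?L" unfolding Lag_def by (intro sum_nonneg prod_nonneg) (use x in auto)
  have key: "s ^ 2 * m \<le> ?L * (real (card Z) * s ^ 3)" if s: "0 < s" "s \<le> 1" for s
  proof -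
    define y where "y i = (if i \<in> Z then s else x i)" for i
    have y: "0 \<le> y i" "x i \<le> y i" for i using s x(1)[of i] by (auto simp: y_def Z_def)
    have "(\<Prod>i\<in>e. y i) = (\<Prod>i\<in>e \<inter> Z. y i) * (\<Prod>i\<in>e - Z. y i)"
      by (rule prod.Int_Diff[OF fe])
    also have "\<dots> = s ^ card (e \<inter> Z) * m" by (simp add: y_def m_def)
    finally have "s ^ 2 * m \<le> (\<Prod>i\<in>e. y i)"
      using power_decreasing[OF cz, of s] s m by simp
    moreover have "(\<Prod>i\<in>e. x i) = 0" using e(2) fe by (auto simp: prod_zero_iff Z_def)
    moreover have "(\<Sum>f\<in>E - {e}. \<Prod>i\<in>f. x i) \<le> (\<Sum>f\<in>E - {e}. \<Prod>i\<in>f. y i)"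
      by (intro sum_mono prod_mono) (use x(1) y(2) in auto)
    ultimately have "?L + s ^ 2 * m \<le> Lag E y"
      by (simp add: Lag_def sum.remove[OF fin(1) e(1)])
    also have "\<dots> \<le> ?L * (\<Sum>i\<in>V. y i ^ 3)" using max y(1) by blast
    also have "(\<Sum>i\<in>V. y i ^ 3) = (\<Sum>i\<in>V. x i ^ 3 + (if i \<in> Z then s ^ 3 else 0))"
      by (rule sum.cong) (auto simp: y_def Z_def)
    also have "\<dots> = 1 + real (card Z) * s ^ 3"
    proof -
      have "V \<inter> {i. i \<in> Z} = Z" by (auto simp: Z_def)
      then show ?thesis by (simp add: sum.distrib x(2) sum.If_cases[OF V(1)])
    qed
    finally show ?thesis by (simp add: algebra_simps)
  qed
  define C where "C = ?L * real (card Z)"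
  have C: "0 \<le> C" using L by (simp add: C_def)
  \<comment> \<open>Chosen so that s (C + 1) <= m, against m <= C s from \<open>key\<close>.\<close>
  define s where "s = min 1 (m / (C + 1))"
  have s: "0 < s" "s \<le> 1" "s * (C + 1) \<le> m"
  proof -
    show "0 < s" "s \<le> 1" using m C by (auto simp: s_def)
    have "s \<le> m / (C + 1)" by (simp add: s_def)
    then show "s * (C + 1) \<le> m" using C by (simp add: pos_le_divide_eq)
  qed
  have "s ^ 2 * m \<le> s ^ 2 * (C * s)"
    using key[OF s(1,2)] by (simp add: C_def power2_eq_square power3_eq_cube algebra_simps)
  then have "m \<le> C * s" using s(1) by simp
  with s show False by (simp add: algebra_simps)
qed

lemma perron_eigenvector:
  assumes V: "finite V" "E \<subseteq> Pow V" and E: "\<And>e. e \<in> E \<Longrightarrow> card e = 3"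
    and h: "h \<in> V" and hub: "\<And>i. i \<in> V \<Longrightarrow> i \<noteq> h \<Longrightarrow> \<exists>k. {i, h, k} \<in> E"
  obtains x :: "'v \<Rightarrow> real" and l where "\<And>i. i \<in> V \<Longrightarrow> 0 < x i" "\<And>i. i \<in> V \<Longrightarrow> pd E i x = l * x i ^ 2"
proof -
  have "V \<noteq> {}" using h by blast
  from Lag_maximizer[OF V(1) this V(2) E] obtain x :: "'v \<Rightarrow> real" where
    x: "\<And>i. 0 \<le> x i" "(\<Sum>i\<in>V. x i ^ 3) = 1"
      "\<And>y. (\<And>i. i \<in> V \<Longrightarrow> 0 \<le> y i) \<Longrightarrow> Lag E y \<le> Lag E x * (\<Sum>i\<in>V. y i ^ 3)"
    by metis
  have pos: "0 < x i" if "i \<in> V" for i by (rule maximizer_pos[OF V E h hub x that])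
  note fin = finite_edges[OF V]
  let ?L = "Lag E x"
  have "pd E j x = (3 * ?L) * x j ^ 2" if j: "j \<in> V" for j
  proof -
    \<comment> \<open>The gap in the maximality inequality along coordinate \<open>j\<close>:
      nonnegative near 0 and zero at 0, so its derivative vanishes. The inequality holds off the
      constraint, hence no multiplier appears.\<close>
    define \<phi> where "\<phi> s = ?L * (1 - x j ^ 3 + (x j + s) ^ 3) - (?L + s * pd E j x)" for s
    have nonneg: "0 \<le> \<phi> s" if "\<bar>0 - s\<bar> < x j" for s
    proof -
      let ?y = "x(j := x j + s)"
      have "0 \<le> ?y i" for i using x(1)[of i] that by auto
      then have "Lag E ?y \<le> ?L * (\<Sum>i\<in>V. ?y i ^ 3)" by (intro x(3)) auto
      moreover have "(\<Sum>i\<in>V. ?y i ^ 3) = 1 - x j ^ 3 + (x j + s) ^ 3"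
      proof -
        have "(\<Sum>i\<in>V - {j}. ?y i ^ 3) = (\<Sum>i\<in>V - {j}. x i ^ 3)" by (rule sum.cong) auto
        then show ?thesis using x(2) by (simp add: sum.remove[OF V(1) j])
      qed
      ultimately show ?thesis by (simp add: \<phi>_def Lag_upd[OF fin])
    qed
    have "(\<phi> has_real_derivative 3 * ?L * x j ^ 2 - pd E j x) (at 0)"
      unfolding \<phi>_def by (auto intro!: derivative_eq_intros)
    then have "3 * ?L * x j ^ 2 - pd E j x = 0"
      by (rule DERIV_local_min[OF _ pos[OF j]]) (use nonneg in \<open>auto simp: \<phi>_def\<close>)
    then show ?thesis by simp
  qed
  with pos show ?thesis using that by blast
qed

section \<open>Substitution in multilinear polynomials\<close>

lemma const_0: "const 0 = 0" and const_add: "const (a + b) = const a + const b"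
  by (simp_all add: const_def single_add)

lemma poly_subst_superset:
  assumes "finite A" "Poly_Mapping.keys p \<subseteq> A"
  shows "poly_subst s p = (\<Sum>\<alpha>\<in>A. const (Poly_Mapping.lookup p \<alpha>) *
    (\<Prod>i\<in>Poly_Mapping.keys \<alpha>. s i ^ Poly_Mapping.lookup \<alpha> i))"
  unfolding poly_subst_def
  by (rule sum.mono_neutral_left) (use assms in \<open>auto simp: in_keys_iff const_0\<close>)

lemma poly_subst_0: "poly_subst s 0 = 0"
  by (simp add: poly_subst_def)

lemma poly_subst_add: "poly_subst s (p + q) = poly_subst s p + poly_subst s q"
proof -
  let ?A = "Poly_Mapping.keys p \<union> Poly_Mapping.keys q"
  have "poly_subst s (p + q) = (\<Sum>\<alpha>\<in>?A. const (Poly_Mapping.lookup (p + q) \<alpha>) *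
      (\<Prod>i\<in>Poly_Mapping.keys \<alpha>. s i ^ Poly_Mapping.lookup \<alpha> i))"
    by (rule poly_subst_superset) (use keys_add[of p q] in auto)
  also have "\<dots> = poly_subst s p + poly_subst s q"
    by (simp add: poly_subst_superset[of ?A p] poly_subst_superset[of ?A q] lookup_add const_add
        distrib_right sum.distrib)
  finally show ?thesis .
qed

lemma poly_subst_sum: "poly_subst s (\<Sum>i\<in>A. f i) = (\<Sum>i\<in>A. poly_subst s (f i))"
  by (induction A rule: infinite_finite_induct) (simp_all add: poly_subst_0 poly_subst_add)

lemma prod_var:
  assumes "finite e"
  shows "(\<Prod>i\<in>e. var i) = Poly_Mapping.single (\<Sum>i\<in>e. Poly_Mapping.single i 1) 1"
  using assms by (induction e rule: finite_induct) (simp_all add: var_def mult_single)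

text \<open>The polynomials to be substituted into are Lagrangians, whose monomials are squarefree;
  together with additivity this carries the homomorphisms through the construction.\<close>

lemma poly_subst_prod_var:
  assumes "finite e"
  shows "poly_subst s (\<Prod>i\<in>e. var i) = (\<Prod>i\<in>e. s i)"
proof -
  let ?m = "\<Sum>i\<in>e. Poly_Mapping.single i (1::nat)"
  have l: "Poly_Mapping.lookup ?m i = (if i \<in> e then 1 else 0)" for i
    using assms by (simp add: lookup_sum lookup_single when_def)
  then have k: "Poly_Mapping.keys ?m = e" by (auto simp: in_keys_iff split: if_splits)
  show ?thesis
    unfolding prod_var[OF assms] poly_subst_def using k l by (simp add: const_def)
qed

lemma poly_subst_Lag:
  assumes "\<And>e. e \<in> E \<Longrightarrow> finite e"
  shows "poly_subst s (Lag E var) = Lag E s"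
  unfolding Lag_def poly_subst_sum by (intro sum.cong refl poly_subst_prod_var assms)

section \<open>The edge sets\<close>

text \<open>Truncated subtraction puts 0 into class 1, so congruences between a vertex and its class
  are stated for positive vertices.\<close>

definition cls :: "nat \<Rightarrow> nat \<Rightarrow> nat" where
  "cls r j = (j - 1) mod 2 ^ r + 1"

definition class_sum :: "nat \<Rightarrow> nat \<Rightarrow> (nat \<Rightarrow> 'a::comm_semiring_1) \<Rightarrow> nat \<Rightarrow> 'a" where
  "class_sum r n w c = (\<Sum>j | j \<in> {1..2 ^ n} \<and> cls r j = c. w j)"

text \<open>The blow-up of \<open>T\<close> along residue classes. Injectivity makes
  \<open>f\<close> a transversal, so expanding products of class sums produces each such
  \<open>f\<close> exactly once.\<close>

definition blow :: "nat \<Rightarrow> nat \<Rightarrow> nat set set \<Rightarrow> nat set set" where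
  "blow r n T = {f. f \<subseteq> {1..2 ^ n} \<and> inj_on (cls r) f \<and> cls r ` f \<in> T}"

text \<open>Eight triples of step 1 and eight of step 3 modulo 8. Multiplication by 3 exchanges the
  two kinds because 9 is 1 modulo 8; this is the symmetry behind the maps 3c + b used later.\<close>

definition T33 :: "nat set set" where
  "T33 = set [{8,1,2}, {1,2,3}, {2,3,4}, {3,4,5}, {4,5,6}, {5,6,7}, {6,7,8}, {7,8,1},
     {6,1,4}, {7,2,5}, {8,3,6}, {1,4,7}, {2,5,8}, {3,6,1}, {4,7,2}, {5,8,3}]"

text \<open>\<open>gam n\<close> is the edge set of \<open>\<Gamma>\<^sub>n\<close>, summed over \<open>k\<close>. The recursion can start at level 2 because
  \<open>G23\<close> is the image of \<open>x\<^sub>1x\<^sub>2x\<^sub>3 + x\<^sub>2x\<^sub>3x\<^sub>4\<close> under the two doubling maps.\<close>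

fun gam :: "nat \<Rightarrow> nat set set" where
  "gam n = (if n \<le> 2 then {{1,2,3}, {2,3,4}}
     else blow 3 n T33 \<union> (`) (\<lambda>i. 2 * i) ` gam (n - 1) \<union> (`) (\<lambda>i. 2 * i - 1) ` gam (n - 1))"

declare gam.simps [simp del]

lemma gam_2: "gam 2 = {{1,2,3}, {2,3,4}}"
  by (simp add: gam.simps)

lemma gam_Suc: "2 \<le> n \<Longrightarrow> gam (Suc n) =
    blow 3 (Suc n) T33 \<union> (`) (\<lambda>i. 2 * i) ` gam n \<union> (`) (\<lambda>i. 2 * i - 1) ` gam n"
  by (subst gam.simps) simp

text \<open>Distinctness of the sets is tested on their binary codes, numerals that the simplifier
  can compare.\<close>

lemma Lag_set:
  assumes "distinct (map (sum (\<lambda>i. 2 ^ i :: nat)) xs)"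
  shows "Lag (set xs) w = (\<Sum>e\<leftarrow>xs. \<Prod>i\<in>e. w i)"
  using assms by (simp add: Lag_def sum.distinct_set_conv_list distinct_map)

lemma Lag_T33:
  "Lag T33 w = w 8 * w 1 * w 2 + w 1 * w 2 * w 3 + w 2 * w 3 * w 4 + w 3 * w 4 * w 5 +
    w 4 * w 5 * w 6 + w 5 * w 6 * w 7 + w 6 * w 7 * w 8 + w 7 * w 8 * w 1 +
    w 6 * w 1 * w 4 + w 7 * w 2 * w 5 + w 8 * w 3 * w 6 + w 1 * w 4 * w 7 +
    w 2 * w 5 * w 8 + w 3 * w 6 * w 1 + w 4 * w 7 * w 2 + w 5 * w 8 * w 3"
  unfolding T33_def by (subst Lag_set) (simp, simp add: add.assoc mult.assoc)

lemma T33_card: "e \<in> T33 \<Longrightarrow> card e = 3 \<and> e \<subseteq> {1..8}"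
proof -
  have "\<forall>e\<in>T33. card e = 3 \<and> e \<subseteq> {1..8}" by (simp add: T33_def)
  then show "e \<in> T33 \<Longrightarrow> card e = 3 \<and> e \<subseteq> {1..8}" by simp
qed

text \<open>Keeps the blown-up edges apart from the two doubled copies, whose edges have vertices of
  one parity only.\<close>

lemma T33_parity: "e \<in> T33 \<Longrightarrow> (\<exists>i\<in>e. odd i) \<and> (\<exists>i\<in>e. even i)"
proof -
  have "\<forall>e\<in>T33. (\<exists>i\<in>e. odd i) \<and> (\<exists>i\<in>e. even i)" by (simp add: T33_def)
  then show "e \<in> T33 \<Longrightarrow> (\<exists>i\<in>e. odd i) \<and> (\<exists>i\<in>e. even i)" by simp
qed

lemma Lag_gam_2: "Lag (gam 2) w = w 1 * w 2 * w 3 + w 2 * w 3 * w 4"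
  unfolding gam_2 using Lag_set[of "[{1,2,3}, {2,3,4}]" w] by (simp add: mult.assoc)

lemma cls_in: "cls r j \<in> {1..2 ^ r}"
  by (simp add: cls_def Suc_leI)

lemma cls_eq_iff:
  assumes "1 \<le> j" "1 \<le> i" "i \<le> 2 ^ r"
  shows "cls r j = i \<longleftrightarrow> j mod 2 ^ r = i mod 2 ^ r"
proof -
  have "cls r j = i \<longleftrightarrow> (j - 1) mod 2 ^ r = (i - 1) mod 2 ^ r"
    using assms by (auto simp: cls_def)
  also have "\<dots> \<longleftrightarrow> (j - 1 + 1) mod 2 ^ r = (i - 1 + 1) mod 2 ^ r"
    by (simp add: nat_mod_eq_iff)
  finally show ?thesis using assms by simp
qed

lemma cls_mod: "1 \<le> j \<Longrightarrow> cls r j mod 2 ^ r = j mod 2 ^ r"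
  using cls_eq_iff[of j "cls r j" r] cls_in[of r j] by simp

lemma cls_id: "j \<in> {1..2 ^ r} \<Longrightarrow> cls r j = j"
  by (cases j) (auto simp: cls_def)

lemma odd_cls: "1 \<le> j \<Longrightarrow> 1 \<le> r \<Longrightarrow> odd (cls r j) \<longleftrightarrow> odd j"
  by (metis cls_mod dvd_mod_iff dvd_power less_le_trans zero_less_one less_one not_less)

text \<open>Expanding a product of class sums chooses a vertex \<open>g c\<close> in each class
  \<open>c\<close> of an edge; the image of \<open>g\<close> identifies these choices with the
  transversals in \<open>blow\<close>.\<close>

lemma Lag_blow:
  fixes w :: "nat \<Rightarrow> 'a::comm_semiring_1"
  assumes T: "finite T" "\<And>e. e \<in> T \<Longrightarrow> finite e"
  shows "Lag (blow r n T) w = Lag T (class_sum r n w)"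
proof -
  define C where "C c = {j. j \<in> {1..2 ^ n} \<and> cls r j = c}" for c
  define F where "F e = {f. f \<subseteq> {1..2 ^ n} \<and> inj_on (cls r) f \<and> cls r ` f = e}" for e
  have finC: "finite (C c)" for c by (simp add: C_def)
  have finF: "finite (F e)" for e by (rule finite_subset[of _ "Pow {1..2 ^ n}"]) (auto simp: F_def)
  have bij: "bij_betw (\<lambda>g. g ` e) (PiE e C) (F e)" for e
    unfolding bij_betw_def
  proof
    show "inj_on (\<lambda>g. g ` e) (PiE e C)"
    proof (rule inj_onI)
      fix g g' assume g: "g \<in> PiE e C" "g' \<in> PiE e C" "g ` e = g' ` e"
      show "g = g'"
      proof (rule PiE_ext[OF g(1,2)])
        fix c assume c: "c \<in> e"
        then obtain c' where c': "c' \<in> e" "g c = g' c'" using g(3) by (metis imageE imageI)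
        have "cls r (g c) = c" "cls r (g' c') = c'" using g c c'(1) by (auto simp: C_def)
        with c'(2) show "g c = g' c" by simp
      qed
    qed
    show "(\<lambda>g. g ` e) ` PiE e C = F e"
    proof
      show "(\<lambda>g. g ` e) ` PiE e C \<subseteq> F e"
      proof (rule image_subsetI)
        fix g assume g: "g \<in> PiE e C"
        then have cg: "cls r (g c) = c" "g c \<in> {1..2 ^ n}" if "c \<in> e" for c using that by (auto simp: C_def)
        then show "g ` e \<in> F e" unfolding F_def by (auto simp: inj_on_def image_image)
      qed
      show "F e \<subseteq> (\<lambda>g. g ` e) ` PiE e C"
      proof
        fix f assume f: "f \<in> F e"
        let ?g = "restrict (the_inv_into f (cls r)) e"
        have "the_inv_into f (cls r) ` e = f"
          using f the_inv_into_onto[of "cls r" f] by (auto simp: F_def)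
        moreover have "?g \<in> PiE e C"
        proof (rule PiE_I)
          fix c assume c: "c \<in> e"
          then have "c \<in> cls r ` f" using f by (simp add: F_def)
          then show "?g c \<in> C c"
            using c f the_inv_into_into[of "cls r" f c f] f_the_inv_into_f[of "cls r" f c]
            by (auto simp: F_def C_def)
        qed simp
        ultimately show "f \<in> (\<lambda>g. g ` e) ` PiE e C" by (force intro!: image_eqI[of _ _ ?g])
      qed
    qed
  qed
  have "Lag T (class_sum r n w) = (\<Sum>e\<in>T. \<Sum>g\<in>PiE e C. \<Prod>c\<in>e. w (g c))"
    unfolding Lag_def class_sum_def C_def[symmetric]
    by (intro sum.cong refl prod_sum_PiE T finC)
  also have "\<dots> = (\<Sum>e\<in>T. \<Sum>f\<in>F e. \<Prod>i\<in>f. w i)"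
  proof (rule sum.cong[OF refl])
    fix e assume "e \<in> T"
    have "(\<Prod>c\<in>e. w (g c)) = (\<Prod>i\<in>g ` e. w i)" if "g \<in> PiE e C" for g
    proof -
      have "cls r (g c) = c" if "c \<in> e" for c using that \<open>g \<in> PiE e C\<close> by (auto simp: C_def)
      then have "inj_on g e" by (metis inj_onI)
      then show ?thesis by (simp add: prod.reindex)
    qed
    then have "(\<Sum>g\<in>PiE e C. \<Prod>c\<in>e. w (g c)) = (\<Sum>g\<in>PiE e C. \<Prod>i\<in>g ` e. w i)"
      by (rule sum.cong[OF refl])
    also have "\<dots> = (\<Sum>f\<in>F e. \<Prod>i\<in>f. w i)"
      by (rule sum.reindex_bij_betw[OF bij])
    finally show "(\<Sum>g\<in>PiE e C. \<Prod>c\<in>e. w (g c)) = (\<Sum>f\<in>F e. \<Prod>i\<in>f. w i)" .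
  qed
  also have "\<dots> = (\<Sum>f\<in>(\<Union>e\<in>T. F e). \<Prod>i\<in>f. w i)"
    using T(1) finF by (subst sum.UNION_disjoint) (auto simp: F_def)
  also have "(\<Union>e\<in>T. F e) = blow r n T" by (auto simp: F_def blow_def)
  finally show ?thesis by (simp add: Lag_def)
qed

lemma Lag_Un_disjoint:
  "finite A \<Longrightarrow> finite B \<Longrightarrow> A \<inter> B = {} \<Longrightarrow> Lag (A \<union> B) w = Lag A w + Lag B w"
  by (simp add: Lag_def sum.union_disjoint)

lemma Lag_image:
  assumes "inj_on f (\<Union>E)"
  shows "Lag ((`) f ` E) w = Lag E (\<lambda>i. w (f i))"
proof -
  have "inj_on ((`) f) E" using assms by (intro inj_on_image) 
  moreover have "inj_on f e" if "e \<in> E" for e using assms that by (auto intro: inj_on_subset)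
  ultimately show ?thesis by (simp add: Lag_def sum.reindex prod.reindex)
qed

lemma Lag_insert:
  assumes "\<And>e. e \<in> E \<Longrightarrow> finite e \<and> v \<notin> e"
  shows "Lag (insert v ` E) w = w v * Lag E w"
proof -
  have "inj_on (insert v) E" using assms by (intro inj_onI) (metis insert_ident)
  then show ?thesis using assms by (simp add: Lag_def sum.reindex sum_distrib_left)
qed

lemma blow_props:
  assumes "\<And>e. e \<in> T \<Longrightarrow> card e = k" "f \<in> blow r n T"
  shows "f \<subseteq> {1..2 ^ n}" "card f = k" "finite f"
  using assms by (auto simp: blow_def intro: finite_subset) (metis card_image)

lemma gam_props: "2 \<le> n \<Longrightarrow> e \<in> gam n \<Longrightarrow> e \<subseteq> {1..2 ^ n} \<and> card e = 3"
proof (induction n arbitrary: e rule: nat_induct_at_least)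
  case base
  then show ?case by (auto simp: gam_2)
next
  case (Suc n)
  from Suc.prems consider "e \<in> blow 3 (Suc n) T33" | f where "f \<in> gam n" "e = (\<lambda>i. 2 * i) ` f"
    | f where "f \<in> gam n" "e = (\<lambda>i. 2 * i - 1) ` f"
    unfolding gam_Suc[OF Suc.hyps(1)] by blast
  then show ?case
  proof cases
    case 1
    then show ?thesis using blow_props(1,2)[of T33 3 e 3 "Suc n"] T33_card by simp
  next
    case 2
    then show ?thesis using Suc.IH[of f] by (force simp: card_image inj_on_def)
  next
    case 3
    have f: "f \<subseteq> {1..2 ^ n}" "card f = 3" using Suc.IH[of f] 3 by auto
    then have "inj_on (\<lambda>i. 2 * i - 1) f" by (intro inj_onI) (auto dest!: subsetD)
    with f show ?thesis unfolding 3(2) by (force simp: card_image)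
  qed
qed

lemma finite_gam: "2 \<le> n \<Longrightarrow> finite (gam n)"
  by (rule finite_subset[of _ "Pow {1..2 ^ n}"]) (use gam_props in auto)

text \<open>The union is disjoint by parity. The even and odd halves are coupled only through the
  eight class sums modulo 8, which is what makes inductions over the level possible.\<close>

lemma Lag_gam_Suc:
  assumes n: "2 \<le> n"
  shows "Lag (gam (Suc n)) w = Lag T33 (class_sum 3 (Suc n) w) +
    Lag (gam n) (\<lambda>i. w (2 * i)) + Lag (gam n) (\<lambda>i. w (2 * i - 1))"
proof -
  let ?A = "(`) (\<lambda>i. 2 * i) ` gam n" and ?B = "(`) (\<lambda>i. 2 * i - 1) ` gam n"
  have nonempty: "\<exists>i. i \<in> e \<and> 1 \<le> i" if "e \<in> gam n" for e
  proof -
    have e: "e \<subseteq> {1..2 ^ n}" "card e = 3" using gam_props[OF n that] by auto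
    then obtain i where "i \<in> e" by (metis card.empty equals0I zero_neq_numeral)
    with e(1) show ?thesis by (intro exI[of _ i]) auto
  qed
  have par: "(\<exists>i\<in>e. odd i) \<and> (\<exists>i\<in>e. even i)" if "e \<in> blow 3 (Suc n) T33" for e
  proof -
    have "e \<subseteq> {1..2 ^ Suc n}" "cls 3 ` e \<in> T33" using that by (auto simp: blow_def)
    then obtain i k where ik: "i \<in> e" "odd (cls 3 i)" "k \<in> e" "even (cls 3 k)"
      using T33_parity[of "cls 3 ` e"] by blast
    then have "1 \<le> i" "1 \<le> k" using \<open>e \<subseteq> {1..2 ^ Suc n}\<close> by auto
    then have "odd i" "even k" using ik odd_cls[of i 3] odd_cls[of k 3] by simp_all
    with ik show ?thesis by blast
  qed
  have evenA: "even i" if "e \<in> ?A" "i \<in> e" for e i using that by auto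
  have oddB: "odd i" if "e \<in> ?B" "i \<in> e" for e i using that gam_props[OF n] by fastforce
  have fin: "finite (blow 3 (Suc n) T33)" "finite ?A" "finite ?B"
    using finite_gam[OF n] finite_gam[of "Suc n"] n gam_Suc[OF n] by auto
  have neB: "e \<noteq> {}" if "e \<in> ?B" for e using that nonempty by blast
  have "Lag (gam (Suc n)) w = Lag (blow 3 (Suc n) T33) w + Lag ?A w + Lag ?B w"
    unfolding gam_Suc[OF n]
  proof (subst Lag_Un_disjoint)
    show "(blow 3 (Suc n) T33 \<union> ?A) \<inter> ?B = {}"
    proof (intro equals0I)
      fix e assume "e \<in> (blow 3 (Suc n) T33 \<union> ?A) \<inter> ?B"
      then have B: "e \<in> ?B" and "e \<in> blow 3 (Suc n) T33 \<or> e \<in> ?A" by simp_all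
      then have "\<exists>i\<in>e. even i" using par[of e] evenA[of e] neB[of e] by (metis ex_in_conv)
      then show False using oddB[OF B] by metis
    qed
    show "Lag (blow 3 (Suc n) T33 \<union> ?A) w + Lag ?B w = Lag (blow 3 (Suc n) T33) w + Lag ?A w + Lag ?B w"
    proof (subst Lag_Un_disjoint)
      show "blow 3 (Suc n) T33 \<inter> ?A = {}"
      proof (intro equals0I)
        fix e assume "e \<in> blow 3 (Suc n) T33 \<inter> ?A"
        then show False using par[of e] evenA[of e] by (metis IntE)
      qed
    qed (use fin in auto)
  qed (use fin in auto)
  moreover have "Lag (blow 3 (Suc n) T33) w = Lag T33 (class_sum 3 (Suc n) w)"
    by (rule Lag_blow) (auto simp: T33_def)
  moreover have "Lag ?A w = Lag (gam n) (\<lambda>i. w (2 * i))"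
    by (rule Lag_image) (auto simp: inj_on_def)
  moreover have "Lag ?B w = Lag (gam n) (\<lambda>i. w (2 * i - 1))"
  proof (rule Lag_image)
    have "\<Union> (gam n) \<subseteq> {1..}" using gam_props[OF n] by fastforce
    moreover have "inj_on (\<lambda>i. 2 * i - 1) {1::nat..}" by (auto simp: inj_on_def)
    ultimately show "inj_on (\<lambda>i. 2 * i - 1) (\<Union> (gam n))" by (rule inj_on_subset[rotated])
  qed
  ultimately show ?thesis by simp
qed

lemma E_hom_Lag:
  assumes T: "\<And>e. e \<in> T \<Longrightarrow> e \<subseteq> {1..2 ^ r}"
  shows "E_hom r n (Lag T var) = Lag T (class_sum r n var)"
proof -
  have "E_hom r n (Lag T var) =
      Lag T (\<lambda>i. \<Sum>j | j \<in> {1..2 ^ n} \<and> j mod 2 ^ r = i mod 2 ^ r. var j)"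
    unfolding E_hom_def by (rule poly_subst_Lag) (use T finite_subset in blast)
  also have "\<dots> = Lag T (class_sum r n var)"
  proof (rule Lag_cong)
    fix e i assume "e \<in> T" "i \<in> e"
    then have i: "1 \<le> i" "i \<le> 2 ^ r" using T by force+
    have "{j. j \<in> {1..2 ^ n} \<and> j mod 2 ^ r = i mod 2 ^ r} = {j. j \<in> {1..2 ^ n} \<and> cls r j = i}"
      using cls_eq_iff[OF _ i] by auto
    then show "(\<Sum>j | j \<in> {1..2 ^ n} \<and> j mod 2 ^ r = i mod 2 ^ r. var j) =
        class_sum r n (var :: nat \<Rightarrow> (nat, complex) mpoly) i"
      by (simp only: class_sum_def)
  qed
  finally show ?thesis .
qed

lemma class_sum_self:
  assumes "c \<in> {1..2 ^ r}"
  shows "class_sum r r w c = w c"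
proof -
  have "{j. j \<in> {1..2 ^ r} \<and> cls r j = c} = {c}" using assms cls_id by auto
  then show ?thesis by (simp add: class_sum_def)
qed

lemma G33_eq: "G33 = Lag T33 var"
proof -
  have "{1..8::int} = {1,2,3,4,5,6,7,8}" by auto
  then show ?thesis unfolding G33_def Lag_T33 by (simp add: red_def add.assoc)
qed

lemma E_hom_G33: "E_hom 3 n G33 = Lag T33 (class_sum 3 n var)"
  unfolding G33_eq by (rule E_hom_Lag) (use T33_card in auto)

lemma p_hom_Lag:
  assumes "2 \<le> n"
  shows "p0_hom (Lag (gam n) var) = Lag (gam n) (\<lambda>i. var (2 * i))"
    and "p1_hom (Lag (gam n) var) = Lag (gam n) (\<lambda>i. var (2 * i - 1))"
proof -
  have "finite e" if "e \<in> gam n" for e using gam_props[OF assms that] by (auto intro: finite_subset)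
  then show "p0_hom (Lag (gam n) var) = Lag (gam n) (\<lambda>i. var (2 * i))"
    and "p1_hom (Lag (gam n) var) = Lag (gam n) (\<lambda>i. var (2 * i - 1))"
    unfolding p0_hom_def p1_hom_def by (simp_all add: poly_subst_Lag)
qed

lemma Gamma_poly_eq: "3 \<le> n \<Longrightarrow> Gamma_poly n = Lag (gam n) var"
proof (induction n rule: nat_induct_at_least)
  case base
  have "Lag T33 (class_sum 3 3 var) = Lag T33 (var :: nat \<Rightarrow> (nat, complex) mpoly)"
  proof (rule Lag_cong, rule class_sum_self)
    fix e i assume "e \<in> T33" "i \<in> e"
    then show "i \<in> {1..2 ^ 3}" using T33_card[of e] by auto
  qed
  moreover have "gam 3 = gam (Suc 2)" "class_sum 3 (Suc 2) = class_sum 3 3" by simp_all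
  ultimately have "Lag (gam 3) (var :: nat \<Rightarrow> (nat, complex) mpoly) = G33 +
      (var 2 * var 4 * var 6 + var 4 * var 6 * var 8) + (var 1 * var 3 * var 5 + var 3 * var 5 * var 7)"
    by (simp only: Lag_gam_Suc[of 2] Lag_gam_2 G33_eq) simp
  moreover have "{2..3::nat} = {2, 3}" by auto
  then have "Gamma_poly 3 = G23 + G33" by (simp add: Gamma_poly_def Gpoly.simps)
  moreover have "{1..4::nat} = {1, 2, 3, 4}" by auto
  then have "G23 = var 1 * var 3 * var 5 + var 2 * var 4 * var 6 + var 3 * var 5 * var 7 + var 4 * var 6 * var 8"
    by (simp add: G23_def add.assoc numeral_eq_Suc)
  ultimately show ?case by (simp add: ac_simps)
next
  case (Suc n)
  have "{2..Suc n} = insert (Suc n) {2..n}" using Suc.hyps by auto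
  then have "Gamma_poly (Suc n) = Gpoly (Suc n) (Suc n) + (\<Sum>k=2..n. Gpoly k (Suc n))"
    by (simp add: Gamma_poly_def)
  also have "Gpoly (Suc n) (Suc n) = E_hom 3 (Suc n) G33"
    using Suc.hyps by (simp add: Gpoly.simps)
  also have "(\<Sum>k=2..n. Gpoly k (Suc n)) = (\<Sum>k=2..n. p0_hom (Gpoly k n) + p1_hom (Gpoly k n))"
    using Suc.hyps by (intro sum.cong refl) (subst Gpoly.simps, auto)
  also have "\<dots> = p0_hom (Gamma_poly n) + p1_hom (Gamma_poly n)"
    by (simp add: sum.distrib Gamma_poly_def p0_hom_def p1_hom_def poly_subst_sum)
  finally show ?case
    using Suc by (simp add: E_hom_G33 p_hom_Lag Lag_gam_Suc add.assoc)
qed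

text \<open>\<open>T\<close> is a graph on the four classes modulo 4, and the hub 0 is joined to its
  blow-up. \<open>TX\<close> and \<open>TY\<close> below are the two perfect matchings of the cycle
  1, 2, 3, 4.\<close>

definition hubgraph :: "nat \<Rightarrow> nat set set \<Rightarrow> nat hypergraph" where
  "hubgraph n T = ({0..2 ^ n}, gam n \<union> insert 0 ` blow 2 n T)"

abbreviation "TX \<equiv> {{1,2}, {3,4}} :: nat set set"
abbreviation "TY \<equiv> {{1,4}, {2,3}} :: nat set set"

lemma hubgraph_props:
  assumes n: "2 \<le> n" and T: "\<And>e. e \<in> T \<Longrightarrow> card e = 2"
  shows "edges (hubgraph n T) \<subseteq> Pow (vertices (hubgraph n T))"
    and "\<And>e. e \<in> edges (hubgraph n T) \<Longrightarrow> card e = 3"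
proof -
  have "e \<subseteq> {0..2 ^ n} \<and> card e = 3" if e: "e \<in> edges (hubgraph n T)" for e
  proof (cases "e \<in> gam n")
    case True
    then show ?thesis using gam_props[OF n] by force
  next
    case False
    then obtain f where f: "e = insert 0 f" "f \<in> blow 2 n T" using e by (auto simp: hubgraph_def)
    then have "f \<subseteq> {1..2 ^ n}" "card f = 2" "finite f" using blow_props[OF T] by auto
    moreover from this have "0 \<notin> f" by auto
    ultimately show ?thesis using f(1) by auto
  qed
  then show "edges (hubgraph n T) \<subseteq> Pow (vertices (hubgraph n T))"
    and "\<And>e. e \<in> edges (hubgraph n T) \<Longrightarrow> card e = 3"
    by (auto simp: hubgraph_def)
qed

lemma Lag_hubgraph:
  assumes n: "2 \<le> n" and T: "\<And>e. e \<in> T \<Longrightarrow> card e = 2" "finite T"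
  shows "Lag (edges (hubgraph n T)) w = Lag (gam n) w + w 0 * Lag T (class_sum 2 n w)"
proof -
  have b: "f \<subseteq> {1..2 ^ n} \<and> finite f" if "f \<in> blow 2 n T" for f
    using blow_props[OF T(1) that] by blast
  have 0: "0 \<notin> f" if "f \<in> blow 2 n T" for f using b[OF that] by auto
  have g0: "0 \<notin> f" if "f \<in> gam n" for f using gam_props[OF n that] by auto
  have fb: "finite (blow 2 n T)" by (rule finite_subset[of _ "Pow {1..2 ^ n}"]) (use b in auto)
  have "Lag (edges (hubgraph n T)) w = Lag (gam n) w + Lag (insert 0 ` blow 2 n T) w"
    unfolding hubgraph_def snd_conv
    by (rule Lag_Un_disjoint) (use finite_gam[OF n] fb g0 in auto)
  also have "Lag (insert 0 ` blow 2 n T) w = w 0 * Lag (blow 2 n T) w"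
    by (rule Lag_insert) (use b 0 in blast)
  also have "Lag (blow 2 n T) w = Lag T (class_sum 2 n w)"
    by (rule Lag_blow[OF T(2)]) (use T(1) in \<open>auto intro: card_ge_0_finite\<close>)
  finally show ?thesis .
qed

lemma Lag_pairs:
  "Lag TX w = w 1 * w 2 + w 3 * w 4" "Lag TY w = w 1 * w 4 + w 2 * w 3"
  using Lag_set[of "[{1,2}, {3,4}]" w] Lag_set[of "[{1,4}, {2,3}]" w] by simp_all

lemma lagrangian_hubgraph:
  assumes n: "3 \<le> n"
  shows "lagrangian (hubgraph n TX) = X_poly n" "lagrangian (hubgraph n TY) = Y_poly n"
proof -
  have L: "lagrangian H = Lag (edges H) var" for H :: "nat hypergraph" by (simp add: lagrangian_def Lag_def)
  have M: "M0_poly n = var 0 * Lag TX (class_sum 2 n var)" "M1_poly n = var 0 * Lag TY (class_sum 2 n var)"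
  proof -
    have "E_hom 2 n (Lag TX var) = Lag TX (class_sum 2 n var)"
      "E_hom 2 n (Lag TY var) = Lag TY (class_sum 2 n var)"
      by (rule E_hom_Lag; auto)+
    then show "M0_poly n = var 0 * Lag TX (class_sum 2 n var)"
      "M1_poly n = var 0 * Lag TY (class_sum 2 n var)"
      unfolding M0_poly_def M1_poly_def Lag_pairs by simp_all
  qed
  have "Lag (edges (hubgraph n T)) (var :: nat \<Rightarrow> (nat, complex) mpoly) =
      Lag (gam n) var + var 0 * Lag T (class_sum 2 n var)" if "T = TX \<or> T = TY" for T
    by (rule Lag_hubgraph) (use n that in auto)
  from this[of TX] this[of TY]
  show "lagrangian (hubgraph n TX) = X_poly n" "lagrangian (hubgraph n TY) = Y_poly n"
    using n by (simp_all only: simp_thms L X_poly_def Y_poly_def Gamma_poly_eq M)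
qed

section \<open>The hypergraphs are hypomorphic\<close>

lemma cls_eqI:
  assumes "1 \<le> i" "1 \<le> j" "i mod 2 ^ r = j mod 2 ^ r"
  shows "cls r i = cls r j"
  using cls_eq_iff[OF assms(1), of "cls r j" r] cls_mod[OF assms(2), of r] cls_in[of r j] assms(3) by simp

text \<open>A vertex map acting on classes by an injective \<open>h\<close> keeps transversals
  transversal, which reduces the question to a finite check on \<open>h\<close> and the edges of
  \<open>T\<close>.\<close>

lemma blow_image:
  assumes f: "f \<in> blow r n T" and cl: "\<And>i. i \<in> {1..2 ^ n} \<Longrightarrow> cls r (\<tau> i) = h (cls r i)"
    and \<tau>: "\<tau> ` {1..2 ^ n} \<subseteq> {1..2 ^ n}"
    and h: "inj_on h {1..2 ^ r}" "\<And>e. e \<in> T \<Longrightarrow> h ` e \<in> T'"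
  shows "\<tau> ` f \<in> blow r n T'"
proof -
  have f': "f \<subseteq> {1..2 ^ n}" "inj_on (cls r) f" "cls r ` f \<in> T" using f by (auto simp: blow_def)
  have cf: "cls r (\<tau> i) = h (cls r i)" if "i \<in> f" for i using cl f'(1) that by blast
  have "cls r ` \<tau> ` f = h ` cls r ` f" using cf by (auto simp: image_image)
  moreover have "inj_on (cls r) (\<tau> ` f)"
  proof (rule inj_onI)
    fix a b assume "a \<in> \<tau> ` f" "b \<in> \<tau> ` f" and eq: "cls r a = cls r b"
    then obtain i k where ik: "i \<in> f" "k \<in> f" "a = \<tau> i" "b = \<tau> k" by blast
    then have "h (cls r i) = h (cls r k)" using eq cf by simp
    then have "cls r i = cls r k" using h(1) cls_in by (auto dest: inj_onD)
    then show "a = b" using f'(2) ik by (auto dest: inj_onD)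
  qed
  ultimately show ?thesis using f' \<tau> h(2) by (auto simp: blow_def)
qed

section \<open>Affine symmetries of \<open>T33\<close> modulo 8\<close>

lemma cls_3: "1 \<le> j \<Longrightarrow> cls 3 j = (if j mod 8 = 0 then 8 else j mod 8)"
  using cls_mod[of j 3] cls_in[of 3 j] by (auto split: if_splits) presburger+

text \<open>The numbers are the binary codes of the sixteen edges in the order of
  \<open>T33\<close>; for instance 262 = 2^8 + 2^1 + 2^2. Membership of an image becomes
  arithmetic.\<close>

lemma T33_iff:
  assumes "finite e"
  shows "e \<in> T33 \<longleftrightarrow> set_encode e \<in> {262, 14, 28, 56, 112, 224, 448, 386, 82, 164, 328, 146, 292, 74, 148, 296}"
proof -
  have "e \<in> T33 \<longleftrightarrow> set_encode e \<in> set_encode ` T33"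
    using T33_card set_encode_eq[OF assms] by (metis card.infinite image_iff zero_neq_numeral)
  also have "set_encode ` T33 = {262, 14, 28, 56, 112, 224, 448, 386, 82, 164, 328, 146, 292, 74, 148, 296}"
    by (simp add: T33_def set_encode_def)
  finally show ?thesis .
qed

text \<open>The rows tabulate 7c + 2, 3c + 2, 7c, 3c + 4 and 7c + 1 modulo 8 for c = 1, ...,
  8.\<close>

lemma T33_automorphism:
  assumes "(h 1, h 2, h 3, h 4, h 5, h 6, h 7, h 8) \<in>
    {(1,8,7,6,5,4,3,2),
     (5,8,3,6,1,4,7,2),
     (7,6,5,4,3,2,1,8),
     (7,2,5,8,3,6,1,4),
     (8,7,6,5,4,3,2,1)}"
  shows "inj_on h {1..2 ^ 3}"
    and "e \<in> T33 \<Longrightarrow> h ` e \<in> T33"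
proof -
  have "{1..2 ^ 3 :: nat} = {1,2,3,4,5,6,7,8}" by auto
  with assms show "inj_on h {1..2 ^ 3}"
    by (elim insertE emptyE; simp)
  have "\<forall>e\<in>T33. set_encode (h ` e) \<in>
      {262, 14, 28, 56, 112, 224, 448, 386, 82, 164, 328, 146, 292, 74, 148, 296}"
    using assms unfolding T33_def set_encode_def
    by (elim insertE emptyE; simp)
  moreover have "finite e" if "e \<in> T33" for e using T33_card[OF that] by (auto intro: finite_subset)
  ultimately show "e \<in> T33 \<Longrightarrow> h ` e \<in> T33" using T33_iff[OF finite_imageI] by blast
qed

text \<open>Modulo 8 the permutations below act as \<open>c \<mapsto> 2 - c\<close>, \<open>3c + 2\<close>, \<open>-c\<close>, \<open>3c + 4\<close> and, for the
  reversal, \<open>1 - c\<close>.\<close>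

lemma T33_affine:
  assumes "(a, b) \<in> {(7, 2), (3, 2), (7, 0), (3, 4), (7, 1)}"
  shows "inj_on (\<lambda>c. cls 3 (a * c + b)) {1..2 ^ 3}"
    and "e \<in> T33 \<Longrightarrow> (\<lambda>c. cls 3 (a * c + b)) ` e \<in> T33"
proof -
  have "(cls 3 (a * 1 + b), cls 3 (a * 2 + b), cls 3 (a * 3 + b), cls 3 (a * 4 + b), cls 3 (a * 5 + b),
      cls 3 (a * 6 + b), cls 3 (a * 7 + b), cls 3 (a * 8 + b)) \<in>
    {(1,8,7,6,5,4,3,2),
     (5,8,3,6,1,4,7,2),
     (7,6,5,4,3,2,1,8),
     (7,2,5,8,3,6,1,4),
     (8,7,6,5,4,3,2,1)}"
    using assms by (elim insertE emptyE; simp add: cls_3)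
  note T33_automorphism[of "\<lambda>c. cls 3 (a * c + b)", OF this]
  then show "inj_on (\<lambda>c. cls 3 (a * c + b)) {1..2 ^ 3}"
    and "e \<in> T33 \<Longrightarrow> (\<lambda>c. cls 3 (a * c + b)) ` e \<in> T33" .
qed

text \<open>Permutations are tracked through the residue of \<tau> j + j, which describes a
  reflection j -> const - j without negative numbers. Here the extra summand is cancelled and the
  index replaced by a congruent one.\<close>

lemma mod_affine:
  fixes k i c q a b m :: nat
  assumes "(k + i) mod m = (a * i + b + i) mod m" and "c mod m = i mod m"
  shows "k mod m = (a * c + b) mod m"
proof -
  have "k mod m = (a * i + b) mod m"
    using assms(1) by (auto simp: nat_mod_eq_iff add.assoc)
  also have "\<dots> = (a * c + b) mod m"
    by (metis assms(2) mod_add_left_eq mod_mult_right_eq)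
  finally show ?thesis .
qed

lemma cls_affine:
  assumes "(k + i) mod 8 = (a * i + b + i) mod 8" "1 \<le> i" "1 \<le> k" "1 \<le> a"
  shows "cls 3 k = cls 3 (a * cls 3 i + b)"
proof (rule cls_eqI)
  show "k mod 2 ^ 3 = (a * cls 3 i + b) mod 2 ^ 3"
    using mod_affine[OF assms(1), of "cls 3 i"] cls_mod[OF assms(2), of 3] by simp
  show "1 \<le> a * cls 3 i + b" using assms(4) cls_in[of 3 i] by (simp add: Suc_le_eq)
qed (use assms in simp)

lemma blow_affine:
  assumes f: "f \<in> blow 3 n T33" and ab: "(a, b) \<in> {(7, 2), (3, 2), (7, 0), (3, 4), (7, 1)}"
    and \<tau>: "\<tau> ` {1..2 ^ n} \<subseteq> {1..2 ^ n}"
    and res: "\<And>j. j \<in> {1..2 ^ n} \<Longrightarrow> (\<tau> j + j) mod 8 = (a * j + b + j) mod 8"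
  shows "\<tau> ` f \<in> blow 3 n T33"
proof (rule blow_image[OF f _ \<tau>, where h = "\<lambda>c. cls 3 (a * c + b)"])
  fix j :: nat assume j: "j \<in> {1..2 ^ n}"
  then have "\<tau> j \<in> {1..2 ^ n}" using \<tau> by blast
  then have "1 \<le> \<tau> j" "1 \<le> j" using j by auto
  then show "cls 3 (\<tau> j) = cls 3 (a * cls 3 j + b)"
    by (intro cls_affine res j) (use ab in auto)
next
  show "inj_on (\<lambda>c. cls 3 (a * c + b)) {1..2 ^ 3}" by (rule T33_affine[OF ab])
  show "\<And>e. e \<in> T33 \<Longrightarrow> (\<lambda>c. cls 3 (a * c + b)) ` e \<in> T33" by (rule T33_affine[OF ab])
qed

text \<open>The reversal changes parity, so it exchanges the two doubled copies and acts between
  them as the reversal of the previous level: 2^(n+1) + 1 - 2i = 2 (2^n + 1 - i) - 1. Blown-up edges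
  are handled by the symmetry 1 - c of \<open>T33\<close>.\<close>

lemma gam_reversal: "2 \<le> n \<Longrightarrow> e \<in> gam n \<Longrightarrow> (\<lambda>j. 2 ^ n + 1 - j) ` e \<in> gam n"
proof (induction n arbitrary: e rule: nat_induct_at_least)
  case base
  then show ?case by (auto simp: gam_2 insert_commute)
next
  case (Suc n)
  let ?\<rho> = "\<lambda>n j. 2 ^ n + 1 - j :: nat"
  from Suc.prems consider "e \<in> blow 3 (Suc n) T33" | f where "f \<in> gam n" "e = (\<lambda>i. 2 * i) ` f"
    | f where "f \<in> gam n" "e = (\<lambda>i. 2 * i - 1) ` f"
    unfolding gam_Suc[OF Suc.hyps(1)] by blast
  then show ?case
  proof cases
    case 1
    have "(?\<rho> (Suc n)) ` e \<in> blow 3 (Suc n) T33"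
    proof (rule blow_affine[OF 1, of 7 1])
      fix i :: nat assume i: "i \<in> {1..2 ^ Suc n}"
      have "8 dvd (2 :: nat) ^ Suc n" using Suc.hyps(1) le_imp_power_dvd[of 3 "Suc n" "2::nat"] by simp
      then obtain q :: nat where q: "2 ^ Suc n = 8 * q" by blast
      have "?\<rho> (Suc n) i + i = 8 * q + 1" using i unfolding q by simp
      moreover have "7 * i + 1 + i = 8 * i + 1" by simp
      ultimately show "(?\<rho> (Suc n) i + i) mod 8 = (7 * i + 1 + i) mod 8" by (simp only: mod_mult_self4)
    qed auto
    then show ?thesis by (simp add: gam_Suc[OF Suc.hyps(1)])
  next
    case (2 f)
    have f: "f \<subseteq> {1..2 ^ n}" using gam_props[OF Suc.hyps(1) 2(1)] by blast
    have "(?\<rho> (Suc n)) ` e = (\<lambda>i. 2 * i - 1) ` (?\<rho> n) ` f"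
      unfolding 2(2) image_image by (intro image_cong refl) (use f in auto)
    then show ?thesis using Suc.IH[OF 2(1)] by (auto simp: gam_Suc[OF Suc.hyps(1)])
  next
    case (3 f)
    have f: "f \<subseteq> {1..2 ^ n}" using gam_props[OF Suc.hyps(1) 3(1)] by blast
    have "(?\<rho> (Suc n)) ` e = (\<lambda>i. 2 * i) ` (?\<rho> n) ` f"
      unfolding 3(2) image_image
    proof (intro image_cong refl)
      fix i assume "i \<in> f"
      then have "1 \<le> i" "i \<le> 2 ^ n" using f by auto
      then show "?\<rho> (Suc n) (2 * i - 1) = 2 * ?\<rho> n i" by simp
    qed
    then show ?thesis using Suc.IH[OF 3(1)] by (auto simp: gam_Suc[OF Suc.hyps(1)])
  qed
qed

section \<open>Gluing permutations of the odd and even halves\<close>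

definition interleave :: "(nat \<Rightarrow> nat) \<Rightarrow> (nat \<Rightarrow> nat) \<Rightarrow> nat \<Rightarrow> nat" where
  "interleave A B j = (if odd j then 2 * A ((j + 1) div 2) - 1 else 2 * B (j div 2))"

lemma interleave_simps:
  "1 \<le> k \<Longrightarrow> interleave A B (2 * k - 1) = 2 * A k - 1" "interleave A B (2 * k) = 2 * B k"
  by (auto simp: interleave_def)

lemma half_cases:
  fixes j n :: nat
  assumes "j \<in> {1..2 ^ Suc n}"
  obtains k where "k \<in> {1..2 ^ n}" "j = 2 * k - 1" | k where "k \<in> {1..2 ^ n}" "j = 2 * k"
proof (cases "odd j")
  case True
  then obtain m where "j = 2 * m + 1" by (elim oddE)
  then show ?thesis using assms that(1)[of "Suc m"] by auto
next
  case False
  then have "even j" by simp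
  then obtain m where "j = 2 * m" by (elim evenE)
  then show ?thesis using assms that(2)[of m] by auto
qed

text \<open>For j = 2k - 1 the image plus j is 2 (A k + k) - 2, and for j = 2k it is 2 (B k + k). So
  residues modulo 4 double to residues modulo 8, and 6 stands for -2.\<close>

lemma interleave:
  fixes A B :: "nat \<Rightarrow> nat"
  assumes A: "A ` {1..2 ^ n} \<subseteq> {1..2 ^ n}" "inj_on A {1..2 ^ n}"
    and B: "B ` {1..2 ^ n} \<subseteq> {1..2 ^ n}" "inj_on B {1..2 ^ n}"
    and resA: "\<And>k. k \<in> {1..2 ^ n} \<Longrightarrow> (A k + k) mod 4 = \<alpha>"
    and resB: "\<And>k. k \<in> {1..2 ^ n} \<Longrightarrow> (B k + k) mod 4 = \<beta>"
  shows "interleave A B ` {1..2 ^ Suc n} \<subseteq> {1..2 ^ Suc n}"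
    and "inj_on (interleave A B) {1..2 ^ Suc n}"
    and "\<And>j. j \<in> {1..2 ^ Suc n} \<Longrightarrow>
      (interleave A B j + j) mod 8 = (if odd j then 2 * \<alpha> + 6 else 2 * \<beta>) mod 8"
proof -
  let ?\<tau> = "interleave A B"
  have inA: "A k \<in> {1..2 ^ n}" and inB: "B k \<in> {1..2 ^ n}" if "k \<in> {1..2 ^ n}" for k
    using A(1) B(1) that by blast+
  have \<tau>_odd: "?\<tau> (2 * k - 1) = 2 * A k - 1" "odd (?\<tau> (2 * k - 1))" if "k \<in> {1..2 ^ n}" for k
    using inA[OF that] that interleave_simps(1)[of k A B] by auto
  have \<tau>_even: "?\<tau> (2 * k) = 2 * B k" "even (?\<tau> (2 * k))" for k
    by (simp_all add: interleave_simps)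
  show "?\<tau> ` {1..2 ^ Suc n} \<subseteq> {1..2 ^ Suc n}"
  proof (rule image_subsetI)
    fix j :: nat assume "j \<in> {1..2 ^ Suc n}"
    then show "?\<tau> j \<in> {1..2 ^ Suc n}"
    proof (cases rule: half_cases)
      case (1 k)
      then show ?thesis using inA[of k] \<tau>_odd[of k] by auto
    next
      case (2 k)
      then show ?thesis using inB[of k] \<tau>_even[of k] by auto
    qed
  qed
  show "inj_on ?\<tau> {1..2 ^ Suc n}"
  proof (rule inj_onI)
    fix j j' :: nat assume j: "j \<in> {1..2 ^ Suc n}" and j': "j' \<in> {1..2 ^ Suc n}" and eq: "?\<tau> j = ?\<tau> j'"
    from j show "j = j'"
    proof (cases rule: half_cases)
      case (1 k)
      from j' show ?thesis
      proof (cases rule: half_cases)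
        case (1 k')
        with \<open>k \<in> _\<close> \<open>j = _\<close> eq have "A k = A k'"
          using \<tau>_odd(1)[of k] \<tau>_odd(1)[of k'] inA[of k] inA[of k'] by simp
        then have "k = k'" using A(2) \<open>k \<in> _\<close> 1 by (auto dest: inj_onD)
        with 1 \<open>j = _\<close> show ?thesis by simp
      next
        case (2 k')
        with \<open>k \<in> _\<close> \<open>j = _\<close> eq show ?thesis using \<tau>_odd(2)[of k] \<tau>_even(2)[of k'] by simp
      qed
    next
      case (2 k)
      from j' show ?thesis
      proof (cases rule: half_cases)
        case (1 k')
        with \<open>k \<in> _\<close> \<open>j = _\<close> eq show ?thesis using \<tau>_odd(2)[of k'] \<tau>_even(2)[of k] by simp
      next
        case (2 k')
        with \<open>j = _\<close> eq have "B k = B k'" by (simp add: \<tau>_even(1))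
        then have "k = k'" using B(2) \<open>k \<in> _\<close> 2 by (auto dest: inj_onD)
        with 2 \<open>j = _\<close> show ?thesis by simp
      qed
    qed
  qed
  fix j :: nat assume "j \<in> {1..2 ^ Suc n}"
  then show "(?\<tau> j + j) mod 8 = (if odd j then 2 * \<alpha> + 6 else 2 * \<beta>) mod 8"
  proof (cases rule: half_cases)
    case (1 k)
    have "odd j" using 1 by auto
    moreover have "(2 * (A k + k) + 6) mod 8 = (2 * \<alpha> + 6) mod 8"
      using mult_mod_right[of 2 "A k + k" 4] resA[OF 1(1)] by (simp add: mod_add_left_eq)
    moreover have "2 * (A k + k) + 6 = ?\<tau> j + j + 8"
      using 1 \<tau>_odd(1)[of k] inA[of k] by auto
    ultimately show ?thesis by simp
  next
    case (2 k)
    have "(2 * (B k + k)) mod 8 = (2 * \<beta>) mod 8"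
      using mult_mod_right[of 2 "B k + k" 4] resB[OF 2(1)] by simp
    then show ?thesis using 2 \<tau>_even(1)[of k] by simp
  qed
qed

text \<open>The conditions on \<open>A\<close> and \<open>B\<close> mention \<open>e\<close>, so
  that the information that \<open>e\<close> avoids a vertex can descend to the half containing this
  vertex.\<close>

lemma gam_interleave:
  assumes n: "2 \<le> n" and e: "e \<in> gam (Suc n)"
    and blow: "\<And>f. f \<in> blow 3 (Suc n) T33 \<Longrightarrow> interleave A B ` f \<in> blow 3 (Suc n) T33"
    and A: "\<And>f. f \<in> gam n \<Longrightarrow> e = (\<lambda>i. 2 * i - 1) ` f \<Longrightarrow> A ` f \<in> gam n"
    and B: "\<And>f. f \<in> gam n \<Longrightarrow> e = (\<lambda>i. 2 * i) ` f \<Longrightarrow> B ` f \<in> gam n"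
  shows "interleave A B ` e \<in> gam (Suc n)"
proof -
  from e consider "e \<in> blow 3 (Suc n) T33" | f where "f \<in> gam n" "e = (\<lambda>i. 2 * i) ` f"
    | f where "f \<in> gam n" "e = (\<lambda>i. 2 * i - 1) ` f"
    unfolding gam_Suc[OF n] by blast
  then show ?thesis
  proof cases
    case 1
    then show ?thesis using blow by (simp add: gam_Suc[OF n])
  next
    case (2 f)
    have "interleave A B ` e = (\<lambda>i. 2 * i) ` B ` f"
      unfolding 2(2) image_image by (simp add: interleave_simps)
    then show ?thesis using B[OF 2] by (auto simp: gam_Suc[OF n])
  next
    case (3 f)
    have "interleave A B ` e = (\<lambda>i. 2 * i - 1) ` A ` f"
      unfolding 3(2) image_image
    proof (rule image_cong[OF refl])
      fix i assume "i \<in> f"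
      then have "1 \<le> i" using gam_props[OF n 3(1)] by auto
      then show "interleave A B (2 * i - 1) = 2 * A i - 1" by (rule interleave_simps)
    qed
    then show ?thesis using A[OF 3] by (auto simp: gam_Suc[OF n])
  qed
qed

text \<open>The vertices of the parity of \<open>v\<close> are permuted recursively, the others are
  reversed. The residues modulo 4 are what makes the permutation compatible with \<open>T33\<close> on the next
  level, and what exchanges \<open>TX\<close> and \<open>TY\<close>.\<close>

lemma gam_vertex_automorphism:
  "2 \<le> n \<Longrightarrow> v \<in> {1..2 ^ n} \<Longrightarrow> \<exists>\<tau>. \<tau> ` {1..2 ^ n} \<subseteq> {1..2 ^ n} \<and> inj_on \<tau> {1..2 ^ n} \<and> \<tau> v = v \<and>
     (\<forall>j\<in>{1..2 ^ n}. (\<tau> j + j) mod 4 = (if odd v then 2 else 0)) \<and>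
     (\<forall>e\<in>gam n. v \<notin> e \<longrightarrow> \<tau> ` e \<in> gam n)"
proof (induction n arbitrary: v rule: nat_induct_at_least)
  case base
  have V: "{1..2 ^ 2 :: nat} = {1,2,3,4}" by auto
  show ?case
  proof (cases "odd v")
    case True
    \<comment> \<open>At level 2 the only edge that can avoid an odd vertex is {2,3,4}, which the
      exchange of 2 and 4 preserves. Even vertices are treated symmetrically with 1 and 3.\<close>
    let ?\<tau> = "\<lambda>j::nat. if j = 2 then 4 else if j = 4 then 2 else j"
    have "v = 1 \<or> v = 3" using base True unfolding V by auto
    then show ?thesis unfolding V gam_2
      by (intro exI[of _ ?\<tau>]) (auto simp: inj_on_def)
  next
    case False
    let ?\<tau> = "\<lambda>j::nat. if j = 1 then 3 else if j = 3 then 1 else j"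
    have "v = 2 \<or> v = 4" using base False unfolding V by auto
    then show ?thesis unfolding V gam_2
      by (intro exI[of _ ?\<tau>]) (auto simp: inj_on_def)
  qed
next
  case (Suc n)
  define \<rho> :: "nat \<Rightarrow> nat" where "\<rho> j = 2 ^ n + 1 - j" for j
  have \<rho>: "\<rho> ` {1..2 ^ n} \<subseteq> {1..2 ^ n}" "inj_on \<rho> {1..2 ^ n}"
    by (auto simp: \<rho>_def inj_on_def)
  have "4 dvd (2 :: nat) ^ n" using Suc.hyps le_imp_power_dvd[of 2 n "2::nat"] by simp
  then have \<rho>_res: "(\<rho> k + k) mod 4 = 1" if "k \<in> {1..2 ^ n}" for k
    using that by (auto simp: \<rho>_def mod_Suc elim!: dvdE)
  have \<rho>_gam: "\<rho> ` f \<in> gam n" if "f \<in> gam n" for f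
    using gam_reversal[OF Suc.hyps that] by (simp add: \<rho>_def[abs_def])
  \<comment> \<open>\<alpha> and \<beta> belong to the odd and even halves: 1 for the reversal, 2 or
    0 for the recursive permutation around an odd or even vertex. They determine the map a c + b
    modulo 8: for (0, 1) the sums are 6 at odd j and 2 at even j, which is 4j + 2 = (3j + 2) +
    j.\<close>
  have step: "interleave A B ` {1..2 ^ Suc n} \<subseteq> {1..2 ^ Suc n} \<and> inj_on (interleave A B) {1..2 ^ Suc n} \<and>
      (\<forall>j\<in>{1..2 ^ Suc n}. (interleave A B j + j) mod 4 = b mod 4) \<and>
      (\<forall>f\<in>blow 3 (Suc n) T33. interleave A B ` f \<in> blow 3 (Suc n) T33)"
    if AB: "A ` {1..2 ^ n} \<subseteq> {1..2 ^ n}" "inj_on A {1..2 ^ n}" "B ` {1..2 ^ n} \<subseteq> {1..2 ^ n}" "inj_on B {1..2 ^ n}"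
      "\<And>k. k \<in> {1..2 ^ n} \<Longrightarrow> (A k + k) mod 4 = \<alpha>" "\<And>k. k \<in> {1..2 ^ n} \<Longrightarrow> (B k + k) mod 4 = \<beta>"
      and ab: "(\<alpha>, \<beta>, a, b) \<in> {(2, 1, 7, 2), (0, 1, 3, 2), (1, 2, 3, 4), (1, 0, 7, 0)}"
    for A B :: "nat \<Rightarrow> nat" and \<alpha> \<beta> a b :: nat
  proof -
    have I1: "interleave A B ` {1..2 ^ Suc n} \<subseteq> {1..2 ^ Suc n}" by (rule interleave(1)[OF AB])
    have I2: "inj_on (interleave A B) {1..2 ^ Suc n}" by (rule interleave(2)[OF AB])
    have I3: "(interleave A B j + j) mod 8 = (if odd j then 2 * \<alpha> + 6 else 2 * \<beta>) mod 8"
      if "j \<in> {1..2 ^ Suc n}" for j by (rule interleave(3)[OF AB that])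
    have res: "(interleave A B j + j) mod 8 = (a * j + b + j) mod 8" if "j \<in> {1..2 ^ Suc n}" for j
      unfolding I3[OF that] using ab by (elim insertE emptyE; simp; presburger)
    have "(interleave A B j + j) mod 4 = b mod 4" if "j \<in> {1..2 ^ Suc n}" for j
    proof -
      have "(interleave A B j + j) mod 4 = (interleave A B j + j) mod 8 mod 4" by (simp add: mod_mod_cancel)
      also have "\<dots> = b mod 4"
        unfolding I3[OF that] using ab by (elim insertE emptyE; simp)
      finally show ?thesis .
    qed
    moreover have "interleave A B ` f \<in> blow 3 (Suc n) T33" if "f \<in> blow 3 (Suc n) T33" for f
      by (rule blow_affine[OF that _ I1 res]) (use ab in auto)
    ultimately show ?thesis using I1 I2 by blast
  qed
  from Suc.prems show ?case
  proof (cases rule: half_cases)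
    case (1 i)
    obtain \<sigma> where \<sigma>: "\<sigma> ` {1..2 ^ n} \<subseteq> {1..2 ^ n}" "inj_on \<sigma> {1..2 ^ n}" "\<sigma> i = i"
      "\<And>j. j \<in> {1..2 ^ n} \<Longrightarrow> (\<sigma> j + j) mod 4 = (if odd i then 2 else 0)"
      "\<And>e. e \<in> gam n \<Longrightarrow> i \<notin> e \<Longrightarrow> \<sigma> ` e \<in> gam n"
      using Suc.IH[OF 1(1)] by auto
    note S = step[OF \<sigma>(1,2) \<rho> \<sigma>(4) \<rho>_res, of "if odd i then 7 else 3" 2]
    have "interleave \<sigma> \<rho> ` e \<in> gam (Suc n)" if "e \<in> gam (Suc n)" "v \<notin> e" for e
    proof (rule gam_interleave[OF Suc.hyps that(1)])
      show "\<And>f. f \<in> blow 3 (Suc n) T33 \<Longrightarrow> interleave \<sigma> \<rho> ` f \<in> blow 3 (Suc n) T33" using S by auto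
      fix f assume f: "f \<in> gam n" "e = (\<lambda>i. 2 * i - 1) ` f"
      have "i \<notin> f" using that(2) unfolding f(2) 1(2) by blast
      then show "\<sigma> ` f \<in> gam n" using \<sigma>(5) f(1) by blast
    qed (rule \<rho>_gam)
    moreover have "interleave \<sigma> \<rho> v = v" "odd v" using 1 \<sigma>(3) interleave_simps(1)[of i \<sigma> \<rho>] by auto
    ultimately show ?thesis using S by (intro exI[of _ "interleave \<sigma> \<rho>"]) auto
  next
    case (2 i)
    obtain \<sigma> where \<sigma>: "\<sigma> ` {1..2 ^ n} \<subseteq> {1..2 ^ n}" "inj_on \<sigma> {1..2 ^ n}" "\<sigma> i = i"
      "\<And>j. j \<in> {1..2 ^ n} \<Longrightarrow> (\<sigma> j + j) mod 4 = (if odd i then 2 else 0)"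
      "\<And>e. e \<in> gam n \<Longrightarrow> i \<notin> e \<Longrightarrow> \<sigma> ` e \<in> gam n"
      using Suc.IH[OF 2(1)] by auto
    note S = step[OF \<rho> \<sigma>(1,2) \<rho>_res \<sigma>(4), of "if odd i then 3 else 7" "if odd i then 4 else 0"]
    have "interleave \<rho> \<sigma> ` e \<in> gam (Suc n)" if "e \<in> gam (Suc n)" "v \<notin> e" for e
    proof (rule gam_interleave[OF Suc.hyps that(1)])
      show "\<And>f. f \<in> blow 3 (Suc n) T33 \<Longrightarrow> interleave \<rho> \<sigma> ` f \<in> blow 3 (Suc n) T33" using S by auto
      fix f assume f: "f \<in> gam n" "e = (\<lambda>i. 2 * i) ` f"
      have "i \<notin> f" using that(2) unfolding f(2) 2(2) by blast
      then show "\<sigma> ` f \<in> gam n" using \<sigma>(5) f(1) by blast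
    qed (rule \<rho>_gam)
    moreover have "interleave \<rho> \<sigma> v = v" "even v" using 2 \<sigma>(3) by (auto simp: interleave_simps)
    ultimately show ?thesis using S by (intro exI[of _ "interleave \<rho> \<sigma>"]) auto
  qed
qed

lemma image_edges_eq:
  assumes "finite E" and V: "\<And>e. e \<in> E \<union> E' \<Longrightarrow> e \<subseteq> V" and f: "inj_on f V"
    and sub: "(`) f ` E \<subseteq> E'" and card: "card E' \<le> card E" "finite E'"
  shows "(`) f ` E = E'"
proof (rule card_seteq[OF card(2) sub])
  have "inj_on ((`) f) E"
    using V by (intro inj_on_image inj_on_subset[OF f]) blast
  then show "card E' \<le> card ((`) f ` E)" using card(1) by (simp add: card_image)
qed

lemma cls_2: "1 \<le> j \<Longrightarrow> cls 2 j = (if j mod 4 = 0 then 4 else j mod 4)"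
  using cls_mod[of j 2] cls_in[of 2 j] by (auto split: if_splits) presburger+

text \<open>Modulo 4 these are c -> -c and c -> 2 - c. Each reflects the 4-cycle of classes through
  two opposite vertices and therefore exchanges its two perfect matchings.\<close>

lemma pair_reflection:
  assumes "b \<in> {4, 6}"
  shows "inj_on (\<lambda>c. cls 2 (3 * c + b)) {1..2 ^ 2}"
    and "T \<in> {(TX, TY), (TY, TX)} \<Longrightarrow> e \<in> fst T \<Longrightarrow> (\<lambda>c. cls 2 (3 * c + b)) ` e \<in> snd T"
proof -
  have "{1..2 ^ 2 :: nat} = {1,2,3,4}" by auto
  with assms show "inj_on (\<lambda>c. cls 2 (3 * c + b)) {1..2 ^ 2}"
    by (elim insertE emptyE; simp add: cls_2)
  show "T \<in> {(TX, TY), (TY, TX)} \<Longrightarrow> e \<in> fst T \<Longrightarrow> (\<lambda>c. cls 2 (3 * c + b)) ` e \<in> snd T"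
  proof -
    assume T: "T \<in> {(TX, TY), (TY, TX)}" "e \<in> fst T"
    have "(\<lambda>c. cls 2 (3 * c + b)) ` e \<in> TY" if "e \<in> TX"
      using assms that by (elim insertE emptyE; simp add: cls_2 insert_commute)
    moreover have "(\<lambda>c. cls 2 (3 * c + b)) ` e \<in> TX" if "e \<in> TY"
      using assms that by (elim insertE emptyE; simp add: cls_2 insert_commute)
    ultimately show "(\<lambda>c. cls 2 (3 * c + b)) ` e \<in> snd T" using T by auto
  qed
qed

lemma uniform_hubgraph:
  assumes n: "2 \<le> n" and T: "\<And>e. e \<in> T \<Longrightarrow> card e = 2"
  shows "uniform_hypergraph 3 (hubgraph n T)"
proof -
  have "card e = 3" if "e \<in> edges (hubgraph n T)" for e
    by (rule hubgraph_props(2)[OF n T that])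
  moreover have "edges (hubgraph n T) \<subseteq> Pow (vertices (hubgraph n T))"
    by (rule hubgraph_props(1)[OF n T])
  moreover have "finite (vertices (hubgraph n T))" by (simp add: hubgraph_def)
  ultimately show ?thesis unfolding uniform_hypergraph_def by blast
qed

text \<open>The required bijection \<eta> is the identity. Deleting 0 leaves the same edges of
  \<Gamma>_n in both; for any other \<open>v\<close> the permutation of
  \<open>gam_vertex_automorphism\<close>, extended by fixing 0, exchanges the matchings.\<close>

lemma hypomorphic_hubgraph:
  assumes n: "3 \<le> n"
  shows "hypomorphic (hubgraph n TX) (hubgraph n TY)"
proof -
  let ?X = "hubgraph n TX" and ?Y = "hubgraph n TY" and ?V = "{1..2 ^ n} :: nat set"
  have n2: "2 \<le> n" using n by simp
  have ver: "vertices ?X = {0..2 ^ n}" "vertices ?Y = {0..2 ^ n}" by (simp_all add: hubgraph_def)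
  have blow2: "f \<subseteq> ?V" if "f \<in> blow 2 n T" for f T using that by (auto simp: blow_def)
  have gamV: "e \<subseteq> ?V" if "e \<in> gam n" for e using gam_props[OF n2 that] by blast
  have "hypergraph_iso (delete_vertex ?X v) (delete_vertex ?Y v)" if v: "v \<in> vertices ?X" for v
  proof (cases "v = 0")
    case True
    have "delete_vertex ?X 0 = delete_vertex ?Y 0" by (auto simp: delete_vertex_def hubgraph_def)
    then show ?thesis
      unfolding hypergraph_iso_def True by (intro exI[of _ id]) (simp add: bij_betw_id)
  next
    case False
    then have vV: "v \<in> ?V" using v ver by auto
    obtain \<tau> where \<tau>: "\<tau> ` ?V \<subseteq> ?V" "inj_on \<tau> ?V" "\<tau> v = v"
      "\<And>j. j \<in> ?V \<Longrightarrow> (\<tau> j + j) mod 4 = (if odd v then 2 else 0)"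
      "\<And>e. e \<in> gam n \<Longrightarrow> v \<notin> e \<Longrightarrow> \<tau> ` e \<in> gam n"
      using gam_vertex_automorphism[OF n2 vV] by auto
    define b :: nat where "b = (if odd v then 6 else 4)"
    have cl: "cls 2 (\<tau> j) = cls 2 (3 * cls 2 j + b)" if j: "j \<in> ?V" for j
    proof (rule cls_eqI)
      have "\<tau> j \<in> ?V" using \<tau>(1) j by blast
      then show "1 \<le> \<tau> j" by simp
      show "1 \<le> 3 * cls 2 j + b" by (simp add: b_def)
      have "3 * j + b + j = 4 * j + b" by simp
      then have "(3 * j + b + j) mod 4 = b mod 4" by simp
      then have "(\<tau> j + j) mod 4 = (3 * j + b + j) mod 4" using \<tau>(4)[OF j] by (simp add: b_def)
      then show "\<tau> j mod 2 ^ 2 = (3 * cls 2 j + b) mod 2 ^ 2"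
        using mod_affine[of "\<tau> j" j 4 3 b "cls 2 j"] cls_mod[of j 2] j by simp
    qed
    have b: "b \<in> {4, 6}" by (simp add: b_def)
    have \<tau>blow: "\<tau> ` f \<in> blow 2 n (snd T)" if "f \<in> blow 2 n (fst T)" "T \<in> {(TX, TY), (TY, TX)}" for f T
      by (rule blow_image[OF that(1) cl \<tau>(1) pair_reflection(1)[OF b] pair_reflection(2)[OF b that(2)]])
    define f where "f j = (if j = 0 then 0 else \<tau> j)" for j
    have f_img: "f ` e = \<tau> ` e" if "e \<subseteq> ?V" for e
      using that by (intro image_cong) (auto simp: f_def)
    have f0: "f ` insert 0 e = insert 0 (\<tau> ` e)" if "e \<subseteq> ?V" for e
      unfolding image_insert f_img[OF that] by (simp add: f_def)
    have V0: "{0..2 ^ n} = insert 0 ?V" by auto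
    have fV: "f ` {0..2 ^ n} \<subseteq> {0..2 ^ n}"
      unfolding V0 f0[OF order_refl] using \<tau>(1) by blast
    have "0 \<notin> \<tau> ` ?V" using \<tau>(1) by force
    then have f_inj: "inj_on f {0..2 ^ n}"
      unfolding V0 using \<tau>(2) f_img[OF order_refl] by (auto simp: f_def inj_on_def image_iff)
    have fv: "f v = v" using False \<tau>(3) by (simp add: f_def)
    define D where "D T = {e \<in> edges (hubgraph n T). v \<notin> e}" for T
    have D: "e \<in> D T \<longleftrightarrow> v \<notin> e \<and> (e \<in> gam n \<or> (\<exists>g\<in>blow 2 n T. e = insert 0 g))" for e T
      by (auto simp: D_def hubgraph_def)
    have DV: "e \<subseteq> {0..2 ^ n}" if "e \<in> D T" for e T
      using that gamV blow2 unfolding D V0 by blast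
    have finD: "finite (D T)" for T
      by (rule finite_subset[of _ "Pow {0..2 ^ n}"]) (use DV in auto)
    have sub: "(`) f ` D (fst T) \<subseteq> D (snd T)" if T: "T \<in> {(TX, TY), (TY, TX)}" for T
    proof (rule image_subsetI)
      fix e assume e: "e \<in> D (fst T)"
      have "v \<notin> f ` e"
      proof
        assume "v \<in> f ` e"
        then obtain j where j: "j \<in> e" "f j = f v" using fv by auto
        have "j = v" using inj_onD[OF f_inj j(2)] DV[OF e] j(1) vV by auto
        then show False using e j(1) D by blast
      qed
      moreover from e consider "e \<in> gam n" "v \<notin> e" | g where "g \<in> blow 2 n (fst T)" "e = insert 0 g"
        unfolding D by blast
      then have "f ` e \<in> gam n \<or> (\<exists>g\<in>blow 2 n (snd T). f ` e = insert 0 g)"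
      proof cases
        case 1
        then show ?thesis using \<tau>(5) f_img[OF gamV] by simp
      next
        case 2
        then show ?thesis using \<tau>blow[OF 2(1) T] f0[OF blow2[OF 2(1)]] by blast
      qed
      ultimately show "f ` e \<in> D (snd T)" unfolding D by blast
    qed
    have f_injD: "inj_on ((`) f) (D T)" for T
      using DV by (intro inj_on_image inj_on_subset[OF f_inj]) blast
    \<comment> \<open>The same \<open>f\<close> maps \<open>D TX\<close> into \<open>D TY\<close>
      and \<open>D TY\<close> into \<open>D TX\<close>, so the cardinalities agree and inclusion
      becomes equality.\<close>
    have le: "card (D (fst T)) \<le> card (D (snd T))" if T: "T \<in> {(TX, TY), (TY, TX)}" for T
      by (rule card_inj_on_le[OF f_injD sub[OF T] finD])
    have img: "(`) f ` D TX = D TY"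
    proof (rule image_edges_eq[OF finD _ f_inj _ _ finD])
      show "(`) f ` D TX \<subseteq> D TY" using sub[of "(TX, TY)"] by simp
      show "card (D TY) \<le> card (D TX)" using le[of "(TY, TX)"] by simp
    qed (use DV in blast)
    have bij: "bij_betw f ({0..2 ^ n} - {v}) ({0..2 ^ n} - {v})"
    proof -
      have "f ` {0..2 ^ n} = {0..2 ^ n}" by (rule endo_inj_surj[OF _ fV f_inj]) simp
      then have "bij_betw f {0..2 ^ n} {0..2 ^ n}" using f_inj by (simp add: bij_betw_def)
      from bij_betw_DiffI[OF this, of "{v}" "{v}"] show ?thesis
        using fv vV by (simp add: bij_betw_def)
    qed
    show ?thesis
      unfolding hypergraph_iso_def
    proof (rule exI[of _ f], rule conjI)
      show "bij_betw f (vertices (delete_vertex ?X v)) (vertices (delete_vertex ?Y v))"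
        unfolding delete_vertex_def fst_conv ver by (rule bij)
      show "(`) f ` edges (delete_vertex ?X v) = edges (delete_vertex ?Y v)"
        unfolding delete_vertex_def snd_conv D_def[symmetric] by (rule img)
    qed
  qed
  moreover have "uniform_hypergraph 3 ?X" "uniform_hypergraph 3 ?Y"
    by (rule uniform_hubgraph[OF n2]; auto)+
  moreover have "bij_betw id (vertices ?X) (vertices ?X)" by (rule bij_betw_id)
  moreover have "vertices ?X = vertices ?Y" by (simp only: ver)
  ultimately show ?thesis unfolding hypomorphic_def by (metis id_apply)
qed

section \<open>The positive eigenvectors are not balanced\<close>

text \<open>The Lagrangian is affine in each variable, so a unit increment gives the derivative
  exactly. Recursions for \<open>Lag\<close> thereby yield recursions for \<open>pd\<close>.\<close>

lemma pd_eq_diff: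
  fixes w :: "'v \<Rightarrow> real"
  assumes "finite E" "\<And>e. e \<in> E \<Longrightarrow> finite e"
  shows "pd E j w = Lag E (w(j := w j + 1)) - Lag E w"
  using Lag_upd[OF assms, of w j 1] by simp

lemma class_sum_upd:
  fixes w :: "nat \<Rightarrow> real"
  assumes "j \<in> {1..2 ^ n}"
  shows "class_sum r n (w(j := w j + s)) =
    (class_sum r n w)(cls r j := class_sum r n w (cls r j) + s)"
proof
  fix c
  let ?C = "{i. i \<in> {1..2 ^ n} \<and> cls r i = c}"
  have fin: "finite ?C" by simp
  have "(\<Sum>i\<in>?C. (w(j := w j + s)) i) = (\<Sum>i\<in>?C. w i + (if i = j then s else 0))"
    by (rule sum.cong) auto
  also have "\<dots> = (\<Sum>i\<in>?C. w i) + (if j \<in> ?C then s else 0)"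
    using fin by (simp only: sum.distrib sum.delta)
  finally show "class_sum r n (w(j := w j + s)) c =
      ((class_sum r n w)(cls r j := class_sum r n w (cls r j) + s)) c"
    using assms by (auto simp: class_sum_def)
qed

lemma class_sum_reindex:
  assumes \<tau>: "bij_betw \<tau> {1..2 ^ n} {1..2 ^ n}" and h: "inj_on h {1..2 ^ r}"
    and cl: "\<And>j. j \<in> {1..2 ^ n} \<Longrightarrow> cls r (\<tau> j) = h (cls r j)" and c: "c \<in> {1..2 ^ r}"
  shows "class_sum r n (\<lambda>j. w (\<tau> j)) c = class_sum r n w (h c)"
proof -
  let ?V = "{1..2 ^ n} :: nat set"
  have "bij_betw \<tau> {j. j \<in> ?V \<and> cls r j = c} {j. j \<in> ?V \<and> cls r j = h c}"
    unfolding bij_betw_def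
  proof
    show "inj_on \<tau> {j. j \<in> ?V \<and> cls r j = c}"
      using \<tau> by (auto simp: bij_betw_def intro: inj_on_subset)
    show "\<tau> ` {j. j \<in> ?V \<and> cls r j = c} = {j. j \<in> ?V \<and> cls r j = h c}"
    proof (intro equalityI subsetI)
      fix i assume "i \<in> \<tau> ` {j. j \<in> ?V \<and> cls r j = c}"
      then show "i \<in> {j. j \<in> ?V \<and> cls r j = h c}" using \<tau> cl by (auto simp: bij_betw_def)
    next
      fix i assume i: "i \<in> {j. j \<in> ?V \<and> cls r j = h c}"
      then have "i \<in> \<tau> ` ?V" using \<tau> by (simp add: bij_betw_def)
      then obtain j where j: "j \<in> ?V" "i = \<tau> j" by blast
      then have "h (cls r j) = h c" using i cl by simp
      then have "cls r j = c" using inj_onD[OF h] cls_in c by blast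
      then show "i \<in> \<tau> ` {j. j \<in> ?V \<and> cls r j = c}" using j by blast
    qed
  qed
  from sum.reindex_bij_betw[OF this, of w] show ?thesis by (simp only: class_sum_def)
qed

lemma class_sum_2_3:
  fixes w :: "nat \<Rightarrow> 'a::comm_semiring_1"
  assumes "c \<in> {1..4}"
  shows "class_sum 2 n w c = class_sum 3 n w c + class_sum 3 n w (c + 4)"
proof -
  let ?C = "\<lambda>r c. {j. j \<in> {1..2 ^ n} \<and> cls r j = c}"
  have "cls 2 j = c \<longleftrightarrow> cls 3 j = c \<or> cls 3 j = c + 4" if "1 \<le> j" for j
  proof -
    define k where "k = (j - 1) mod 8"
    have "(j - 1) mod 4 = k mod 4" by (simp add: k_def mod_mod_cancel)
    also have "\<dots> = (if k < 4 then k else k - 4)"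
    proof -
      have "k < 8" by (simp add: k_def)
      then show ?thesis by (simp add: le_mod_geq)
    qed
    finally have "cls 2 j = (if k < 4 then k else k - 4) + 1" by (simp add: cls_def)
    moreover have "cls 3 j = k + 1" by (simp add: cls_def k_def)
    ultimately show ?thesis using assms by auto
  qed
  then have "?C 2 c = ?C 3 c \<union> ?C 3 (c + 4)" by auto
  then show ?thesis unfolding class_sum_def by (simp only:) (rule sum.union_disjoint; auto)
qed

lemma class_sum_odd:
  assumes c: "c \<in> {1..2 ^ r}"
  shows "class_sum r n (\<lambda>i. w (2 * i - 1)) c = class_sum (Suc r) (Suc n) w (2 * c - 1)"
proof -
  have "bij_betw (\<lambda>i. 2 * i - 1) {j. j \<in> {1..2 ^ n} \<and> cls r j = c}
      {j. j \<in> {1..2 ^ Suc n} \<and> cls (Suc r) j = 2 * c - 1}"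
  proof -
    have cl: "cls (Suc r) (2 * i - 1) = 2 * cls r i - 1" if "1 \<le> i" for i
    proof -
      from that obtain k where k: "i = Suc k" by (cases i) auto
      have "2 * i - 1 - 1 = 2 * k" using k by simp
      then show ?thesis using k mult_mod_right[of 2 k "2 ^ r"] by (simp add: cls_def)
    qed
    show ?thesis unfolding bij_betw_def
    proof
      show "inj_on (\<lambda>i. 2 * i - 1) {j. j \<in> {1..2 ^ n} \<and> cls r j = c}" by (auto simp: inj_on_def)
      show "(\<lambda>i. 2 * i - 1) ` {j. j \<in> {1..2 ^ n} \<and> cls r j = c} =
          {j. j \<in> {1..2 ^ Suc n} \<and> cls (Suc r) j = 2 * c - 1}"
      proof (intro equalityI subsetI)
        fix j assume j: "j \<in> {j. j \<in> {1..2 ^ Suc n} \<and> cls (Suc r) j = 2 * c - 1}"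
        then have jV: "j \<in> {1..2 ^ Suc n}" and cj: "cls (Suc r) j = 2 * c - 1" by auto
        have "odd (cls (Suc r) j)" using c cj by auto
        then have "odd j" using odd_cls[of j "Suc r"] jV by simp
        with jV show "j \<in> (\<lambda>i. 2 * i - 1) ` {j. j \<in> {1..2 ^ n} \<and> cls r j = c}"
        proof (cases rule: half_cases)
          case (1 k)
          then have "2 * cls r k - 1 = 2 * c - 1" using cl[of k] cj by simp
          then have "cls r k = c" using cls_in[of r k] c by auto
          with 1 show ?thesis by blast
        qed auto
      next
        fix j assume "j \<in> (\<lambda>i. 2 * i - 1) ` {j. j \<in> {1..2 ^ n} \<and> cls r j = c}"
        then obtain i where i: "i \<in> {1..2 ^ n}" "cls r i = c" "j = 2 * i - 1" by auto
        then show "j \<in> {j. j \<in> {1..2 ^ Suc n} \<and> cls (Suc r) j = 2 * c - 1}"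
          using cl[of i] by auto
      qed
    qed
  qed
  from sum.reindex_bij_betw[OF this, of w] show ?thesis by (simp only: class_sum_def)
qed

lemma finite_T33: "finite T33" "e \<in> T33 \<Longrightarrow> finite e"
  using T33_card by (auto simp: T33_def intro: finite_subset)

lemma pd_T33_diff: "pd T33 j w = Lag T33 (w(j := w j + 1)) - Lag T33 w" for w :: "nat \<Rightarrow> real"
  by (rule pd_eq_diff[OF finite_T33])

lemma finite_gam_edge: "2 \<le> n \<Longrightarrow> e \<in> gam n \<Longrightarrow> finite e"
  using gam_props by (blast intro: finite_subset)

text \<open>The chain rule for \<open>Lag_gam_Suc\<close>: a vertex occurs in its own half and in
  one class sum modulo 8.\<close>

lemma pd_gam_Suc:
  fixes w :: "nat \<Rightarrow> real"
  assumes n: "2 \<le> n" and k: "k \<in> {1..2 ^ n}"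
  shows "pd (gam (Suc n)) (2 * k - 1) w =
      pd T33 (cls 3 (2 * k - 1)) (class_sum 3 (Suc n) w) + pd (gam n) k (\<lambda>i. w (2 * i - 1))"
    and "pd (gam (Suc n)) (2 * k) w =
      pd T33 (cls 3 (2 * k)) (class_sum 3 (Suc n) w) + pd (gam n) k (\<lambda>i. w (2 * i))"
proof -
  have n': "2 \<le> Suc n" using n by simp
  note d = pd_eq_diff[OF finite_gam[OF n] finite_gam_edge[OF n]]
    pd_eq_diff[OF finite_gam[OF n'] finite_gam_edge[OF n']] pd_T33_diff
  have kV: "2 * k - 1 \<in> {1..2 ^ Suc n}" "2 * k \<in> {1..2 ^ Suc n}" using k by auto
  have "(\<lambda>i. (w(2 * k - 1 := z)) (2 * i)) = (\<lambda>i. w (2 * i))"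
    "(\<lambda>i. (w(2 * k - 1 := z)) (2 * i - 1)) = (\<lambda>i. w (2 * i - 1))(k := z)"
    "(\<lambda>i. (w(2 * k := z)) (2 * i - 1)) = (\<lambda>i. w (2 * i - 1))"
    "(\<lambda>i. (w(2 * k := z)) (2 * i)) = (\<lambda>i. w (2 * i))(k := z)" for z
    using k by (auto simp: fun_eq_iff) presburger+
  then show "pd (gam (Suc n)) (2 * k - 1) w =
      pd T33 (cls 3 (2 * k - 1)) (class_sum 3 (Suc n) w) + pd (gam n) k (\<lambda>i. w (2 * i - 1))"
    and "pd (gam (Suc n)) (2 * k) w =
      pd T33 (cls 3 (2 * k)) (class_sum 3 (Suc n) w) + pd (gam n) k (\<lambda>i. w (2 * i))"
    by (simp_all only: d Lag_gam_Suc[OF n] class_sum_upd[OF kV(1)] class_sum_upd[OF kV(2)])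
qed

lemma pd_T33:
  fixes s :: "nat \<Rightarrow> real"
  shows "pd T33 1 s = s 8 * s 2 + s 2 * s 3 + s 7 * s 8 + s 6 * s 4 + s 4 * s 7 + s 3 * s 6"
    and "pd T33 2 s = s 8 * s 1 + s 1 * s 3 + s 3 * s 4 + s 7 * s 5 + s 5 * s 8 + s 4 * s 7"
  unfolding pd_T33_diff Lag_T33 by (simp_all add: algebra_simps)

text \<open>Each of the eight vertices lies on 6 = 16 * 3 / 8 edges.\<close>

lemma pd_T33_const:
  fixes s :: "nat \<Rightarrow> real"
  assumes "c \<in> {1..8}" and s: "\<And>i. i \<in> {1..8} \<Longrightarrow> s i = a"
  shows "pd T33 c s = 6 * a ^ 2"
proof -
  have "{1..8::nat} = {1,2,3,4,5,6,7,8}" by auto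
  with s have v: "s 1 = a" "s 2 = a" "s 3 = a" "s 4 = a" "s 5 = a" "s 6 = a" "s 7 = a" "s 8 = a" by auto
  have "c \<in> {1,2,3,4,5,6,7,8}" using assms(1) by auto
  then show ?thesis
    unfolding pd_T33_diff Lag_T33
    using v by (elim insertE emptyE; simp add: algebra_simps power2_eq_square)
qed

section \<open>The reversal and the exchange of the two halves\<close>

lemma Lag_gam_reversal:
  fixes w :: "nat \<Rightarrow> real"
  assumes n: "2 \<le> n"
  shows "Lag (gam n) (\<lambda>j. w (2 ^ n + 1 - j)) = Lag (gam n) w"
proof -
  let ?\<rho> = "\<lambda>j. 2 ^ n + 1 - j :: nat"
  have V: "e \<subseteq> {1..2 ^ n}" if "e \<in> gam n" for e using gam_props[OF n that] by blast
  have inj: "inj_on ?\<rho> {1..2 ^ n}" by (auto simp: inj_on_def)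
  have "(`) ?\<rho> ` gam n = gam n"
    by (rule image_edges_eq[OF finite_gam[OF n] _ inj _ order_refl finite_gam[OF n]])
      (use V gam_reversal[OF n] in auto)
  moreover have "inj_on ?\<rho> (\<Union> (gam n))" using V by (intro inj_on_subset[OF inj]) blast
  ultimately show ?thesis using Lag_image[of ?\<rho> "gam n" w] by simp
qed

lemma reversal_class:
  assumes "1 \<le> r" "r \<le> n" "j \<in> {1..2 ^ n}"
  shows "cls r (2 ^ n + 1 - j) = 2 ^ r + 1 - cls r j"
proof -
  have c: "cls r j \<in> {1..2 ^ r}" by (rule cls_in)
  have "2 ^ r dvd (2::nat) ^ n" using assms by (intro le_imp_power_dvd)
  then have "(2 ^ n + 1 - j + j) mod 2 ^ r = (2 ^ r + 1 - cls r j + cls r j) mod 2 ^ r"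
    using assms(3) c by (auto elim!: dvdE simp: mod_Suc)
  also have "\<dots> = (2 ^ r + 1 - cls r j + j) mod 2 ^ r"
    by (rule mod_add_cong[OF refl]) (use cls_mod assms(3) in simp)
  finally have "(2 ^ n + 1 - j) mod 2 ^ r = (2 ^ r + 1 - cls r j) mod 2 ^ r"
    by (auto simp: nat_mod_eq_iff add.assoc)
  then show ?thesis using assms(3) c by (intro cls_eq_iff[THEN iffD2]) auto
qed

lemma bij_reversal: "bij_betw (\<lambda>j. m + 1 - j) {1..m} {1..m::nat}"
  by (rule bij_betw_byWitness[where f' = "\<lambda>j. m + 1 - j"]) auto

lemma class_sum_reversal:
  assumes "1 \<le> r" "r \<le> n" "c \<in> {1..2 ^ r}"
  shows "class_sum r n (\<lambda>j. w (2 ^ n + 1 - j)) c = class_sum r n w (2 ^ r + 1 - c)"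
  by (rule class_sum_reindex[OF bij_reversal _ reversal_class[OF assms(1,2)] assms(3)])
    (auto simp: inj_on_def)

definition twin :: "nat \<Rightarrow> nat" where
  "twin j = (if odd j then j + 1 else j - 1)"

lemma twin_twin: "1 \<le> j \<Longrightarrow> twin (twin j) = j"
  by (auto simp: twin_def)

lemma twin_in: "j \<in> {1..2 ^ Suc n} \<Longrightarrow> twin j \<in> {1..2 ^ Suc n}"
  by (erule half_cases) (auto simp: twin_def)

lemma bij_twin: "bij_betw twin {1..2 ^ Suc n} {1..2 ^ Suc n}"
  by (rule bij_betw_byWitness[where f' = twin]) (use twin_twin twin_in in auto)

lemma cls_3_double:
  "cls 3 (2 * i + 1) = 2 * (i mod 4) + 1" "cls 3 (2 * i + 2) = 2 * (i mod 4) + 2"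
proof -
  have m: "(2 * i) mod 8 = 2 * (i mod 4)" using mult_mod_right[of 2 i 4] by simp
  then show "cls 3 (2 * i + 1) = 2 * (i mod 4) + 1" by (simp add: cls_def)
  have "Suc (2 * (i mod 4)) \<noteq> 8" by presburger
  then have "Suc (2 * i) mod 8 = Suc (2 * (i mod 4))" by (simp add: mod_Suc m)
  then show "cls 3 (2 * i + 2) = 2 * (i mod 4) + 2" by (simp add: cls_def)
qed

lemma cls_twin:
  assumes "j \<in> {1..2 ^ Suc n}"
  shows "cls 3 (twin j) = twin (cls 3 j)"
  using assms
proof (cases rule: half_cases)
  case (1 k)
  then obtain i where i: "j = 2 * i + 1" by (cases k) auto
  show ?thesis using cls_3_double[of i] by (simp add: i twin_def)
next
  case (2 k)
  then obtain i where i: "j = 2 * i + 2" by (cases k) auto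
  show ?thesis using cls_3_double[of i] by (simp add: i twin_def)
qed

lemma Lag_cong_gam:
  assumes "2 \<le> n" "\<And>i. i \<in> {1..2 ^ n} \<Longrightarrow> w i = w' i"
  shows "Lag (gam n) w = Lag (gam n) w'"
  by (rule Lag_cong) (use gam_props[OF assms(1)] assms(2) in blast)

lemma pd_cong_gam:
  assumes "2 \<le> n" "\<And>i. i \<in> {1..2 ^ n} \<Longrightarrow> w i = w' i"
  shows "pd (gam n) k w = pd (gam n) k w'"
  unfolding pd_def by (intro sum.cong prod.cong refl) (use gam_props[OF assms(1)] assms(2) in blast)

lemma Lag_T33_swap:
  fixes s t :: "nat \<Rightarrow> real"
  assumes s: "s 8 = s 1" "s 7 = s 2" "s 6 = s 3" "s 5 = s 4" "s 1 + s 4 = s 2 + s 3"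
    and t: "\<And>c. c \<in> {1..8} \<Longrightarrow> t c = s (twin c)"
  shows "Lag T33 t = Lag T33 s"
proof -
  have t': "t 1 = s 2" "t 2 = s 1" "t 3 = s 4" "t 4 = s 3" "t 5 = s 6" "t 6 = s 5" "t 7 = s 8" "t 8 = s 7"
  proof -
    have tw: "twin 1 = 2" "twin 2 = 1" "twin 3 = 4" "twin 4 = 3" "twin 5 = 6" "twin 6 = 5" "twin 7 = 8" "twin 8 = 7"
      by (simp_all add: twin_def)
    show "t 1 = s 2" "t 2 = s 1" "t 3 = s 4" "t 4 = s 3" "t 5 = s 6" "t 6 = s 5" "t 7 = s 8" "t 8 = s 7"
      using t[of 1] t[of 2] t[of 3] t[of 4] t[of 5] t[of 6] t[of 7] t[of 8] unfolding tw by simp_all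
  qed
  \<comment> \<open>Eliminating \<open>s 4\<close> by the balance condition makes the two sides
    equal as polynomials.\<close>
  have s4: "s 4 = s 2 + s 3 - s 1" using s(5) by simp
  show ?thesis unfolding Lag_T33 t' s(1-4) s4 by (simp add: algebra_simps)
qed

text \<open>If the class sums modulo 4 agree, then rigidity first gives invariance under the reversal and
  then under \<open>twin\<close>, because \<open>Lag T33\<close> changes under \<open>twin\<close> by a multiple of
  \<open>s 1 + s 4 - s 2 - s 3\<close>. So the two halves of the vector agree, and comparing the critical
  equations at 1 and 2 makes the class sums modulo 8 equal; this is the same situation one level
  down, with a larger \<open>\<kappa>\<close>.\<close>

lemma not_balanced:
  fixes x :: "nat \<Rightarrow> real"
  shows "2 \<le> n \<Longrightarrow> (\<And>j. j \<in> {1..2 ^ n} \<Longrightarrow> 0 < x j) \<Longrightarrow> 0 < \<kappa> \<Longrightarrow>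
    (\<And>j. j \<in> {1..2 ^ n} \<Longrightarrow> pd (gam n) j x + \<kappa> = l * x j ^ 2) \<Longrightarrow>
    (\<And>c. c \<in> {1..4} \<Longrightarrow> class_sum 2 n x c = S) \<Longrightarrow> False"
proof (induction n arbitrary: x \<kappa> S rule: nat_induct_at_least)
  case base
  have "x c = S" if "c \<in> {1..4}" for c
    using base(4)[OF that] class_sum_self[of c 2 x] that by simp
  then have x: "x 1 = S" "x 2 = S" "x 3 = S" "x 4 = S" by auto
  have "pd (gam 2) j x = Lag (gam 2) (x(j := x j + 1)) - Lag (gam 2) x" for j
    by (rule pd_eq_diff[OF finite_gam finite_gam_edge]) auto
  \<comment> \<open>Vertex 1 lies on one edge and vertex 2 on two, so equal coordinates cannot
    satisfy both critical equations.\<close>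
  from this[of 1] this[of 2] have "pd (gam 2) 1 x = S * S" "pd (gam 2) 2 x = 2 * (S * S)"
    using x by (simp_all add: Lag_gam_2 algebra_simps)
  then have "S * S + \<kappa> = l * S ^ 2" "2 * (S * S) + \<kappa> = l * S ^ 2"
    using base(3)[of 1] base(3)[of 2] x by simp_all
  then have "S * S = 0" by linarith
  moreover have "0 < S" using base(1)[of 1] x by simp
  ultimately show False by simp
next
  case (Suc n)
  let ?N = "Suc n" and ?V = "{1..2 ^ Suc n} :: nat set"
  let ?s = "class_sum 3 (Suc n) x"
  have N: "2 \<le> ?N" "3 \<le> ?N" using Suc.hyps by simp_all
  have gamV: "gam ?N \<subseteq> Pow ?V" using gam_props[OF N(1)] by blast
  have rigid: "x (\<tau> j) = x j"
    if \<tau>: "bij_betw \<tau> ?V ?V" and L: "Lag (gam ?N) (\<lambda>j. x (\<tau> j)) = Lag (gam ?N) x" and j: "j \<in> ?V" for \<tau> j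
  proof (rule affine_eigenvector_rigid[OF _ gamV _ _ _ _ \<open>0 < \<kappa>\<close> L])
    show "\<And>i. i \<in> ?V \<Longrightarrow> 0 \<le> x (\<tau> i)"
      using \<tau> Suc.prems(1) by (meson bij_betwE less_imp_le)
    show "(\<Sum>j\<in>?V. x (\<tau> j)) = (\<Sum>j\<in>?V. x j)" "(\<Sum>j\<in>?V. x (\<tau> j) ^ 3) = (\<Sum>j\<in>?V. x j ^ 3)"
      using sum.reindex_bij_betw[OF \<tau>, of x] sum.reindex_bij_betw[OF \<tau>, of "\<lambda>j. x j ^ 3"] by simp_all
    show "\<And>i. i \<in> ?V \<Longrightarrow> 0 < x i" "\<And>i. i \<in> ?V \<Longrightarrow> pd (gam ?N) i x + \<kappa> = l * x i ^ 2"
      by (fact Suc.prems)+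
    show "\<And>e. e \<in> gam ?N \<Longrightarrow> card e = 3" using gam_props[OF N(1)] by blast
  qed (use j in auto)
  have rev: "x (2 ^ ?N + 1 - j) = x j" if "j \<in> ?V" for j
    by (rule rigid[OF bij_reversal Lag_gam_reversal[OF N(1)] that])
  have srev: "?s (9 - c) = ?s c" if "c \<in> {1..8}" for c
  proof -
    have "?s c = class_sum 3 ?N (\<lambda>j. x (2 ^ ?N + 1 - j)) c"
      unfolding class_sum_def by (rule sum.cong) (use rev in auto)
    also have "\<dots> = ?s (9 - c)" using class_sum_reversal[of 3 ?N c x] N that by simp
    finally show ?thesis by simp
  qed
  have s: "?s 8 = ?s 1" "?s 7 = ?s 2" "?s 6 = ?s 3" "?s 5 = ?s 4"
    using srev[of 1] srev[of 2] srev[of 3] srev[of 4] by simp_all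
  \<comment> \<open>Class c modulo 4 splits into c and c + 4 modulo 8; the reversal then rewrites 5
    and 6 as 4 and 3.\<close>
  have "?s 1 + ?s 5 = S" "?s 2 + ?s 6 = S"
    using Suc.prems(4)[of 1] Suc.prems(4)[of 2] class_sum_2_3[of 1 ?N x] class_sum_2_3[of 2 ?N x] by simp_all
  then have s14: "?s 1 + ?s 4 = ?s 2 + ?s 3" using s by simp
  have stwin: "class_sum 3 ?N (\<lambda>j. x (twin j)) c = ?s (twin c)" if "c \<in> {1..8}" for c
  proof (rule class_sum_reindex[OF bij_twin _ cls_twin])
    show "inj_on twin {1..2 ^ 3}" using bij_twin[of 2] by (simp add: bij_betw_def eval_nat_numeral)
  qed (use that in auto)
  have twin: "x (twin j) = x j" if "j \<in> ?V" for j
  proof (rule rigid[OF bij_twin _ that])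
    have "Lag (gam n) (\<lambda>i. x (twin (2 * i))) = Lag (gam n) (\<lambda>i. x (2 * i - 1))"
      "Lag (gam n) (\<lambda>i. x (twin (2 * i - 1))) = Lag (gam n) (\<lambda>i. x (2 * i))"
      by (rule Lag_cong_gam[OF Suc.hyps]; force simp: twin_def)+
    moreover have "Lag T33 (class_sum 3 ?N (\<lambda>j. x (twin j))) = Lag T33 ?s"
      by (rule Lag_T33_swap[OF s s14 stwin])
    ultimately show "Lag (gam ?N) (\<lambda>j. x (twin j)) = Lag (gam ?N) x"
      unfolding Lag_gam_Suc[OF Suc.hyps] by simp
  qed
  have s_eq: "?s (twin c) = ?s c" if "c \<in> {1..8}" for c
  proof -
    have "?s (twin c) = class_sum 3 ?N (\<lambda>j. x (twin j)) c" using stwin[OF that] by simp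
    also have "\<dots> = ?s c" unfolding class_sum_def by (rule sum.cong) (use twin in auto)
    finally show ?thesis .
  qed
  have "twin 1 = 2" "twin 3 = 4" by (simp_all add: twin_def)
  then have s2: "?s 2 = ?s 1" "?s 4 = ?s 3" using s_eq[of 1] s_eq[of 3] by simp_all
  have V12: "1 \<in> ?V" "2 \<in> ?V" by simp_all
  have cls12: "cls 3 1 = 1" "cls 3 2 = 2" by (simp_all add: cls_def)
  have pdw: "pd (gam n) k (\<lambda>i. x (2 * i)) = pd (gam n) k (\<lambda>i. x (2 * i - 1))" for k
  proof (rule pd_cong_gam[OF Suc.hyps])
    fix i :: nat assume "i \<in> {1..2 ^ n}"
    then have "2 * i - 1 \<in> ?V" "twin (2 * i - 1) = 2 * i" by (auto simp: twin_def)
    then show "x (2 * i) = x (2 * i - 1)" using twin[of "2 * i - 1"] by simp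
  qed
  have "pd T33 1 ?s = pd T33 2 ?s"
  proof -
    have "x 2 = x 1" using twin[OF V12(1)] \<open>twin 1 = 2\<close> by simp
    moreover have "pd (gam ?N) 1 x = pd T33 1 ?s + pd (gam n) 1 (\<lambda>i. x (2 * i - 1))"
      "pd (gam ?N) 2 x = pd T33 2 ?s + pd (gam n) 1 (\<lambda>i. x (2 * i - 1))"
      using pd_gam_Suc[OF Suc.hyps, of 1 x] cls12 pdw[of 1] by simp_all
    ultimately show ?thesis using Suc.prems(3)[OF V12(1)] Suc.prems(3)[OF V12(2)] by simp
  qed
  \<comment> \<open>With a = s_1 and b = s_3 the two derivatives are 2a^2 + 2ab + 2b^2 and a^2 + 4ab
    + b^2, which differ by (a - b)^2.\<close>
  then have "(?s 1 - ?s 3) * (?s 1 - ?s 3) = 0"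
    unfolding pd_T33 s s2 by (simp add: algebra_simps)
  then have s13: "?s 3 = ?s 1" by simp
  have s_const: "?s c = ?s 1" if "c \<in> {1..8}" for c
  proof -
    have "c \<in> {1,2,3,4,5,6,7,8}" using that by auto
    then show ?thesis using s s2 s13 by (elim insertE emptyE) auto
  qed
  \<comment> \<open>The odd half inherits the equation: its \<open>T33\<close> term is the constant
    6 s_1^2, absorbed into \<kappa>, and its class c modulo 4 is class 2c - 1 modulo 8 of the
    whole.\<close>
  show False
  proof (rule Suc.IH[of "\<lambda>i. x (2 * i - 1)" "\<kappa> + 6 * ?s 1 ^ 2" "?s 1"])
    show "0 < x (2 * j - 1)" if "j \<in> {1..2 ^ n}" for j
      by (rule Suc.prems(1)) (use that in auto)
    show "0 < \<kappa> + 6 * ?s 1 ^ 2" using \<open>0 < \<kappa>\<close> by (simp add: add_pos_nonneg)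
    show "pd (gam n) j (\<lambda>i. x (2 * i - 1)) + (\<kappa> + 6 * ?s 1 ^ 2) = l * x (2 * j - 1) ^ 2"
      if j: "j \<in> {1..2 ^ n}" for j
    proof -
      have "pd T33 (cls 3 (2 * j - 1)) ?s = 6 * ?s 1 ^ 2"
        by (rule pd_T33_const[OF _ s_const]) (use cls_in[of 3] in auto)
      moreover have "2 * j - 1 \<in> ?V" using j by auto
      ultimately show ?thesis using Suc.prems(3)[of "2 * j - 1"] pd_gam_Suc(1)[OF Suc.hyps j, of x] by simp
    qed
    show "class_sum 2 n (\<lambda>i. x (2 * i - 1)) c = ?s 1" if "c \<in> {1..4}" for c
    proof -
      have "class_sum 2 n (\<lambda>i. x (2 * i - 1)) c = class_sum (Suc 2) (Suc n) x (2 * c - 1)"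
        by (rule class_sum_odd) (use that in simp)
      also have "\<dots> = ?s (2 * c - 1)" by (simp add: eval_nat_numeral)
      also have "\<dots> = ?s 1" by (rule s_const) (use that in auto)
      finally show ?thesis .
    qed
  qed
qed

section \<open>The characteristic polynomials differ\<close>

lemma pd_Lag_pairs:
  fixes s :: "nat \<Rightarrow> real"
  assumes "c \<in> {1..4}" and s: "\<And>i. i \<in> {1..4} \<Longrightarrow> s i = a"
  shows "Lag TX (s(c := s c + 1)) - Lag TX s = a"
proof -
  have "{1..4::nat} = {1,2,3,4}" by auto
  with s have v: "s 1 = a" "s 2 = a" "s 3 = a" "s 4 = a" by auto
  have "c \<in> {1,2,3,4}" using assms(1) by auto
  then show ?thesis
    unfolding Lag_pairs using v by (elim insertE emptyE; simp add: algebra_simps)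
qed

text \<open>Every class is matched by \<open>T\<close>, and the representative of the partner class
  in 1..4 is itself a vertex, which serves as \<open>k\<close>.\<close>

lemma hub_edge:
  assumes n: "2 \<le> n" and T: "T = TX \<or> T = TY" and i: "i \<in> vertices (hubgraph n T)" "i \<noteq> 0"
  shows "\<exists>k. {i, 0, k} \<in> edges (hubgraph n T)"
proof -
  have iV: "i \<in> {1..2 ^ n}" using i by (simp add: hubgraph_def)
  have "\<forall>c\<in>{1,2,3,4}. \<exists>c'\<in>{1,2,3,4}. c \<noteq> c' \<and> {c, c'} \<in> T" using T by (auto simp: insert_commute)
  moreover have "cls 2 i \<in> {1,2,3,4}" using cls_in[of 2 i] by auto
  ultimately obtain c where c: "c \<in> {1,2,3,4}" "cls 2 i \<noteq> c" "{cls 2 i, c} \<in> T" by blast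
  have cc: "cls 2 c = c" using c(1) by (intro cls_id) auto
  have "2 ^ 2 \<le> (2 ^ n :: nat)" by (rule power_increasing[OF n]) simp
  then have "c \<in> {1..2 ^ n}" using c(1) by auto
  then have "{i, c} \<in> blow 2 n T" using iV c cc by (auto simp: blow_def)
  then have "{i, 0, c} \<in> edges (hubgraph n T)"
    by (auto simp: hubgraph_def insert_commute[of i 0])
  then show ?thesis by blast
qed

lemma characteristic_polynomials_differ:
  assumes n: "3 \<le> n"
  shows "characteristic_polynomial 3 (hubgraph n TX) \<noteq> characteristic_polynomial 3 (hubgraph n TY)"
proof -
  let ?X = "hubgraph n TX" and ?Y = "hubgraph n TY" and ?V = "{0..2 ^ n} :: nat set"
  let ?W = "{1..2 ^ n} :: nat set"
  have n2: "2 \<le> n" using n by simp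
  have verT: "vertices (hubgraph n T) = ?V" for T by (simp add: hubgraph_def)
  have V: "finite ?V" and h: "0 \<in> ?V" and W: "?V = insert 0 ?W" by auto
  have card2: "card e = 2" if "e \<in> T" "T = TX \<or> T = TY" for e T using that by auto
  have E: "edges (hubgraph n T) \<subseteq> Pow ?V" "\<And>e. e \<in> edges (hubgraph n T) \<Longrightarrow> card e = 3"
    if "T = TX \<or> T = TY" for T
    using hubgraph_props(1)[OF n2 card2[OF _ that]] hubgraph_props(2)[OF n2 card2[OF _ that]]
    by (simp_all only: verT)
  have LagT: "Lag (edges (hubgraph n T)) w = Lag (gam n) w + w 0 * Lag T (class_sum 2 n w)"
    if "T = TX \<or> T = TY" for T and w :: "nat \<Rightarrow> real"
    by (rule Lag_hubgraph[OF n2 card2[OF _ that]]) (use that in auto)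
  have hub: "\<exists>k. {i, 0, k} \<in> edges (hubgraph n T)" if "T = TX \<or> T = TY" "i \<in> ?V" "i \<noteq> 0" for i T
    by (rule hub_edge[OF n2 that(1)]) (use that verT in auto)
  have perron: "\<exists>(x :: nat \<Rightarrow> real) l. (\<forall>i\<in>?V. 0 < x i) \<and> (\<forall>i\<in>?V. pd (edges (hubgraph n T)) i x = l * x i ^ 2)"
    if T: "T = TX \<or> T = TY" for T
  proof (rule perron_eigenvector[OF V E(1)[OF T] _ h])
    show "\<And>e. e \<in> edges (hubgraph n T) \<Longrightarrow> card e = 3" by (rule E(2)[OF T])
    show "\<And>i. i \<in> ?V \<Longrightarrow> i \<noteq> 0 \<Longrightarrow> \<exists>k. {i, 0, k} \<in> edges (hubgraph n T)" by (rule hub[OF T])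
  next
    fix x :: "nat \<Rightarrow> real" and l
    assume *: "\<And>i. i \<in> ?V \<Longrightarrow> 0 < x i"
      "\<And>i. i \<in> ?V \<Longrightarrow> pd (edges (hubgraph n T)) i x = l * x i ^ 2"
    show ?thesis by (rule exI[of _ x], rule exI[of _ l], intro conjI ballI *)
  qed
  have tx: "TX = TX \<or> TX = TY" and ty: "TY = TX \<or> TY = TY" by simp_all
  from perron[OF tx] obtain x :: "nat \<Rightarrow> real" and l where
    "\<forall>i\<in>?V. 0 < x i" "\<forall>i\<in>?V. pd (edges ?X) i x = l * x i ^ 2" by blast
  then have x: "\<And>i. i \<in> ?V \<Longrightarrow> 0 < x i"
    and xeig: "\<And>i. i \<in> ?V \<Longrightarrow> pd (edges ?X) i x = l * x i ^ 2" by blast+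
  from perron[OF ty] obtain y :: "nat \<Rightarrow> real" and m where
    "\<forall>i\<in>?V. 0 < y i" "\<forall>i\<in>?V. pd (edges ?Y) i y = m * y i ^ 2" by blast
  then have y: "\<And>i. i \<in> ?V \<Longrightarrow> 0 < y i"
    and yeig: "\<And>i. i \<in> ?V \<Longrightarrow> pd (edges ?Y) i y = m * y i ^ 2" by blast+
  let ?S = "class_sum 2 n x"
  have value_x: "3 * Lag (edges ?X) x = l * (\<Sum>j\<in>?V. x j ^ 3)"
  proof -
    have "(\<Sum>j\<in>?V. x j * pd (edges ?X) j x) = (\<Sum>j\<in>?V. l * x j ^ 3)"
      by (rule sum.cong) (use xeig in \<open>auto simp: power2_eq_square power3_eq_cube\<close>)
    then show ?thesis
      using eigenvector_value[where x = x, OF V E(1)[OF tx] E(2)[OF tx]] by (simp add: sum_distrib_left)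
  qed
  define z where "z j = (if j = 0 then x 0 else x (2 ^ n + 1 - j))" for j
  have zW: "z j = x (2 ^ n + 1 - j)" if "j \<in> ?W" for j using that by (simp add: z_def)
  have z_pos: "0 \<le> z j" if "j \<in> ?V" for j
    using that x[of 0] x[of "2 ^ n + 1 - j"] by (auto simp: z_def intro: less_imp_le)
  have zS: "class_sum 2 n z c = ?S (5 - c)" if "c \<in> {1..4}" for c
  proof -
    have "class_sum 2 n z c = class_sum 2 n (\<lambda>j. x (2 ^ n + 1 - j)) c"
      unfolding class_sum_def by (rule sum.cong) (use zW in auto)
    also have "\<dots> = ?S (5 - c)" using class_sum_reversal[of 2 n c x] n that by simp
    finally show ?thesis .
  qed
  have "Lag (gam n) z = Lag (gam n) (\<lambda>j. x (2 ^ n + 1 - j))"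
    by (rule Lag_cong_gam[OF n2]) (rule zW)
  then have "Lag (gam n) z = Lag (gam n) x" using Lag_gam_reversal[OF n2] by simp
  then have "Lag (edges ?X) z = Lag (edges ?X) x"
    unfolding LagT[OF tx] Lag_pairs using zS[of 1] zS[of 2] zS[of 3] zS[of 4] by (simp add: z_def)
  moreover have "(\<Sum>j\<in>?V. z j ^ 3) = (\<Sum>j\<in>?V. x j ^ 3)"
  proof -
    have "(\<Sum>j\<in>?W. z j ^ 3) = (\<Sum>j\<in>?W. x (2 ^ n + 1 - j) ^ 3)" by (rule sum.cong) (use zW in auto)
    also have "\<dots> = (\<Sum>j\<in>?W. x j ^ 3)" by (rule sum.reindex_bij_betw[OF bij_reversal])
    finally show ?thesis unfolding W by (simp add: z_def)
  qed
  ultimately have z_val: "3 * Lag (edges ?X) z = l * (\<Sum>j\<in>?V. z j ^ 3)" using value_x by simp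
  \<comment> \<open>Equality in the AM-GM bound makes z / x constant on an edge through the hub, and
    at the hub the ratio is 1.\<close>
  have zx: "z i = x i" if i: "i \<in> ?V" for i
  proof (cases "i = 0")
    case False
    obtain k where k: "{i, 0, k} \<in> edges ?X" using hub[OF tx i False] by blast
    have "z i / x i = z 0 / x 0"
      by (rule eigenvector_bound(2)[OF V E(1)[OF tx] E(2)[OF tx] x z_pos xeig z_val k]) auto
    then show ?thesis using x[OF i] x[OF h] by (simp add: z_def)
  qed (simp add: z_def)
  have "class_sum 2 n z c = ?S c" for c
    unfolding class_sum_def by (rule sum.cong) (use zx in auto)
  then have S: "?S 4 = ?S 1" "?S 3 = ?S 2" using zS[of 1] zS[of 2] by simp_all
  have YX: "Lag (edges ?Y) x = Lag (edges ?X) x + x 0 * (?S 1 - ?S 2)\<^sup>2"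
    unfolding LagT[OF tx] LagT[OF ty] Lag_pairs S by (simp add: algebra_simps power2_eq_square)
  have "l < m"
  proof (rule ccontr)
    assume "\<not> l < m"
    have "3 * Lag (edges ?Y) x \<le> m * (\<Sum>j\<in>?V. x j ^ 3)"
      by (rule eigenvector_bound(1)[OF V E(1)[OF ty] E(2)[OF ty] y _ yeig]) (use x in \<open>auto intro: less_imp_le\<close>)
    also have "\<dots> \<le> l * (\<Sum>j\<in>?V. x j ^ 3)"
      using \<open>\<not> l < m\<close> x by (intro mult_right_mono sum_nonneg) (auto intro: less_imp_le)
    also have "\<dots> = 3 * Lag (edges ?X) x" using value_x by simp
    finally have "x 0 * (?S 1 - ?S 2)\<^sup>2 \<le> 0" using YX by simp
    then have "?S 1 = ?S 2" using x[OF h] by (simp add: mult_le_0_iff)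
    have Sc: "?S c = ?S 1" if "c \<in> {1..4}" for c
    proof -
      have "c \<in> {1,2,3,4}" using that by auto
      then show ?thesis using S \<open>?S 1 = ?S 2\<close> by auto
    qed
    have "0 < ?S 1"
      unfolding class_sum_def
    proof (rule sum_pos)
      have "1 \<in> {j. j \<in> ?W \<and> cls 2 j = 1}" by (simp add: cls_def)
      then show "{j. j \<in> ?W \<and> cls 2 j = 1} \<noteq> {}" by blast
    qed (use x in auto)
    \<comment> \<open>The hub edges through \<open>j\<close> contribute x_0 times the sum over the
      class matched with that of \<open>j\<close>. By balance this is the same number for every
      \<open>j\<close>, and it becomes the initial \<kappa>.\<close>
    show False
    proof (rule not_balanced[OF n2, of x "x 0 * ?S 1" l "?S 1"])
      show "\<And>j. j \<in> ?W \<Longrightarrow> 0 < x j" using x by simp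
      show "0 < x 0 * ?S 1" using x[OF h] \<open>0 < ?S 1\<close> by simp
      show "pd (gam n) j x + x 0 * ?S 1 = l * x j ^ 2" if j: "j \<in> ?W" for j
      proof -
        have jV: "j \<in> ?V" "j \<noteq> 0" using j by auto
        have "pd (edges ?X) j x = Lag (edges ?X) (x(j := x j + 1)) - Lag (edges ?X) x"
          by (rule pd_eq_diff) (use finite_edges[OF V E(1)[OF tx]] in auto)
        also have "\<dots> = (Lag (gam n) (x(j := x j + 1)) - Lag (gam n) x) +
            x 0 * (Lag TX (?S(cls 2 j := ?S (cls 2 j) + 1)) - Lag TX ?S)"
          unfolding LagT[OF tx] class_sum_upd[OF j] using jV(2) by (simp add: algebra_simps)
        also have "Lag (gam n) (x(j := x j + 1)) - Lag (gam n) x = pd (gam n) j x"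
          by (rule pd_eq_diff[symmetric]) (use finite_gam[OF n2] finite_gam_edge[OF n2] in auto)
        also have "Lag TX (?S(cls 2 j := ?S (cls 2 j) + 1)) - Lag TX ?S = ?S 1"
          by (rule pd_Lag_pairs[OF _ Sc]) (use cls_in[of 2 j] in auto)
        finally show ?thesis using xeig[OF jV(1)] by simp
      qed
      show "\<And>c. c \<in> {1..4} \<Longrightarrow> ?S c = ?S 1" by (rule Sc)
    qed
  qed
  have links: "(\<Sum>is\<in>links (edges (hubgraph n T)) i. w (is ! 0) * w (is ! 1) / 2) =
      pd (edges (hubgraph n T)) i w" if "T = TX \<or> T = TY" for T i and w :: "nat \<Rightarrow> real"
    by (rule links_sum_eq_pd[OF V E[OF that]])
  have "poly (characteristic_polynomial 3 ?X) (of_real m) \<noteq> 0"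
  proof (rule characteristic_polynomial_neq_0[where x = x and l = l])
    show "finite (vertices ?X)" "edges ?X \<subseteq> Pow (vertices ?X)"
      unfolding verT by (rule V, rule E[OF tx])
    show "0 < x i" if "i \<in> vertices ?X" for i using x that unfolding verT by blast
    show "(\<Sum>is\<in>links (edges ?X) i. x (is ! 0) * x (is ! 1) / 2) \<le> l * x i ^ 2"
      if "i \<in> vertices ?X" for i
      unfolding links[OF tx] using xeig that unfolding verT by simp
  qed (rule \<open>l < m\<close>)
  moreover have "poly (characteristic_polynomial 3 ?Y) (of_real m) = 0"
  proof -
    \<comment> \<open>\<open>2 ^ n\<close> is the greatest vertex, and its hub edge carries chips
      from the least vertex 0 to it.\<close>
    obtain k where k: "{2 ^ n, 0, k} \<in> edges ?Y" using hub[OF ty, of "2 ^ n"] by auto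
    show ?thesis
    proof (rule characteristic_polynomial_eq_0[where x = y and h = 0 and v = "2 ^ n" and ?k0.0 = k])
      show "finite (vertices ?Y)" "edges ?Y \<subseteq> Pow (vertices ?Y)"
        unfolding verT by (rule V, rule E[OF ty])
      show "card e = 3" if "e \<in> edges ?Y" for e by (rule E(2)[OF ty that])
      show "{0, 2 ^ n, k} \<in> edges ?Y" using k by (simp add: insert_commute)
      show "\<exists>k. {i, 0, k} \<in> edges ?Y" if "i \<in> vertices ?Y" "i \<noteq> 0" for i
        using hub[OF ty _ that(2)] that(1) unfolding verT by blast
      show "0 < y i" if "i \<in> vertices ?Y" for i using y that unfolding verT by blast
      show "(\<Sum>is\<in>links (edges ?Y) i. y (is ! 0) * y (is ! 1) / 2) = m * y i ^ 2"
        if "i \<in> vertices ?Y" for i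
        unfolding links[OF ty] using yeig that unfolding verT by blast
    qed (simp_all only: verT, auto)
  qed
  ultimately show ?thesis by metis
qed

theorem corollary3p14:
  fixes n :: nat
  assumes "3 \<le> n"
  shows "\<exists>X Y :: nat hypergraph.
    uniform_hypergraph 3 X \<and> vertices X = {0..2 ^ n} \<and> lagrangian X = X_poly n \<and>
    uniform_hypergraph 3 Y \<and> vertices Y = {0..2 ^ n} \<and> lagrangian Y = Y_poly n \<and>
    hypomorphic X Y \<and>
    characteristic_polynomial 3 X \<noteq> characteristic_polynomial 3 Y"
proof (intro exI conjI)
  have n: "2 \<le> n" using assms by simp
  show "uniform_hypergraph 3 (hubgraph n TX)" "uniform_hypergraph 3 (hubgraph n TY)"
    by (rule uniform_hubgraph[OF n]; auto)+
  show "vertices (hubgraph n TX) = {0..2 ^ n}" "vertices (hubgraph n TY) = {0..2 ^ n}"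
    by (simp_all add: hubgraph_def)
qed (use assms lagrangian_hubgraph hypomorphic_hubgraph characteristic_polynomials_differ in blast)+

end
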